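(* Let $\mathbb H$ be the open upper half-plane, let $F:\mathbb H\to\mathbb C$ be holomorphic, and suppose that (i) $F$ admits a convergent $q$-expansion at the cusp $i\infty$ of the form $F(\tau)=\sum_{n=0}^\infty a_n\,q^{n+\alpha}$ with $a_n\in\mathbb C$, $a_0\neq0$, and $\alpha>0$ real (the expansion being valid for $\operatorname{Im}\tau$ sufficiently large); (ii) $F\!\left(-\tfrac1{3\tau}\right)=1-F(\tau)$ for all $\tau\in\mathbb H$; (iii) the derivative $f:=dF/d\tau$ is nowhere vanishing on $\mathbb H$. Then $\alpha=1/3$ and $F(\tau)=\widetilde\Pi_h^{\mathrm{par}}(\tau)$ for all $\tau\in\mathbb H$, where $\widetilde\Pi_h^{\mathrm{par}}$ is the holomorphic extension to $\mathbb H$ of the function $\tau\mapsto\Pi_h^{\mathrm{par}}(-i\sqrt3\,\tau)$, $\tau\in i\mathbb R_{>0}$.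
   Context: Here $q^{n+\alpha}:=e^{2\pi i(n+\alpha)\tau}$. For $r>0$, $P_r\subset\mathbb C$ is the closed parallelogram with vertices $0,\ r,\ r+e^{i\pi/3},\ e^{i\pi/3}$ in cyclic order. $\Delta\subset\mathbb C$ is the closed equilateral triangle with vertices $0,1,e^{i\pi/3}$. Cardy--Smirnov function of $P_r$ (defined purely conformally, as a Carleson length). Let $g:P_r\to\Delta$ be the unique homeomorphism that is conformal (biholomorphic) between the interiors and satisfies $g(0)=0$, $g(r+e^{i\pi/3})=1$, $g(e^{i\pi/3})=e^{i\pi/3}$. Then $g(r)\in(0,1)$, and $\Pi_h^{\mathrm{par}}(r):=1-g(r)$, the Euclidean length of the segment $[g(r),1]$. The function $\tau\mapsto\Pi_h^{\mathrm{par}}(-i\sqrt3\,\tau)$ on $i\mathbb R_{>0}$ has a (necessarily unique) holomorphic extension $\widetilde\Pi_h^{\mathrm{par}}$ to $\mathbb H$, explicitly $\widetilde\Pi_h^{\mathrm{par}}(\tau)=c_\eta\int_{i\infty}^\tau\eta(z)^2\eta(3z)^2\,dz$ with $c_\eta=\frac{12\pi^2 i}{\sqrt3\,\Gamma(1/3)^3}$ and $\eta(\tau)=q^{1/24}\prod_{n\ge1}(1-q^n)$, $q=e^{2\pi i\tau}$, the Dedekind eta function. *)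

theory Defs
  imports "HOL-Complex_Analysis.Complex_Analysis"
begin

definition upper_half_plane :: "complex set" where
  "upper_half_plane = {z. Im z > 0}"

definition parallelogram :: "real \<Rightarrow> complex set" where
  "parallelogram r =
     convex hull {0, of_real r, of_real r + cis (pi / 3), cis (pi / 3)}"

definition equilateral_triangle :: "complex set" where
  "equilateral_triangle = convex hull {0, 1, cis (pi / 3)}"

text \<open>The normalised conformal maps of a parallelogram onto the triangle: homeomorphisms of the
  closed regions that are biholomorphic between the interiors.\<close>

definition is_carleson_map :: "real \<Rightarrow> (complex \<Rightarrow> complex) \<Rightarrow> bool" where
  "is_carleson_map r g \<longleftrightarrow>
     (\<exists>h. homeomorphism (parallelogram r) equilateral_triangle g h \<and>
          g ` interior (parallelogram r) = interior equilateral_triangle \<and>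
          g holomorphic_on interior (parallelogram r) \<and>
          h holomorphic_on interior equilateral_triangle) \<and>
     g 0 = 0 \<and>
     g (of_real r + cis (pi / 3)) = 1 \<and>
     g (cis (pi / 3)) = cis (pi / 3)"

text \<open>The map is unique as a function on the closed parallelogram only; membership in
  \<^const>\<open>extensional\<close> fixes its irrelevant values elsewhere.\<close>

definition carleson_map :: "real \<Rightarrow> complex \<Rightarrow> complex" where
  "carleson_map r = (THE g. g \<in> extensional (parallelogram r) \<and> is_carleson_map r g)"

text \<open>Complex-valued for convenience: the value of the map at \<open>r\<close> lies in the real interval
  \<open>(0,1)\<close>, so this is the length of the segment from that value to \<open>1\<close>.\<close>

definition Pi_h_par :: "real \<Rightarrow> complex" where
  "Pi_h_par r = 1 - carleson_map r (of_real r)"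

text \<open>The holomorphic extension of \<open>\<tau> \<mapsto> Pi_h_par (- \<i> sqrt 3 \<tau>)\<close> from the positive imaginary axis
  to the upper half-plane. With \<open>\<tau> = \<i> t\<close> the argument is \<open>sqrt 3 t\<close>.\<close>

definition Pi_h_par_ext :: "complex \<Rightarrow> complex" where
  "Pi_h_par_ext = (THE G. G \<in> extensional upper_half_plane \<and>
     G holomorphic_on upper_half_plane \<and>
     (\<forall>t::real. t > 0 \<longrightarrow> G (\<i> * of_real t) = Pi_h_par (sqrt 3 * t)))"

end

theory Submission
  imports Defs "HOL-Real_Asymp.Real_Asymp"
begin

text \<open>Let \<open>N w\<close> be the hypergeometric period \<open>cubic_period w\<close> and parametrise the upper half-plane by
  \<open>tau z = \<i> / sqrt 3 * N (1 - z) / N z\<close>, so that \<open>z \<mapsto> 1 - z\<close> corresponds to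
  \<open>\<tau> \<mapsto> - 1 / (3 \<tau>)\<close> and crossing the cut \<open>(1, \<infinity>)\<close> of \<open>tau\<close> to \<open>\<tau> \<mapsto> \<tau> + 1\<close>. At the fixed
  point of \<open>\<tau> \<mapsto> 1 - 1 / (3 \<tau>)\<close> the two transformation laws of \<open>f = deriv F\<close> are compatible with
  \<open>f \<noteq> 0\<close> only if \<open>cis (2 \<pi> \<alpha>) = cis (2 \<pi> / 3)\<close>. Therefore
  \<open>f (tau z) (z (1 - z))\<^bsup>-1/3\<^esup> / (N z)\<^sup>2\<close> is single-valued, is symmetric under \<open>z \<mapsto> 1 - z\<close>, has
  removable singularities at \<open>0\<close> and \<open>1\<close> and is bounded, hence constant by Liouville. If
  \<open>\<alpha> \<ge> 4/3\<close> it would tend to \<open>0\<close> at \<open>1\<close>; thus \<open>\<alpha> = 1/3\<close>. The Wronskian of \<open>N z\<close> and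
  \<open>N (1 - z)\<close> is \<open>const / (z (1 - z))\<close>, so \<open>F (tau x)\<close> has derivative \<open>const * (x (1 - x))\<^bsup>-2/3\<^esup>\<close> on
  \<open>(0, 1)\<close>. This is the Schwarz--Christoffel integrand of the equilateral triangle, and the
  Schwarz--Christoffel map of the parallelogram with prevertices \<open>0, 1, 1 / (1 - x), \<infinity>\<close> has side
  ratio \<open>N (1 - x) / N x\<close>; this identifies \<open>F\<close> with the Cardy--Smirnov function on the imaginary
  axis.\<close>

text \<open>The exponents in \<open>pullback\<close> match the growth of the period. For
  \<open>Re z >= 1/2\<close> a sector estimate keeps \<open>tau z\<close> at a fixed height above
  the real line, so translation and cusp decay bound \<open>deriv F\<close> there, and
  \<open>1 / (cubic_period z)\<^sup>2\<close> grows at most like \<open>norm z powr (2/3)\<close>,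
  which the two powers \<open>-1/3\<close> cancel. The symmetry \<open>z -> 1 - z\<close> covers the
  other half-plane, so the argument stays in the z-plane. The fixed point determines \<alpha> only
  modulo 1. The next candidate 4/3 is so far from 1/3 that crude rational constants in the
  logarithmic estimate at the cusp exclude it. The Wronskian constant and the scales of the polygon
  maps stay unevaluated; the limits of \<open>F\<close> at the two ends of \<open>(0, 1)\<close> fix
  their ratio. On the geometric side a Schwarz--Christoffel integral is at first only locally
  injective. Global injectivity is read off from the boundary, whose image runs once along the
  sides. The triangle and every parallelogram share the prevertices \<open>0\<close>,
  \<open>1\<close>, \<open>\<infinity>\<close> at the corners that normalise the Carleson map; the
  fourth corner carries the modulus.\<close>

section \<open>Injectivity from boundary values\<close>

text \<open>The boundary values trace a Jordan curve, which winds at most once around any point off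
  it. Two preimages of one value \<open>w\<close> would force winding number at least 2 by the
  argument principle. As \<open>f\<close> is merely continuous on the circle, zeros are counted
  inside a slightly smaller circle whose image has the same winding number.\<close>

lemma holomorphic_inj_on_ball_if_inj_on_sphere:
  fixes f :: "complex \<Rightarrow> complex"
  assumes cont: "continuous_on (cball 0 1) f" and hol: "f holomorphic_on ball 0 1"
    and inj: "inj_on f (sphere 0 1)" and disj: "f ` ball 0 1 \<inter> f ` sphere 0 1 = {}"
  shows "inj_on f (cball 0 1)"
proof -
  have inj_ball: "z1 = z2" if z: "z1 \<in> ball 0 1" "z2 \<in> ball 0 1" and eq: "f z1 = f z2" for z1 z2
  proof (rule ccontr)
    assume ne: "z1 \<noteq> z2"
    define w where "w = f z1"
    have w_notin: "w \<notin> f ` sphere 0 1" using disj z unfolding w_def by blast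
    have "compact (f ` sphere 0 1)"
      by (intro compact_continuous_image continuous_on_subset[OF cont]) auto
    then obtain d where d: "d > 0" "\<And>x. x \<in> f ` sphere 0 1 \<Longrightarrow> d \<le> dist w x"
      using separate_point_closed[of "f ` sphere 0 1" w] w_notin compact_imp_closed by metis
    have "uniformly_continuous_on (cball 0 1) f"
      by (intro compact_uniformly_continuous cont) auto
    then obtain e where e: "e > 0"
      "\<And>x y. x \<in> cball 0 1 \<Longrightarrow> y \<in> cball 0 1 \<Longrightarrow> dist y x < e \<Longrightarrow> dist (f y) (f x) < d"
      unfolding uniformly_continuous_on_def using d(1) by meson
    \<comment> \<open>Within \<open>e\<close> of the unit circle, so that the two image loops differ
      by less than the distance \<open>d\<close> of \<open>w\<close> from the boundary curve, and
      beyond both \<open>z1\<close> and \<open>z2\<close>; the entry \<open>1/2\<close> secures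
      positivity.\<close>
    define \<rho> where "\<rho> = Max {1 - e/2, (1 + norm z1)/2, (1 + norm z2)/2, 1/2}"
    have "1 - e/2 \<le> \<rho>" "(1 + norm z1)/2 \<le> \<rho>" "(1 + norm z2)/2 \<le> \<rho>" "1/2 \<le> \<rho>"
      unfolding \<rho>_def by (rule Max_ge; simp)+
    then have \<rho>: "\<rho> < 1" "norm z1 < \<rho>" "norm z2 < \<rho>" "1 - e < \<rho>" "\<rho> > 0"
      using z e(1) by (auto simp: \<rho>_def)
    define g1 where "g1 = f \<circ> circlepath 0 1"
    define gr where "gr = f \<circ> circlepath 0 \<rho>"
    have c1: "path_image (circlepath (0::complex) 1) = sphere 0 1" by simp
    have cr: "path_image (circlepath (0::complex) \<rho>) = sphere 0 \<rho>" using \<rho> by simp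
    have path1: "path g1" unfolding g1_def
      by (intro path_continuous_image continuous_on_subset[OF cont]) auto
    have vr: "valid_path gr" unfolding gr_def
      by (rule valid_path_compose_holomorphic[OF _ hol]) (use \<rho> in auto)
    have simple: "simple_path g1" unfolding g1_def
      by (rule simple_path_continuous_image)
         (use inj in \<open>auto intro!: continuous_on_subset[OF cont] simp: simple_path_circlepath\<close>)
    have close: "norm (gr t - g1 t) < norm (g1 t - w)" if "t \<in> {0..1}" for t
    proof -
      define c where "c = circlepath (0::complex) 1 t"
      have c: "norm c = 1" unfolding c_def circlepath by simp
      have cr: "circlepath 0 \<rho> t = of_real \<rho> * c" unfolding c_def circlepath by simp
      have "dist (of_real \<rho> * c) c = norm ((of_real \<rho> - 1) * c)" by (simp add: dist_norm algebra_simps)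
      also have "\<dots> = \<bar>\<rho> - 1\<bar>" using c norm_of_real[of "\<rho> - 1", where 'a = complex] by (simp add: norm_mult)
      finally have "dist (of_real \<rho> * c) c < e" using \<rho> by auto
      then have "dist (f (of_real \<rho> * c)) (f c) < d"
        by (intro e) (use c \<rho> in \<open>auto simp: norm_mult\<close>)
      also have "d \<le> dist w (f c)" using d(2)[of "f c"] c by auto
      finally show ?thesis
        by (simp add: gr_def g1_def cr c_def[symmetric] dist_norm norm_minus_commute)
    qed
    have wn_eq: "winding_number gr w = winding_number g1 w"
      using path1 vr close by (intro winding_number_nearby_loops_eq)
        (auto simp: valid_path_imp_path g1_def gr_def pathfinish_compose pathstart_compose)
    have wn1: "winding_number g1 w \<in> {-1,0,1}"
      using simple w_notin by (intro simple_closed_path_winding_number_cases)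
        (auto simp: g1_def pathfinish_compose pathstart_compose path_image_compose)
    define h where "h = (\<lambda>z. f z - w)"
    define pz where "pz = {p\<in>ball 0 1. h p = 0}"
    have holh: "h holomorphic_on ball 0 1" unfolding h_def by (intro holomorphic_intros hol)
    have pz_notin: "w \<notin> gr ` {0..1}" using close by (metis imageE norm_minus_commute order_less_irrefl)
    have noncst: "\<exists>z\<in>ball 0 1. h z \<noteq> 0"
    proof -
      have "gr 0 \<noteq> w" using pz_notin by force
      then show ?thesis using \<rho> by (intro bexI[of _ "circlepath 0 \<rho> 0"]) (auto simp: gr_def h_def circlepath)
    qed
    \<comment> \<open>In the collar outside radius \<rho> the values of \<open>f\<close> are within
      \<open>d\<close> of the boundary curve, so \<open>w\<close> is not attained there.\<close>
    have pz_sub: "pz \<subseteq> cball 0 \<rho>"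
    proof
      fix p assume p: "p \<in> pz"
      show "p \<in> cball 0 \<rho>"
      proof (rule ccontr)
        assume "p \<notin> cball 0 \<rho>"
        then have np: "norm p > \<rho>" "norm p < 1" "h p = 0" using p by (auto simp: pz_def)
        define c where "c = p / norm p"
        have c: "norm c = 1" using np \<rho> by (auto simp: c_def norm_divide)
        have "p - c = of_real (1 - 1 / norm p) * p" by (simp add: c_def algebra_simps)
        then have "dist p c = \<bar>1 - 1 / norm p\<bar> * norm p"
          by (simp only: dist_norm norm_mult norm_of_real)
        also have "\<dots> = 1 - norm p" using np \<rho> by (auto simp: abs_if field_simps)
        finally have "dist p c < e" using np \<rho> by auto
        then have "dist (f p) (f c) < d" by (intro e) (use c np in auto)
        moreover have "d \<le> dist w (f c)" using d(2)[of "f c"] c by auto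
        ultimately show False using np by (simp add: h_def)
      qed
    qed
    have fin: "finite pz"
    proof -
      have "finite {z \<in> cball 0 \<rho>. h z = 0}"
      proof (rule holomorphic_compact_finite_zeros[OF holh])
        have "h z1 = 0" by (simp add: h_def w_def)
        then show "\<not> h constant_on ball 0 1"
          using noncst z(1) by (metis constant_on_def)
      qed (use \<rho> in auto)
      moreover have "pz \<subseteq> {z \<in> cball 0 \<rho>. h z = 0}" using pz_sub by (auto simp: pz_def)
      ultimately show ?thesis by (rule rev_finite_subset)
    qed
    have off: "p \<in> ball 0 \<rho>" if "p \<in> pz" for p
    proof -
      have "norm p \<noteq> \<rho>"
      proof
        assume "norm p = \<rho>"
        then have "p \<in> path_image (circlepath 0 \<rho>)" using \<rho> by simp
        then have "f p \<in> gr ` {0..1}" unfolding gr_def path_image_def by auto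
        then show False using pz_notin that by (auto simp: pz_def h_def)
      qed
      then show ?thesis using pz_sub that by force
    qed
    have ci: "contour_integral (circlepath 0 \<rho>) (\<lambda>x. deriv h x * 1 / h x) = 2 * pi * \<i> *
        (\<Sum>p\<in>{w\<in>ball 0 1. h w = 0 \<or> w \<in> {}}. winding_number (circlepath 0 \<rho>) p * 1 * zorder h p)"
    proof (rule argument_principle)
      show "path_image (circlepath 0 \<rho>) \<subseteq> ball 0 1 - {w \<in> ball 0 1. h w = 0 \<or> w \<in> {}}"
        using off \<rho> by (fastforce simp: pz_def)
      show "\<forall>z. z \<notin> ball 0 1 \<longrightarrow> winding_number (circlepath 0 \<rho>) z = 0"
        using \<rho> by (auto intro!: winding_number_zero_outside[of _ "cball 0 \<rho>"])
      show "finite {w \<in> ball 0 1. h w = 0 \<or> w \<in> {}}" using fin by (simp add: pz_def)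
    qed (use holh in auto)
    have "{w\<in>ball 0 1. h w = 0 \<or> w \<in> {}} = pz" by (auto simp: pz_def)
    moreover have "(\<Sum>p\<in>pz. winding_number (circlepath 0 \<rho>) p * 1 * zorder h p) = of_int (\<Sum>p\<in>pz. zorder h p)"
      unfolding of_int_sum using off by (intro sum.cong) (auto simp: winding_number_circlepath)
    ultimately have ci': "contour_integral (circlepath 0 \<rho>) (\<lambda>x. deriv h x / h x) = 2 * pi * \<i> * of_int (\<Sum>p\<in>pz. zorder h p)"
      using ci by simp
    have zpos: "zorder h p \<ge> 1" if "p \<in> pz" for p
      using zorder_exist_zero[OF holh _ _ _ noncst, of p] that by (auto simp: pz_def split: if_splits)
    have "(\<Sum>p\<in>{z1,z2}. zorder h p) \<le> (\<Sum>p\<in>pz. zorder h p)"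
    proof (rule sum_mono2[OF fin])
      show "{z1, z2} \<subseteq> pz" using z eq by (auto simp: pz_def h_def w_def)
      show "0 \<le> zorder h p" if "p \<in> pz - {z1, z2}" for p using zpos[of p] that by auto
    qed
    moreover have "(\<Sum>p\<in>{z1,z2}. zorder h p) \<ge> 2"
    proof -
      have "zorder h z1 \<ge> 1" "zorder h z2 \<ge> 1" using zpos z eq by (auto simp: pz_def h_def w_def)
      then show ?thesis using ne by simp
    qed
    ultimately have two: "(\<Sum>p\<in>pz. zorder h p) \<ge> 2" by linarith
    have "contour_integral gr (\<lambda>u. 1 / (u - w)) = contour_integral (circlepath 0 \<rho>) (\<lambda>x. deriv f x * (1 / (f x - w)))"
      unfolding gr_def
      by (rule contour_integral_comp_analyticW[of _ "ball 0 1"]) (use \<rho> hol analytic_on_open in auto)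
    also have "\<dots> = contour_integral (circlepath 0 \<rho>) (\<lambda>x. deriv h x / h x)"
    proof (rule contour_integral_cong)
      fix x assume "x \<in> path_image (circlepath 0 \<rho>)"
      then have "x \<in> ball 0 1" using \<rho> by auto
      then have "f field_differentiable at x" using hol holomorphic_on_imp_differentiable_at by blast
      then have "deriv h x = deriv f x" unfolding h_def by simp
      then show "deriv f x * (1 / (f x - w)) = deriv h x / h x" by (simp add: h_def)
    qed simp
    finally have "winding_number gr w = of_int (\<Sum>p\<in>pz. zorder h p)"
      using winding_number_valid_path[OF vr, of w] pz_notin unfolding ci' path_image_def by simp
    then have "(of_int (\<Sum>p\<in>pz. zorder h p) :: complex) \<in> of_int ` {-1,0,1}"
      using wn1 wn_eq by simp
    then have "(\<Sum>p\<in>pz. zorder h p) \<in> {-1,0,1}"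
      unfolding image_iff of_int_eq_iff by blast
    then show False using two by auto
  qed
  show ?thesis
  proof (rule inj_onI)
    fix x y :: complex assume xy: "x \<in> cball 0 1" "y \<in> cball 0 1" "f x = f y"
    have "cball (0::complex) 1 = ball 0 1 \<union> sphere 0 1" by auto
    then show "x = y" using xy inj_ball inj disj unfolding inj_on_def by blast
  qed
qed

text \<open>By the open mapping theorem the frontier of the compact image comes from the circle,
  hence lies in \<open>frontier P\<close>. A connected set disjoint from \<open>frontier P\<close>
  is then either inside the image or disjoint from it. This is applied to \<open>- P\<close>,
  connected as the complement of a bounded convex set in the plane, and to
  \<open>interior P\<close>.\<close>

lemma holomorphic_ball_image_eq_interior:
  fixes f :: "complex \<Rightarrow> complex"
  assumes cont: "continuous_on (cball 0 1) f" and hol: "f holomorphic_on ball 0 1"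
    and nc: "\<not> f constant_on ball 0 1"
    and P: "compact P" "convex P" and sph: "f ` sphere 0 1 \<subseteq> frontier P"
  shows "f ` ball 0 1 = interior P" "f ` cball 0 1 = P"
proof -
  define X where "X = f ` cball 0 1"
  have X: "compact X" unfolding X_def by (intro compact_continuous_image cont) auto
  have opn: "open (f ` ball 0 1)"
    by (rule open_mapping_thm[OF hol]) (use nc in auto)
  have cb: "cball (0::complex) 1 = ball 0 1 \<union> sphere 0 1" by auto
  have frX: "frontier X \<subseteq> frontier P"
  proof -
    have "f ` ball 0 1 \<subseteq> interior X" using opn by (intro interior_maximal) (auto simp: X_def)
    moreover have "closure X = X" using X by (simp add: compact_imp_closed closure_closed)
    ultimately have "frontier X \<subseteq> f ` sphere 0 1" unfolding frontier_def X_def cb by blast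
    then show ?thesis using sph by blast
  qed
  have frP: "frontier P \<subseteq> P" using P by (simp add: compact_imp_closed frontier_subset_closed)
  have XP: "X \<subseteq> P"
  proof (rule ccontr)
    assume "\<not> X \<subseteq> P"
    have "(- P) \<inter> frontier X \<noteq> {}"
    proof (rule connected_Int_frontier)
      show "connected (- P)"
        using P by (intro connected_complement_bounded_convex) (auto simp: compact_imp_bounded)
      show "(- P) \<inter> X \<noteq> {}" using \<open>\<not> X \<subseteq> P\<close> by blast
      show "- P - X \<noteq> {}"
      proof
        assume "- P - X = {}"
        then have "UNIV = P \<union> X" by blast
        moreover have "bounded (P \<union> X)" using P X by (simp add: compact_imp_bounded)
        ultimately show False by (metis not_bounded_UNIV)
      qed
    qed
    then show False using frX frP by blast
  qed
  have sub: "f ` ball 0 1 \<subseteq> interior P"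
    using opn XP by (intro interior_maximal) (auto simp: X_def)
  have "interior P \<subseteq> X"
  proof (rule ccontr)
    assume *: "\<not> interior P \<subseteq> X"
    have "interior P \<inter> frontier X \<noteq> {}"
    proof (rule connected_Int_frontier)
      show "connected (interior P)" using P by (simp add: convex_connected convex_interior)
      have "f 0 \<in> interior P" "f 0 \<in> X" using sub by (auto simp: X_def)
      then show "interior P \<inter> X \<noteq> {}" by blast
    qed (use * in blast)
    then show False using frX by (auto simp: frontier_def)
  qed
  then have "interior P \<subseteq> f ` ball 0 1" using sph unfolding X_def cb frontier_def by blast
  with sub show eq: "f ` ball 0 1 = interior P" by blast
  have "interior P \<noteq> {}" using eq by force
  then have "closure (interior P) = P"
    using P by (simp add: convex_closure_interior compact_imp_closed)
  moreover have "closure (interior P) \<subseteq> X"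
    using \<open>interior P \<subseteq> X\<close> X by (intro closure_minimal) (auto simp: compact_imp_closed)
  ultimately show "f ` cball 0 1 = P" using XP by (auto simp: X_def)
qed

section \<open>The cubic hypergeometric period\<close>

text \<open>Domination is assumed for the integrand alone. Cauchy's inequality on discs of radius
  about \<open>r/2\<close> turns \<open>g\<close> into a bound for the derivative, and the mean
  value inequality turns that into a bound for difference quotients, so dominated convergence
  applies along sequences tending to \<open>z0\<close>.\<close>

lemma has_field_derivative_integral_dominated:
  fixes f :: "complex \<Rightarrow> 'a \<Rightarrow> complex"
  assumes r: "r > 0"
    and hol: "\<And>x. x \<in> space M \<Longrightarrow> (\<lambda>z. f z x) holomorphic_on ball z0 r"
    and meas: "\<And>z. z \<in> ball z0 r \<Longrightarrow> f z \<in> borel_measurable M"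
    and meas': "(\<lambda>x. deriv (\<lambda>z. f z x) z0) \<in> borel_measurable M"
    and bound: "\<And>z x. z \<in> ball z0 r \<Longrightarrow> x \<in> space M \<Longrightarrow> norm (f z x) \<le> g x"
    and g: "integrable M g"
  shows "((\<lambda>z. integral\<^sup>L M (f z)) has_field_derivative integral\<^sup>L M (\<lambda>x. deriv (\<lambda>z. f z x) z0)) (at z0)"
proof -
  have int: "integrable M (f z)" if "z \<in> ball z0 r" for z
    by (rule Bochner_Integration.integrable_bound[OF g meas[OF that]])
       (use bound[OF that] in \<open>auto intro!: AE_I2 intro: order_trans[OF _ abs_ge_self]\<close>)
  define F where "F = (\<lambda>z. integral\<^sup>L M (f z))"
  define D where "D = integral\<^sup>L M (\<lambda>x. deriv (\<lambda>z. f z x) z0)"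
  have quot: "norm ((f z x - f z0 x) / (z - z0)) \<le> g x / (r/2)"
    if z: "z \<in> ball z0 (r/2)" "z \<noteq> z0" and x: "x \<in> space M" for z x
  proof -
    have "norm (f z x - f z0 x) \<le> (g x / (r/2)) * norm (z - z0)"
    proof (rule field_differentiable_bound[of "ball z0 (r/2)" "\<lambda>z. f z x" "deriv (\<lambda>z. f z x)"])
      fix w assume w: "w \<in> ball z0 (r/2)"
      have "((\<lambda>z. f z x) has_field_derivative deriv (\<lambda>z. f z x) w) (at w)"
        using w r by (intro holomorphic_derivI[OF hol[OF x]]) auto
      then show "((\<lambda>z. f z x) has_field_derivative deriv (\<lambda>z. f z x) w) (at w within ball z0 (r/2))"
        using has_field_derivative_at_within by blast
      have sub: "cball w (r/2 - \<epsilon>) \<subseteq> ball z0 r" if "\<epsilon> > 0" for \<epsilon>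
      proof
        fix y assume "y \<in> cball w (r/2 - \<epsilon>)"
        then show "y \<in> ball z0 r" using w that dist_triangle[of z0 y w] by auto
      qed
      have sub': "ball w (r/2) \<subseteq> ball z0 r"
      proof
        fix y assume "y \<in> ball w (r/2)"
        then show "y \<in> ball z0 r" using w dist_triangle[of z0 y w] by auto
      qed
      \<comment> \<open>Cauchy's inequality asks for a closed disc inside \<open>ball z0 r\<close>,
        hence the radius \<open>r/2 - \<epsilon>\<close>; afterwards \<epsilon> tends to 0.\<close>
      have "norm ((deriv ^^ 1) (\<lambda>z. f z x) w) \<le> fact 1 * g x / (r/2 - \<epsilon>) ^ 1"
        if e: "\<epsilon> > 0" "\<epsilon> < r/2" for \<epsilon>
      proof (rule Cauchy_inequality)
        show "(\<lambda>z. f z x) holomorphic_on ball w (r/2 - \<epsilon>)"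
          using sub[OF e(1)] by (intro holomorphic_on_subset[OF hol[OF x]]) auto
        show "continuous_on (cball w (r/2 - \<epsilon>)) (\<lambda>z. f z x)"
          using sub[OF e(1)] by (intro continuous_on_subset[OF holomorphic_on_imp_continuous_on[OF hol[OF x]]])
        show "norm (f y x) \<le> g x" if "norm (w - y) = r/2 - \<epsilon>" for y
          using sub[OF e(1)] that by (intro bound x) (auto simp: dist_norm subset_iff)
      qed (use e in auto)
      then have ev: "norm (deriv (\<lambda>z. f z x) w) \<le> g x / (r/2 - \<epsilon>)" if "\<epsilon> > 0" "\<epsilon> < r/2" for \<epsilon>
        using that by simp
      have lim: "((\<lambda>\<epsilon>. g x / (r/2 - \<epsilon>)) \<longlongrightarrow> g x / (r/2 - 0)) (at_right 0)"
        using r by (intro tendsto_intros) auto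
      have "eventually (\<lambda>\<epsilon>. norm (deriv (\<lambda>z. f z x) w) \<le> g x / (r/2 - \<epsilon>)) (at_right 0)"
        using ev r by (intro eventually_at_rightI[of 0 "r/2"]) auto
      from tendsto_lowerbound[OF lim this] show "norm (deriv (\<lambda>z. f z x) w) \<le> g x / (r/2)" by simp
    qed (use z r in auto)
    then show ?thesis using z by (simp add: norm_divide divide_le_eq)
  qed
  have "((\<lambda>z. (F z - F z0) / (z - z0)) \<longlongrightarrow> D) (at z0 within ball z0 (r/2))"
  proof (rule tendsto_at_iff_sequentially[THEN iffD2], intro allI impI)
    fix X assume X: "\<forall>i. X i \<in> ball z0 (r/2) - {z0}" and lim: "X \<longlonglongrightarrow> z0"
    have XX: "X i \<in> ball z0 (r/2)" "X i \<noteq> z0" "X i \<in> ball z0 r" for i using X[rule_format, of i] r by auto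
    have eq: "(F (X i) - F z0) / (X i - z0) = (\<integral>x. (f (X i) x - f z0 x) / (X i - z0) \<partial>M)" for i
      unfolding F_def using int[OF XX(3)] int[of z0] r by (simp add: diff_divide_distrib)
    have "(\<lambda>i. \<integral>x. (f (X i) x - f z0 x) / (X i - z0) \<partial>M) \<longlonglongrightarrow> D"
      unfolding D_def
    proof (rule integral_dominated_convergence)
      show "integrable M (\<lambda>x. g x / (r/2))" using g by simp
      show "(\<lambda>x. (f (X i) x - f z0 x) / (X i - z0)) \<in> borel_measurable M" for i
        using meas[OF XX(3)] meas[of z0] r
        by (intro borel_measurable_divide borel_measurable_diff) auto
      show "AE x in M. norm ((f (X i) x - f z0 x) / (X i - z0)) \<le> g x / (r/2)" for i
        using quot[OF XX(1,2)] by (auto intro!: AE_I2)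
      show "AE x in M. (\<lambda>i. (f (X i) x - f z0 x) / (X i - z0)) \<longlonglongrightarrow> deriv (\<lambda>z. f z x) z0"
      proof (rule AE_I2)
        fix x assume x: "x \<in> space M"
        have "((\<lambda>z. f z x) has_field_derivative deriv (\<lambda>z. f z x) z0) (at z0)"
          using r by (intro holomorphic_derivI[OF hol[OF x]]) auto
        then have "((\<lambda>z. (f z x - f z0 x) / (z - z0)) \<longlongrightarrow> deriv (\<lambda>z. f z x) z0) (at z0)"
          by (simp add: has_field_derivative_iff)
        moreover have "filterlim X (at z0) sequentially"
          using lim XX(2) by (simp add: filterlim_at)
        ultimately show "(\<lambda>i. (f (X i) x - f z0 x) / (X i - z0)) \<longlonglongrightarrow> deriv (\<lambda>z. f z x) z0"
          by (rule filterlim_compose)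
      qed
    qed (rule meas')
    then show "((\<lambda>z. (F z - F z0) / (z - z0)) \<circ> X) \<longlonglongrightarrow> D"
      by (simp add: eq o_def)
  qed
  then show ?thesis using r unfolding F_def D_def
    by (simp add: has_field_derivative_iff at_within_open[of z0 "ball z0 (r/2)"])
qed

section \<open>Euler-type integrals on the slit plane\<close>

lemma set_integrable_powr_mult_powr:
  fixes p b :: real
  assumes "p > -1" "b \<le> 0" "p + b < -1"
  shows "set_integrable lborel {0<..} (\<lambda>v. v powr p * (1 + v) powr b)"
proof -
  have abs: "set_integrable lborel A f" if "f integrable_on A" "\<And>x. x \<in> A \<Longrightarrow> f x \<ge> 0" "A \<in> sets borel"
     "f \<in> borel_measurable borel" for A and f :: "real \<Rightarrow> real"
  proof -
    have "f absolutely_integrable_on A" using that by (intro nonnegative_absolutely_integrable_1)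
    then show ?thesis using that
      by (simp add: set_integrable_def integrable_completion)
  qed
  have 1: "set_integrable lborel {0..1} (\<lambda>v. v powr p)"
    using integrable_on_powr_from_0[of p 1] assms by (intro abs) auto
  have 2: "set_integrable lborel {1..} (\<lambda>v. v powr (p + b))"
    using has_integral_powr_to_inf[of "p + b" 1] assms by (intro abs) (auto simp: integrable_on_def)
  have i1: "set_integrable lborel {0<..1} (\<lambda>v. v powr p * (1 + v) powr b)"
  proof (rule set_integrable_bound[OF set_integrable_subset[OF 1]])
    show "AE x in lborel. x \<in> {0<..1} \<longrightarrow> norm (x powr p * (1 + x) powr b) \<le> norm (x powr p)"
    proof (intro AE_I2 impI)
      fix x :: real assume "x \<in> {0<..1}"
      then have "(1 + x) powr b \<le> 1" using assms powr_mono[of b 0 "1+x"] by simp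
      then show "norm (x powr p * (1 + x) powr b) \<le> norm (x powr p)"
        by (simp add: mult_left_le)
    qed
  qed (auto simp: set_borel_measurable_def)
  have i2: "set_integrable lborel {1<..} (\<lambda>v. v powr p * (1 + v) powr b)"
  proof (rule set_integrable_bound[OF set_integrable_subset[OF 2]])
    show "AE x in lborel. x \<in> {1<..} \<longrightarrow> norm (x powr p * (1 + x) powr b) \<le> norm (x powr (p + b))"
    proof (intro AE_I2 impI)
      fix x :: real assume "x \<in> {1<..}"
      then have "(1 + x) powr b \<le> x powr b" using assms by (intro powr_mono2') auto
      then show "norm (x powr p * (1 + x) powr b) \<le> norm (x powr (p + b))"
        by (simp add: powr_add mult_left_mono)
    qed
  qed (auto simp: set_borel_measurable_def)
  have "set_integrable lborel ({0<..1} \<union> {1<..}) (\<lambda>v. v powr p * (1 + v) powr b)"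
    by (rule set_integrable_Un[OF i1 i2]) auto
  moreover have "{0<..1} \<union> {1<..} = {0::real<..}" by auto
  ultimately show ?thesis by simp
qed

text \<open>The family is closed under differentiation in \<open>w\<close>: a derivative multiplies
  by \<open>s\<close> and moves \<open>(p, s)\<close> to \<open>(p + 1, s - 1)\<close>. The exponent
  \<open>-2/3\<close> is unaffected and therefore built in.\<close>

definition euler_integral :: "real \<Rightarrow> real \<Rightarrow> complex \<Rightarrow> complex" where
  "euler_integral p s w = (LINT v:{0<..}|lborel.
     of_real (v powr p * (1 + v) powr (-2/3)) * (1 + w * of_real v) powr of_real s)"

lemma one_plus_mult_bound:
  fixes w0 :: complex
  assumes "w0 \<notin> \<real>\<^sub>\<le>\<^sub>0"
  obtains r c where "r > 0" "c > 0" "ball w0 r \<inter> \<real>\<^sub>\<le>\<^sub>0 = {}"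
    "\<And>w v. w \<in> ball w0 r \<Longrightarrow> v \<ge> 0 \<Longrightarrow> norm (1 + w * of_real v) \<ge> c * (1 + v)"
proof -
  have "0 \<notin> closed_segment 1 w0"
  proof
    assume "0 \<in> closed_segment 1 w0"
    then obtain u where u: "0 \<le> u" "u \<le> 1" "0 = (1 - u) *\<^sub>R 1 + u *\<^sub>R w0"
      by (auto simp: closed_segment_def)
    then have "u \<noteq> 0" by auto
    then have "w0 = of_real (- (1 - u) / u)" using u by (auto simp: scaleR_conv_of_real field_simps add_eq_0_iff)
    moreover have "- (1 - u) / u \<le> 0" using u by (intro divide_nonpos_nonneg) auto
    ultimately show False using assms by (metis nonpos_Reals_of_real_iff)
  qed
  then obtain d where d: "d > 0" "\<And>x. x \<in> closed_segment 1 w0 \<Longrightarrow> d \<le> dist 0 x"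
    using separate_point_closed[of "closed_segment 1 w0" 0] by auto
  have "open (- \<real>\<^sub>\<le>\<^sub>0 :: complex set)" by (simp add: open_Compl)
  then obtain r0 where r0: "r0 > 0" "ball w0 r0 \<subseteq> - \<real>\<^sub>\<le>\<^sub>0"
    using assms openE by blast
  show ?thesis
  proof (rule that[of "min r0 (d/2)" "d/2"])
    fix w :: complex and v :: real assume w: "w \<in> ball w0 (min r0 (d/2))" and v: "v \<ge> 0"
    define t where "t = v / (1 + v)"
    have t: "0 \<le> t" "t \<le> 1" using v by (auto simp: t_def)
    have "(1 - t) *\<^sub>R 1 + t *\<^sub>R w0 \<in> closed_segment 1 w0" using t by (auto simp: closed_segment_def)
    then have "d \<le> norm ((1 - t) *\<^sub>R 1 + t *\<^sub>R w0)" using d(2) by force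
    also have "\<dots> = norm ((1 - t) *\<^sub>R 1 + t *\<^sub>R w + t *\<^sub>R (w0 - w))" by (simp add: algebra_simps)
    also have "\<dots> \<le> norm ((1 - t) *\<^sub>R 1 + t *\<^sub>R w) + norm (t *\<^sub>R (w0 - w))" by (rule norm_triangle_ineq)
    also have "norm (t *\<^sub>R (w0 - w)) \<le> 1 * (d/2)"
      unfolding norm_scaleR using t w by (intro mult_mono) (auto simp: dist_norm)
    finally have "d/2 \<le> norm ((1 - t) *\<^sub>R 1 + t *\<^sub>R w)" by simp
    also have "(1 - t) *\<^sub>R 1 + t *\<^sub>R w = (1 + w * of_real v) / of_real (1 + v)"
      using v by (simp add: t_def scaleR_conv_of_real divide_simps)
    also have "norm \<dots> = norm (1 + w * of_real v) / (1 + v)" using v by (simp only: norm_divide norm_of_real)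
    finally show "d / 2 * (1 + v) \<le> norm (1 + w * of_real v)" using v by (simp add: field_simps)
  qed (use d r0 in auto)
qed

lemma one_plus_mult_not_nonpos:
  fixes w :: complex
  assumes "w \<notin> \<real>\<^sub>\<le>\<^sub>0" "v \<ge> 0"
  shows "1 + w * of_real v \<notin> \<real>\<^sub>\<le>\<^sub>0"
proof
  assume *: "1 + w * of_real v \<in> \<real>\<^sub>\<le>\<^sub>0"
  have "v \<noteq> 0" using * by auto
  then have v: "v > 0" using assms(2) by simp
  have *: "Im w * v = 0" "1 + Re w * v \<le> 0" using * by (auto simp: complex_nonpos_Reals_iff)
  have "Re w \<le> 0"
  proof (rule ccontr)
    assume "\<not> Re w \<le> 0"
    then have "Re w * v > 0" using v by simp
    then show False using *(2) by linarith
  qed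
  moreover have "Im w = 0" using * v by simp
  ultimately have "Im w = 0" "Re w \<le> 0" by auto
  then show False using assms(1) by (simp add: complex_nonpos_Reals_iff)
qed

lemma norm_integrand_bound:
  fixes p s :: real
  assumes "c > 0" "v > 0" "s \<le> 0" "norm (1 + w * of_real v) \<ge> c * (1 + v)"
  shows "norm (complex_of_real (v powr p * (1 + v) powr (-2/3)) * (1 + w * of_real v) powr of_real s)
     \<le> c powr s * (v powr p * (1 + v) powr (-2/3 + s))"
proof -
  have "norm ((1 + w * of_real v) powr of_real s) = norm (1 + w * of_real v) powr s"
    by (simp add: norm_powr_real_powr')
  also have "\<dots> \<le> (c * (1 + v)) powr s" using assms by (intro powr_mono2') auto
  also have "\<dots> = c powr s * (1 + v) powr s" using assms by (simp add: powr_mult)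
  finally have "norm ((1 + w * of_real v) powr of_real s) \<le> c powr s * (1 + v) powr s" .
  then have "(v powr p * (1 + v) powr (-2/3)) * norm ((1 + w * of_real v) powr of_real s)
     \<le> (v powr p * (1 + v) powr (-2/3)) * (c powr s * (1 + v) powr s)"
    by (intro mult_left_mono) auto
  then show ?thesis unfolding norm_mult norm_of_real powr_add by (simp add: mult_ac abs_mult)
qed

text \<open>The linear lower bound for \<open>norm (1 + w * of_real v)\<close> makes a multiple of
  \<open>v powr p * (1 + v) powr (-2/3 + s)\<close> a dominating function, locally uniformly in
  \<open>w\<close>. The conditions \<open>p > -1\<close> and \<open>p - 2/3 + s < -1\<close> are its
  integrability at 0 and at infinity.\<close>

lemma has_field_derivative_euler_integral:
  assumes w0: "w0 \<notin> \<real>\<^sub>\<le>\<^sub>0" and ps: "p > -1" "s \<le> 0" "p - 2/3 + s < -1"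
  shows "(euler_integral p s has_field_derivative of_real s * euler_integral (p + 1) (s - 1) w0) (at w0)"
    and "set_integrable lborel {0<..} (\<lambda>v. complex_of_real (v powr p * (1 + v) powr (-2/3)) *
           (1 + w0 * of_real v) powr of_real s)"
proof -
  obtain r c where rc: "r > 0" "c > 0" "ball w0 r \<inter> \<real>\<^sub>\<le>\<^sub>0 = {}"
    "\<And>w v. w \<in> ball w0 r \<Longrightarrow> v \<ge> 0 \<Longrightarrow> norm (1 + w * of_real v) \<ge> c * (1 + v)"
    using one_plus_mult_bound[OF w0] by metis
  define f where "f = (\<lambda>w v. indicator {0<..} v *\<^sub>R (complex_of_real (v powr p * (1 + v) powr (-2/3)) *
           (1 + w * of_real v) powr of_real s))"
  define g where "g = (\<lambda>v. indicator {0<..} v *\<^sub>R (c powr s * (v powr p * (1 + v) powr (-2/3 + s))))"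
  have g: "integrable lborel g"
    unfolding g_def set_integrable_def[symmetric]
    by (intro set_integrable_mult_right set_integrable_powr_mult_powr) (use ps in auto)
  have der: "((\<lambda>w. f w v) has_field_derivative indicator {0<..} v *\<^sub>R (complex_of_real (v powr p * (1 + v) powr (-2/3)) *
           (of_real s * (1 + w * of_real v) powr (of_real s - 1) * of_real v))) (at w)"
    if "w \<in> ball w0 r" for w v
  proof (cases "v > 0")
    case True
    have "1 + w * of_real v \<notin> \<real>\<^sub>\<le>\<^sub>0" using that rc True by (intro one_plus_mult_not_nonpos) auto
    then show ?thesis unfolding f_def using True
      by (auto intro!: derivative_eq_intros simp: scaleR_conv_of_real)
  qed (auto simp: f_def)
  have bound: "norm (f w v) \<le> g v" if "w \<in> ball w0 r" for w v
    using norm_integrand_bound[of c v s w p] rc that ps by (cases "v > 0") (auto simp: f_def g_def)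
  have meas: "f w \<in> borel_measurable lborel" for w
    unfolding f_def by measurable
  show "set_integrable lborel {0<..} (\<lambda>v. complex_of_real (v powr p * (1 + v) powr (-2/3)) *
           (1 + w0 * of_real v) powr of_real s)"
    unfolding set_integrable_def f_def[symmetric]
    by (rule Bochner_Integration.integrable_bound[OF g])
       (use bound[of w0] rc meas in \<open>auto simp: f_def intro!: AE_I2 intro: order_trans[OF _ abs_ge_self]\<close>)
  have d0: "deriv (\<lambda>w. f w v) w0 = of_real s * (indicator {0<..} v *\<^sub>R (complex_of_real (v powr (p+1) * (1 + v) powr (-2/3)) *
           (1 + w0 * of_real v) powr of_real (s - 1)))" for v
    using DERIV_imp_deriv[OF der[of w0 v]] rc
    by (cases "v > 0") (simp_all add: powr_add)
  have "((\<lambda>w. integral\<^sup>L lborel (f w)) has_field_derivative integral\<^sup>L lborel (\<lambda>v. deriv (\<lambda>w. f w v) w0)) (at w0)"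
  proof (rule has_field_derivative_integral_dominated[OF rc(1)])
    show "(\<lambda>w. f w v) holomorphic_on ball w0 r" for v
      using der by (intro holomorphic_onI) (meson field_differentiable_at_within field_differentiable_def)
    show "(\<lambda>v. deriv (\<lambda>w. f w v) w0) \<in> borel_measurable lborel" unfolding d0 by measurable
  qed (use meas bound g in auto)
  then show "(euler_integral p s has_field_derivative of_real s * euler_integral (p + 1) (s - 1) w0) (at w0)"
    unfolding d0 integral_mult_right_zero
    unfolding euler_integral_def[abs_def] f_def set_lebesgue_integral_def .
qed

text \<open>By Euler's integral, \<open>cubic_period w\<close> is \<open>B(1/3, 2/3)\<close> times the hypergeometric function
  \<open>\<^sub>2F\<^sub>1(1/3, 2/3; 1; 1 - w)\<close>.\<close>

definition cubic_period :: "complex \<Rightarrow> complex" where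
  "cubic_period w = euler_integral (-1/3) (-1/3) w"

definition cubic_period_real :: "real \<Rightarrow> real" where
  "cubic_period_real x = (LINT v:{0<..}|lborel. v powr (-1/3) * (1 + v) powr (-2/3) * (1 + x * v) powr (-1/3))"

lemma cubic_period_altdef:
  "cubic_period w = (LINT v:{0<..}|lborel.
     of_real (v powr (-1/3) * (1 + v) powr (-2/3)) * (1 + w * of_real v) powr of_real (-1/3))"
  unfolding cubic_period_def euler_integral_def ..

lemma set_integrable_cubic_period:
  assumes "w \<notin> \<real>\<^sub>\<le>\<^sub>0"
  shows "set_integrable lborel {0<..} (\<lambda>v. complex_of_real (v powr (-1/3) * (1 + v) powr (-2/3)) *
           (1 + w * of_real v) powr of_real (-1/3))"
  by (rule has_field_derivative_euler_integral(2)[OF assms]) auto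

lemma cubic_period_holomorphic: "cubic_period holomorphic_on - \<real>\<^sub>\<le>\<^sub>0"
proof (rule holomorphic_onI)
  fix w :: complex assume "w \<in> - \<real>\<^sub>\<le>\<^sub>0"
  then have "(euler_integral (-1/3) (-1/3) has_field_derivative
      of_real (-1/3) * euler_integral (-1/3 + 1) (-1/3 - 1) w) (at w)"
    by (intro has_field_derivative_euler_integral) auto
  then show "cubic_period field_differentiable at w within - \<real>\<^sub>\<le>\<^sub>0"
    unfolding cubic_period_def[abs_def] field_differentiable_def
    using has_field_derivative_at_within by blast
qed

lemma cubic_period_cnj:
  assumes "w \<notin> \<real>\<^sub>\<le>\<^sub>0"
  shows "cubic_period (cnj w) = cnj (cubic_period w)"
proof -
  have "cnj (cubic_period w) = (LINT v:{0<..}|lborel.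
     cnj (of_real (v powr (-1/3) * (1 + v) powr (-2/3)) * (1 + w * of_real v) powr of_real (-1/3)))"
    unfolding cubic_period_altdef set_lebesgue_integral_def Bochner_Integration.integral_cnj[symmetric] complex_cnj_scaleR ..
  also have "\<dots> = cubic_period (cnj w)"
    unfolding cubic_period_altdef
  proof (rule set_lebesgue_integral_cong)
    show "\<forall>v. v \<in> {0<..} \<longrightarrow> cnj (of_real (v powr (-1/3) * (1 + v) powr (-2/3)) * (1 + w * of_real v) powr of_real (-1/3)) =
      complex_of_real (v powr (-1/3) * (1 + v) powr (-2/3)) * (1 + cnj w * of_real v) powr of_real (-1/3)"
    proof (intro allI impI)
      fix v :: real assume "v \<in> {0<..}"
      then have "1 + w * of_real v \<notin> \<real>\<^sub>\<le>\<^sub>0" by (intro one_plus_mult_not_nonpos assms) auto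
      then have "cnj ((1 + w * of_real v) powr of_real (-1/3)) = cnj (1 + w * of_real v) powr cnj (of_real (-1/3))"
        by (intro cnj_powr) (auto simp: complex_nonpos_Reals_iff)
      then show "cnj (of_real (v powr (-1/3) * (1 + v) powr (-2/3)) * (1 + w * of_real v) powr of_real (-1/3)) =
          complex_of_real (v powr (-1/3) * (1 + v) powr (-2/3)) * (1 + cnj w * of_real v) powr of_real (-1/3)"
        by simp
    qed
  qed simp
  finally show ?thesis ..
qed

lemma cubic_period_of_real:
  assumes "x \<ge> 0"
  shows "cubic_period (of_real x) = of_real (cubic_period_real x)"
  unfolding cubic_period_altdef cubic_period_real_def set_integral_complex_of_real[symmetric]
proof (rule set_lebesgue_integral_cong)
  show "\<forall>v. v \<in> {0<..} \<longrightarrow> complex_of_real (v powr (-1/3) * (1 + v) powr (-2/3)) *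
      (1 + of_real x * of_real v) powr of_real (-1/3) =
      of_real (v powr (-1/3) * (1 + v) powr (-2/3) * (1 + x * v) powr (-1/3))"
  proof (intro allI impI)
    fix v :: real assume "v \<in> {0<..}"
    then have "complex_of_real (1 + x * v) powr of_real (-1/3) = of_real ((1 + x * v) powr (-1/3))"
      using assms by (intro powr_of_real) (auto intro: add_nonneg_nonneg)
    then show "complex_of_real (v powr (-1/3) * (1 + v) powr (-2/3)) *
      (1 + of_real x * of_real v) powr of_real (-1/3) =
      of_real (v powr (-1/3) * (1 + v) powr (-2/3) * (1 + x * v) powr (-1/3))" by simp
  qed
qed simp

lemma set_integrable_cubic_period_real:
  fixes x :: real
  assumes "x > 0"
  shows "set_integrable lborel {0<..} (\<lambda>v. v powr (-1/3) * (1 + v) powr (-2/3) * (1 + x * v) powr (-1/3))"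
proof -
  have "set_integrable lborel {0<..} (\<lambda>v. min x 1 powr (-1/3) * (v powr (-1/3) * (1 + v) powr (-1)))"
    using set_integrable_powr_mult_powr[of "-1/3" "-1"] by (intro set_integrable_mult_right) auto
  then show ?thesis
  proof (rule set_integrable_bound)
    show "AE v in lborel. v \<in> {0<..} \<longrightarrow> norm (v powr (-1/3) * (1 + v) powr (-2/3) * (1 + x * v) powr (-1/3))
        \<le> norm (min x 1 powr (-1/3) * (v powr (-1/3) * (1 + v) powr (-1)))"
    proof (intro AE_I2 impI)
      fix v :: real assume "v \<in> {0<..}"
      then have v: "v > 0" by simp
      have "min x 1 * (1 + v) \<le> 1 + x * v" using v
        by (auto simp: min_def algebra_simps intro: mult_right_mono)
      then have "(1 + x * v) powr (-1/3) \<le> (min x 1 * (1 + v)) powr (-1/3)"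
        using v assms by (intro powr_mono2') auto
      also have "\<dots> = min x 1 powr (-1/3) * (1 + v) powr (-1/3)" using v assms by (simp add: powr_mult)
      finally have "v powr (-1/3) * (1 + v) powr (-2/3) * (1 + x * v) powr (-1/3) \<le>
         v powr (-1/3) * (1 + v) powr (-2/3) * (min x 1 powr (-1/3) * (1 + v) powr (-1/3))"
        by (intro mult_left_mono) auto
      also have "\<dots> = min x 1 powr (-1/3) * (v powr (-1/3) * ((1 + v) powr (-2/3) * (1 + v) powr (-1/3)))"
        by (simp add: mult_ac)
      also have "(1 + v) powr (-2/3) * (1 + v) powr (-1/3) = (1 + v) powr (-1)"
        by (simp flip: powr_add)
      finally show "norm (v powr (-1/3) * (1 + v) powr (-2/3) * (1 + x * v) powr (-1/3))
        \<le> norm (min x 1 powr (-1/3) * (v powr (-1/3) * (1 + v) powr (-1)))" by simp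
    qed
  qed (auto simp: set_borel_measurable_def)
qed

lemma cubic_period_real_pos:
  assumes "x > 0"
  shows "cubic_period_real x > 0"
proof -
  define f where "f = (\<lambda>v. v powr (-1/3) * (1 + v) powr (-2/3) * (1 + x * v) powr (-1/3))"
  have f: "set_integrable lborel {0<..} f" unfolding f_def by (rule set_integrable_cubic_period_real[OF assms])
  have fI: "set_integrable lborel {1..2} f" by (rule set_integrable_subset[OF f]) auto
  \<comment> \<open>Every factor of the integrand decreases in \<open>v\<close>, so the value at
    \<open>v = 2\<close> is a lower bound on \<open>{1..2}\<close>.\<close>
  define c where "c = 2 powr (-1/3) * 3 powr (-2/3) * (1 + x * 2) powr (-1/3)"
  have c: "c > 0" using assms by (simp add: c_def)
  have "(LINT v:{1..2::real}|lborel. c) \<le> (LINT v:{1..2}|lborel. f v)"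
  proof (rule set_integral_mono[OF _ fI])
    fix v :: real assume "v \<in> {1..2}"
    then show "c \<le> f v" unfolding c_def f_def using assms
      by (intro mult_mono powr_mono2' mult_nonneg_nonneg) (auto intro: add_nonneg_nonneg add_pos_pos)
  qed (simp add: set_integrable_def)
  also have "\<dots> \<le> (LINT v:{0<..}|lborel. f v)"
    unfolding set_lebesgue_integral_def using f fI unfolding set_integrable_def
    by (intro integral_mono) (auto simp: f_def indicator_def)
  finally have "c \<le> cubic_period_real x"
    unfolding cubic_period_real_def f_def[symmetric] set_lebesgue_integral_def by simp
  then show ?thesis using c by linarith
qed

section \<open>Boundary values of the period on the upper side of the cut\<close>

lemma powr_upper_half:
  assumes "z \<noteq> 0" "Im z \<ge> 0"
  shows "z powr s = exp (s * (Ln (- \<i> * z) + \<i> * pi / 2))"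
proof -
  have "Ln (\<i> * (- \<i> * z)) = Ln (- \<i> * z) + \<i> * pi / 2"
    using assms by (subst Ln_times_ii) auto
  then show ?thesis using assms by (simp add: powr_def)
qed

text \<open>Principal powers are continuous from above at their cut: the rotation
  \<open>- \<i> * z\<close> carries the closed upper half-plane without 0 into the slit plane, where
  \<open>Ln\<close> is continuous, and \<open>powr_upper_half\<close> records the compensating shift
  by \<open>\<i> * pi / 2\<close>.\<close>

lemma continuous_on_powr_upper_half:
  "continuous_on ({z. Im z \<ge> 0} - {0}) (\<lambda>z. z powr s)"
proof -
  have "continuous_on ({z. Im z \<ge> 0} - {0}) (\<lambda>z. exp (s * (Ln (- \<i> * z) + \<i> * pi / 2)))"
  proof (intro continuous_intros ballI)
    fix z assume "z \<in> {z. Im z \<ge> 0} - {0}"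
    then have "z \<noteq> 0" "Im z \<ge> 0" by auto
    then show "- \<i> * z \<notin> \<real>\<^sub>\<le>\<^sub>0"
      by (auto simp: complex_nonpos_Reals_iff complex_eq_iff)
  qed
  moreover have "continuous_on ({z. Im z \<ge> 0} - {0}) (\<lambda>z. exp (s * (Ln (- \<i> * z) + \<i> * pi / 2))) \<longleftrightarrow>
     continuous_on ({z. Im z \<ge> 0} - {0}) (\<lambda>z. z powr s)"
    by (rule continuous_on_cong) (auto simp: powr_upper_half)
  ultimately show ?thesis by blast
qed

text \<open>The substitution \<open>u = norm w * v\<close> moves the zero of
  \<open>1 + w * of_real v\<close>, which exists for negative real \<open>w\<close>, to the fixed
  place \<open>u = 1\<close>. One dominating function then serves all nearby \<open>w\<close> up to
  the cut.\<close>

lemma cubic_period_scaled: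
  assumes "w \<noteq> 0"
  shows "cubic_period w = (LINT u:{0<..}|lborel.
     of_real (u powr (-1/3) * (norm w + u) powr (-2/3)) * (1 + sgn w * of_real u) powr of_real (-1/3))"
proof -
  define r where "r = norm w"
  have r: "r > 0" using assms by (simp add: r_def)
  have "cubic_period w = (\<integral>v. indicator {0<..} v *\<^sub>R (complex_of_real (v powr (-1/3) * (1 + v) powr (-2/3)) *
      (1 + w * of_real v) powr of_real (-1/3)) \<partial>lborel)"
    unfolding cubic_period_altdef set_lebesgue_integral_def ..
  also have "\<dots> = \<bar>1/r\<bar> *\<^sub>R (\<integral>u. indicator {0<..} (0 + 1/r * u) *\<^sub>R (complex_of_real ((0 + 1/r * u) powr (-1/3) * (1 + (0 + 1/r * u)) powr (-2/3)) *
      (1 + w * of_real (0 + 1/r * u)) powr of_real (-1/3)) \<partial>lborel)"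
    using r by (intro lborel_integral_real_affine) auto
  also have "\<dots> = (\<integral>u. \<bar>1/r\<bar> *\<^sub>R (indicator {0<..} (0 + 1/r * u) *\<^sub>R (complex_of_real ((0 + 1/r * u) powr (-1/3) * (1 + (0 + 1/r * u)) powr (-2/3)) *
      (1 + w * of_real (0 + 1/r * u)) powr of_real (-1/3))) \<partial>lborel)"
    by (rule Bochner_Integration.integral_scaleR_right[symmetric])
  also have "\<dots> = (\<integral>u. indicator {0<..} u *\<^sub>R (of_real (u powr (-1/3) * (norm w + u) powr (-2/3)) * (1 + sgn w * of_real u) powr of_real (-1/3)) \<partial>lborel)"
  proof (rule Bochner_Integration.integral_cong[OF refl])
    fix u :: real
    show "\<bar>1/r\<bar> *\<^sub>R (indicator {0<..} (0 + 1/r * u) *\<^sub>R (complex_of_real ((0 + 1/r * u) powr (-1/3) * (1 + (0 + 1/r * u)) powr (-2/3)) *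
      (1 + w * of_real (0 + 1/r * u)) powr of_real (-1/3))) =
      indicator {0<..} u *\<^sub>R (of_real (u powr (-1/3) * (norm w + u) powr (-2/3)) * (1 + sgn w * of_real u) powr of_real (-1/3))"
    proof (cases "u > 0")
      case True
      have 1: "w * of_real (0 + 1/r * u) = sgn w * of_real u" using r
        by (simp add: sgn_div_norm r_def scaleR_conv_of_real field_simps)
      have "1 + (0 + 1/r * u) = (r + u) / r" using r by (simp add: field_simps)
      then have 2: "(1 + (0 + 1/r * u)) powr (-2/3) = (r + u) powr (-2/3) / r powr (-2/3)"
        using r True by (simp add: powr_divide)
      have 3: "(0 + 1/r * u) powr (-1/3) = u powr (-1/3) / r powr (-1/3)"
        using r True by (simp add: powr_divide)
      \<comment> \<open>The Jacobian \<open>1 / r\<close> is absorbed by the powers of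
        \<open>r\<close> released from the two real factors, so that \<open>r\<close> remains only
        in \<open>norm w + u\<close>.\<close>
      have "r powr (-1/3) * r powr (-2/3) * r = r powr ((-1/3) + (-2/3) + 1)"
        unfolding powr_add using r by simp
      then have 4: "r powr (-1/3) * r powr (-2/3) * r = 1" using r by simp
      have 5: "\<bar>1/r\<bar> * ((u powr (-1/3) / r powr (-1/3)) * ((r + u) powr (-2/3) / r powr (-2/3)))
         = u powr (-1/3) * (r + u) powr (-2/3)"
        using r 4 by (simp add: field_simps)
      have "\<bar>1/r\<bar> *\<^sub>R (complex_of_real ((u powr (-1/3) / r powr (-1/3)) * ((r + u) powr (-2/3) / r powr (-2/3))) * Z)
         = complex_of_real (u powr (-1/3) * (r + u) powr (-2/3)) * Z" for Z
        unfolding 5[symmetric] by (simp add: scaleR_conv_of_real)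
      then show ?thesis unfolding 1 2 3 using True r by (simp add: r_def)
    qed (use r in \<open>simp add: zero_less_mult_iff zero_less_divide_iff\<close>)
  qed
  finally show ?thesis unfolding set_lebesgue_integral_def .
qed

text \<open>The integrable singularities sit at 0 and 1. Outside \<open>[1/2, 2]\<close> the
  distance from \<open>u\<close> to 1 is at least \<open>(1 + u) / 3\<close>, which gives the first
  summand of \<open>g\<close> with its \<open>3 powr (1/3)\<close>. Inside, \<open>u >= 1/2\<close>
  gives \<open>2 powr (1/3)\<close>, and two affine copies of the function
  \<open>u powr (-1/3)\<close> on \<open>{0..1}\<close> cover the singularity from both
  sides.\<close>

lemma set_integrable_scaled_bound:
  fixes m :: real assumes m: "m > 0"
  shows "set_integrable lborel {0<..} (\<lambda>u. u powr (-1/3) * (m + u) powr (-2/3) * \<bar>1 - u\<bar> powr (-1/3))"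
proof -
  define C where "C = (min m 1) powr (-2/3)"
  have I0: "integrable lborel (\<lambda>x::real. indicator {0..1} x *\<^sub>R x powr (-1/3))"
  proof -
    have "(\<lambda>x::real. x powr (-1/3)) absolutely_integrable_on {0..1}"
      using integrable_on_powr_from_0[of "-1/3" 1] by (intro nonnegative_absolutely_integrable_1) auto
    then show ?thesis by (simp add: set_integrable_def integrable_completion)
  qed
  have I1: "integrable lborel (\<lambda>u::real. indicator {0..1} (-1 + 1 * u) *\<^sub>R (-1 + 1 * u) powr (-1/3))"
    by (rule lborel_integrable_real_affine[OF I0]) auto
  have I2: "integrable lborel (\<lambda>u::real. indicator {0..1} (1 + (-1) * u) *\<^sub>R (1 + (-1) * u) powr (-1/3))"
    by (rule lborel_integrable_real_affine[OF I0]) auto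
  define g where "g = (\<lambda>u::real. C * (3 powr (1/3) * (u powr (-1/3) * (1 + u) powr (-1))) +
     C * 2 powr (1/3) * (indicator {0..1} (-1 + 1 * u) *\<^sub>R (-1 + 1 * u) powr (-1/3) +
           indicator {0..1} (1 + (-1) * u) *\<^sub>R (1 + (-1) * u) powr (-1/3)))"
  have "set_integrable lborel {0<..} g"
    unfolding g_def
  proof (intro set_integral_add(1) set_integrable_mult_right)
    show "set_integrable lborel {0<..} (\<lambda>u::real. u powr (-1/3) * (1 + u) powr (-1))"
      by (rule set_integrable_powr_mult_powr) auto
    show "set_integrable lborel {0<..} (\<lambda>u::real. indicator {0..1} (-1 + 1 * u) *\<^sub>R (-1 + 1 * u) powr (-1/3))"
      "set_integrable lborel {0<..} (\<lambda>u::real. indicator {0..1} (1 + (-1) * u) *\<^sub>R (1 + (-1) * u) powr (-1/3))"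
      unfolding set_integrable_def by (intro integrable_mult_indicator I1 I2; simp)+
  qed
  then show ?thesis
  proof (rule set_integrable_bound)
    show "AE u in lborel. u \<in> {0<..} \<longrightarrow> norm (u powr (-1/3) * (m + u) powr (-2/3) * \<bar>1 - u\<bar> powr (-1/3)) \<le> norm (g u)"
    proof (intro AE_I2 impI)
      fix u :: real assume "u \<in> {0<..}"
      then have u: "u > 0" by simp
      have C: "C > 0" using m by (simp add: C_def)
      have "min m 1 * (1 + u) \<le> m + u" using u
        by (auto simp: min_def algebra_simps)
      then have "(m + u) powr (-2/3) \<le> (min m 1 * (1 + u)) powr (-2/3)"
        using u m by (intro powr_mono2') auto
      then have m2: "(m + u) powr (-2/3) \<le> C * (1 + u) powr (-2/3)" using u m by (simp add: powr_mult C_def)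
      have g0: "g u \<ge> 0" using C by (auto simp: g_def)
      have "u powr (-1/3) * (m + u) powr (-2/3) * \<bar>1 - u\<bar> powr (-1/3) \<le>
            u powr (-1/3) * (C * (1 + u) powr (-2/3)) * \<bar>1 - u\<bar> powr (-1/3)"
        using m2 by (intro mult_right_mono mult_left_mono) auto
      also have "\<dots> \<le> g u"
      proof (cases "1/2 \<le> u \<and> u \<le> 2")
        case True
        have "u powr (-1/3) \<le> (1/2) powr (-1/3)" using True by (intro powr_mono2') auto
        also have "(1/2::real) powr (-1/3) = 2 powr (1/3)" by (simp add: powr_divide powr_minus)
        finally have a: "u powr (-1/3) \<le> 2 powr (1/3)" .
        have b: "(1 + u) powr (-2/3) \<le> 1" using u powr_mono[of "-2/3" 0 "1 + u"] by simp
        have "u powr (-1/3) * (C * (1 + u) powr (-2/3)) * \<bar>1 - u\<bar> powr (-1/3) \<le>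
            2 powr (1/3) * (C * 1) * \<bar>1 - u\<bar> powr (-1/3)"
          using a b C by (intro mult_right_mono mult_mono mult_left_mono) auto
        also have "\<bar>1 - u\<bar> powr (-1/3) \<le> indicator {0..1} (-1 + 1 * u) *\<^sub>R (-1 + 1 * u) powr (-1/3) +
           indicator {0..1} (1 + (-1) * u) *\<^sub>R (1 + (-1) * u) powr (-1/3)"
          using True by (cases "u \<le> 1") (auto simp: indicator_def)
        finally show ?thesis using C u unfolding g_def
          by (simp add: mult_ac mult_left_mono add_increasing)
      next
        case False
        then have "\<bar>1 - u\<bar> \<ge> (1/3) * (1 + u)" using u by auto
        then have "\<bar>1 - u\<bar> powr (-1/3) \<le> ((1/3) * (1 + u)) powr (-1/3)" using u by (intro powr_mono2') auto
        also have "\<dots> = (1/3) powr (-1/3) * (1 + u) powr (-1/3)" by (rule powr_mult)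
        also have "(1/3::real) powr (-1/3) = 3 powr (1/3)" by (simp add: powr_divide powr_minus)
        finally have "u powr (-1/3) * (C * (1 + u) powr (-2/3)) * \<bar>1 - u\<bar> powr (-1/3) \<le>
          u powr (-1/3) * (C * (1 + u) powr (-2/3)) * (3 powr (1/3) * (1 + u) powr (-1/3))"
          using C by (intro mult_left_mono) auto
        also have "\<dots> = C * (3 powr (1/3) * (u powr (-1/3) * ((1 + u) powr (-2/3) * (1 + u) powr (-1/3))))"
          by (simp add: mult_ac)
        also have "(1 + u) powr (-2/3) * (1 + u) powr (-1/3) = (1 + u) powr (-1)"
          by (simp flip: powr_add)
        also have "C * (3 powr (1/3) * (u powr (-1/3) * (1 + u) powr (-1))) \<le> g u"
          unfolding g_def using C by auto
        finally show ?thesis .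
      qed
      finally show "norm (u powr (-1/3) * (m + u) powr (-2/3) * \<bar>1 - u\<bar> powr (-1/3)) \<le> norm (g u)"
        using g0 by simp
    qed
  qed (auto simp: set_borel_measurable_def)
qed

lemma scaled_integrand_bound:
  assumes "0 < m" "m \<le> norm w" "u > 0" "u \<noteq> 1"
  shows "norm (complex_of_real (u powr (-1/3) * (norm w + u) powr (-2/3)) * (1 + sgn w * of_real u) powr of_real (-1/3))
    \<le> u powr (-1/3) * (m + u) powr (-2/3) * \<bar>1 - u\<bar> powr (-1/3)"
proof -
  have "norm (sgn w) = 1" using assms by (auto simp: norm_sgn)
  then have "norm (sgn w * of_real u) = u" using assms by (simp add: norm_mult)
  then have "\<bar>1 - u\<bar> \<le> norm (1 + sgn w * of_real u)"
    using norm_triangle_ineq3[of 1 "- (sgn w * of_real u)"] by (simp add: norm_minus_cancel)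
  then have "norm (1 + sgn w * of_real u) powr (-1/3) \<le> \<bar>1 - u\<bar> powr (-1/3)"
    using assms by (intro powr_mono2') auto
  moreover have "(norm w + u) powr (-2/3) \<le> (m + u) powr (-2/3)" using assms by (intro powr_mono2') auto
  ultimately have "u powr (-1/3) * (norm w + u) powr (-2/3) * norm (1 + sgn w * of_real u) powr (-1/3)
     \<le> u powr (-1/3) * (m + u) powr (-2/3) * \<bar>1 - u\<bar> powr (-1/3)"
    by (intro mult_mono mult_left_mono) auto
  moreover have "norm ((1 + sgn w * of_real u) powr of_real (-1/3)) = norm (1 + sgn w * of_real u) powr (-1/3)"
    by (subst norm_powr_real_powr') auto
  ultimately show ?thesis by (simp only: norm_mult norm_of_real) (simp add: abs_mult)
qed

lemma integrable_scaled:
  assumes "w \<noteq> 0"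
  shows "set_integrable lborel {0<..} (\<lambda>u. complex_of_real (u powr (-1/3) * (norm w + u) powr (-2/3)) * (1 + sgn w * of_real u) powr of_real (-1/3))"
proof (rule set_integrable_bound[OF set_integrable_scaled_bound[of "norm w"]])
  show "AE u in lborel. u \<in> {0<..} \<longrightarrow> norm (complex_of_real (u powr (-1/3) * (norm w + u) powr (-2/3)) * (1 + sgn w * of_real u) powr of_real (-1/3))
    \<le> norm (u powr (-1/3) * (norm w + u) powr (-2/3) * \<bar>1 - u\<bar> powr (-1/3))"
    using AE_lborel_singleton[of 1]
  proof eventually_elim
    case (elim u)
    then show ?case using scaled_integrand_bound[of "norm w" w u] assms by auto
  qed
qed (use assms in \<open>auto simp: set_borel_measurable_def\<close>)

text \<open>This includes the negative axis, where the principal branch is the limit from above. In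
  the scaled form dominated convergence applies; the null set \<open>u = 1\<close> is discarded
  because \<open>1 + sgn w * of_real u\<close> can vanish there, and for the other positive
  \<open>u\<close> this base stays in the closed upper half-plane without 0.\<close>

lemma continuous_on_cubic_period_upper:
  "continuous_on ({w. Im w \<ge> 0} - {0}) cubic_period"
proof (rule continuous_on_sequentially[THEN iffD2], intro allI ballI impI)
  fix X and w :: complex
  assume w: "w \<in> {w. Im w \<ge> 0} - {0}" and X: "(\<forall>n. X n \<in> {w. Im w \<ge> 0} - {0}) \<and> X \<longlonglongrightarrow> w"
  define f where "f = (\<lambda>w u. indicator {0<..} u *\<^sub>R (complex_of_real (u powr (-1/3) * (norm w + u) powr (-2/3)) * (1 + sgn w * of_real u) powr of_real (-1/3)))"
  define m where "m = norm w / 2"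
  have m: "m > 0" using w by (simp add: m_def)
  have "(\<lambda>n. norm (X n)) \<longlonglongrightarrow> norm w" using X by (intro tendsto_norm) auto
  then have "eventually (\<lambda>n. norm (X n) > m) sequentially"
    by (rule order_tendstoD) (use m in \<open>auto simp: m_def\<close>)
  then obtain n0 where n0: "\<And>n. n \<ge> n0 \<Longrightarrow> norm (X n) > m" by (auto simp: eventually_sequentially)
  have "(\<lambda>n. integral\<^sup>L lborel (f (X (n + n0)))) \<longlonglongrightarrow> integral\<^sup>L lborel (f w)"
  proof (rule integral_dominated_convergence)
    show "integrable lborel (\<lambda>u. indicator {0<..} u *\<^sub>R (u powr (-1/3) * (m + u) powr (-2/3) * \<bar>1 - u\<bar> powr (-1/3)))"
      using set_integrable_scaled_bound[OF m] by (simp add: set_integrable_def)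
    show "f w \<in> borel_measurable lborel" "f (X (n + n0)) \<in> borel_measurable lborel" for n
      unfolding f_def by measurable
    show "AE u in lborel. norm (f (X (n + n0)) u) \<le> indicator {0<..} u *\<^sub>R (u powr (-1/3) * (m + u) powr (-2/3) * \<bar>1 - u\<bar> powr (-1/3))" for n
      using AE_lborel_singleton[of 1]
    proof eventually_elim
      case (elim u)
      have "m \<le> norm (X (n + n0))" using n0[of "n + n0"] by simp
      then show ?case using scaled_integrand_bound[of m "X (n + n0)" u] m elim
        by (cases "u > 0") (auto simp: f_def)
    qed
    show "AE u in lborel. (\<lambda>n. f (X (n + n0)) u) \<longlonglongrightarrow> f w u"
      using AE_lborel_singleton[of 1]
    proof eventually_elim
      case (elim u)
      have XX: "(\<lambda>n. X (n + n0)) \<longlonglongrightarrow> w" using X by (auto intro: LIMSEQ_ignore_initial_segment)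
      show ?case
      proof (cases "u > 0")
        case True
        have nz: "1 + sgn z * of_real u \<noteq> 0" for z :: complex
        proof
          assume "1 + sgn z * of_real u = 0"
          then have "norm (sgn z * of_real u) = 1" by (metis add_eq_0_iff norm_minus_cancel norm_one)
          then show False using True elim by (auto simp: norm_mult norm_sgn split: if_splits)
        qed
        have im: "Im (1 + sgn z * of_real u) \<ge> 0" if "Im z \<ge> 0" for z :: complex
          using that True by (simp add: Im_sgn)
        have "(\<lambda>n. 1 + sgn (X (n + n0)) * of_real u) \<longlonglongrightarrow> 1 + sgn w * of_real u"
          using w by (intro tendsto_intros XX) auto
        then have "(\<lambda>n. (1 + sgn (X (n + n0)) * of_real u) powr of_real (-1/3)) \<longlonglongrightarrow> (1 + sgn w * of_real u) powr of_real (-1/3)"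
          using w X nz im by (intro continuous_on_tendsto_compose[OF continuous_on_powr_upper_half]) auto
        moreover have "norm w + u \<noteq> 0" using True norm_ge_zero[of w] by linarith
        then have "(\<lambda>n. complex_of_real (u powr (-1/3) * (norm (X (n + n0)) + u) powr (-2/3)))
            \<longlonglongrightarrow> of_real (u powr (-1/3) * (norm w + u) powr (-2/3))"
          by (intro tendsto_intros XX disjI1)
        ultimately show ?thesis unfolding f_def
          by (intro tendsto_scaleR tendsto_mult tendsto_const)
      qed (auto simp: f_def)
    qed
  qed
  then have "(\<lambda>n. cubic_period (X (n + n0))) \<longlonglongrightarrow> cubic_period w"
    using X w by (simp add: cubic_period_scaled f_def set_lebesgue_integral_def)
  then show "(cubic_period \<circ> X) \<longlonglongrightarrow> cubic_period w"
    unfolding o_def by (rule LIMSEQ_offset)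
qed

section \<open>Sectors containing the period values\<close>

lemma cone_arg:
  assumes "Re z \<ge> 0" "Im z \<le> 0" "Im (cis \<beta> * z) \<ge> 0" "0 \<le> \<beta>" "\<beta> \<le> pi/2"
  obtains \<rho> a where "\<rho> \<ge> 0" "0 \<le> a" "a \<le> \<beta>" "z = of_real \<rho> * cis (-a)"
proof (cases "z = 0")
  case True
  then show ?thesis using assms by (intro that[of 0 0]) auto
next
  case False
  define a where "a = - Arg z"
  have z: "z = of_real (norm z) * cis (-a)" using False
    by (simp add: a_def cis_Arg_unique rcis_cmod_Arg[unfolded rcis_def])
  have bnd: "-pi/2 \<le> -a" "-a \<le> pi/2"
    using Re_Ln_pos_le[OF False] assms(1) False by (auto simp: a_def Arg_eq_Im_Ln abs_le_iff)
  have "Im z = - norm z * sin a" by (subst z) simp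
  then have "sin a \<ge> 0" using assms(2) False by (simp add: mult_le_0_iff zero_le_mult_iff)
  have a0: "a \<ge> 0"
  proof (rule ccontr)
    assume "\<not> a \<ge> 0"
    then have "sin (-a) > 0" using bnd pi_gt_zero by (intro sin_gt_zero) linarith+
    then show False using \<open>sin a \<ge> 0\<close> by simp
  qed
  have "Im (cis \<beta> * z) = norm z * sin (\<beta> - a)"
    by (subst z) (simp add: sin_diff algebra_simps)
  then have "sin (\<beta> - a) \<ge> 0" using assms(3) False by (simp add: zero_le_mult_iff)
  have "a \<le> \<beta>"
  proof (rule ccontr)
    assume "\<not> a \<le> \<beta>"
    then have "sin (a - \<beta>) > 0" using bnd assms(4,5) a0 pi_gt_zero by (intro sin_gt_zero) linarith+
    moreover have "sin (a - \<beta>) = - sin (\<beta> - a)" by (simp add: sin_diff)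
    ultimately show False using \<open>sin (\<beta> - a) \<ge> 0\<close> by simp
  qed
  then show ?thesis using z a0 by (intro that[of "norm z" a]) auto
qed

text \<open>The phase of the integrand is minus one third of \<open>Arg (1 + w * of_real v)\<close>,
  hence lies in \<open>[- \<beta>, 0]\<close>. Half-plane inequalities pass through the integral,
  and \<open>cone_arg\<close> turns them back into a bound on the argument. As
  \<open>\<beta> <= pi / 3\<close>, all cosines involved are at least 1/2, so the real part loses at
  most a factor 2 against the integral of norms.\<close>

lemma cubic_period_cone:
  assumes w: "w \<noteq> 0" and \<beta>: "0 \<le> \<beta>" "\<beta> \<le> pi / 3"
    and arg: "\<And>v. v > 0 \<Longrightarrow> 0 \<le> Arg (1 + w * of_real v) \<and> Arg (1 + w * of_real v) \<le> 3 * \<beta>"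
  shows "Re (cubic_period w) \<ge> 0" "Im (cubic_period w) \<le> 0" "Im (cis \<beta> * cubic_period w) \<ge> 0"
    "Re (cubic_period w) \<ge> 1/2 * (LINT u:{0<..}|lborel. norm (complex_of_real (u powr (-1/3) * (norm w + u) powr (-2/3)) * (1 + sgn w * of_real u) powr of_real (-1/3)))"
proof -
  define f where "f = (\<lambda>u. complex_of_real (u powr (-1/3) * (norm w + u) powr (-2/3)) * (1 + sgn w * of_real u) powr of_real (-1/3))"
  have f: "integrable lborel (\<lambda>u. indicator {0<..} u *\<^sub>R f u)"
    using integrable_scaled[OF w] unfolding set_integrable_def f_def .
  have N: "cubic_period w = (\<integral>u. indicator {0<..} u *\<^sub>R f u \<partial>lborel)"
    using cubic_period_scaled[OF w] unfolding set_lebesgue_integral_def f_def .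
  have "\<exists>R\<ge>0. \<exists>a. 0 \<le> a \<and> a \<le> \<beta> \<and> f u = of_real R * cis (-a)" if u: "u > 0" for u
  proof -
    define z where "z = 1 + sgn w * of_real u"
    have z: "z = 1 + w * of_real (u / norm w)"
      using w by (simp add: z_def sgn_div_norm scaleR_conv_of_real field_simps)
    have A: "0 \<le> Arg z" "Arg z \<le> 3 * \<beta>" using arg[of "u / norm w"] u w unfolding z by auto
    have "z powr of_real (-1/3) = of_real (norm z powr (-1/3)) * cis (- (Arg z / 3))"
    proof (cases "z = 0")
      case False
      have "z powr of_real (-1/3) = exp (of_real (-1/3) * (of_real (ln (norm z)) + \<i> * of_real (Arg z)))"
      proof -
        have "Ln z = of_real (ln (norm z)) + \<i> * of_real (Arg z)"
          using False by (simp add: complex_eq_iff Arg_eq_Im_Ln)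
        then show ?thesis using False by (simp add: powr_def)
      qed
      also have "\<dots> = exp (of_real (-1/3 * ln (norm z))) * exp (\<i> * of_real (- (Arg z / 3)))"
        unfolding exp_add[symmetric] by (simp add: algebra_simps)
      also have "\<dots> = of_real (norm z powr (-1/3)) * cis (- (Arg z / 3))"
        using False by (simp only: cis_conv_exp exp_of_real) (simp add: powr_def)
      finally show ?thesis .
    qed auto
    then have "f u = of_real ((u powr (-1/3) * (norm w + u) powr (-2/3)) * norm z powr (-1/3)) * cis (- (Arg z / 3))"
      unfolding f_def z_def[symmetric] by simp
    moreover have "(u powr (-1/3) * (norm w + u) powr (-2/3)) * norm z powr (-1/3) \<ge> 0" by simp
    moreover have "0 \<le> Arg z / 3" "Arg z / 3 \<le> \<beta>" using A by auto
    ultimately show ?thesis by blast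
  qed
  then have cone: "Re (f u) \<ge> 1/2 * norm (f u) \<and> Im (f u) \<le> 0 \<and> Im (cis \<beta> * f u) \<ge> 0" if u: "u > 0" for u
  proof -
    obtain R a where R: "R \<ge> 0" "0 \<le> a" "a \<le> \<beta>" "f u = of_real R * cis (-a)"
      using \<open>\<And>u. u > 0 \<Longrightarrow> \<exists>R\<ge>0. \<exists>a. 0 \<le> a \<and> a \<le> \<beta> \<and> f u = of_real R * cis (-a)\<close>[OF u] by blast
    have "cos (pi/3) \<le> cos a" using R \<beta> pi_gt_zero by (intro cos_monotone_0_pi_le) auto
    then have "R * (1/2) \<le> R * cos a" using R by (intro mult_left_mono) (auto simp: cos_60)
    moreover have "sin a \<ge> 0" using R \<beta> pi_gt_zero by (intro sin_ge_zero) auto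
    moreover have "sin (\<beta> - a) \<ge> 0" using R \<beta> pi_gt_zero by (intro sin_ge_zero) auto
    moreover have "Im (cis \<beta> * f u) = R * sin (\<beta> - a)" unfolding R(4) by (simp add: sin_diff algebra_simps)
    ultimately show ?thesis using R by (simp add: norm_mult)
  qed
  show "Im (cubic_period w) \<le> 0"
  proof -
    have "Im (cubic_period w) = (\<integral>u. Im (indicator {0<..} u *\<^sub>R f u) \<partial>lborel)"
      unfolding N by (rule integral_Im[OF f, symmetric])
    moreover have "0 \<le> (\<integral>u. - Im (indicator {0<..} u *\<^sub>R f u) \<partial>lborel)"
    proof (intro integral_nonneg_AE AE_I2)
      fix u :: real
      show "0 \<le> - Im (indicator {0<..} u *\<^sub>R f u)"
        using cone[of u] by (cases "u > 0") auto
    qed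
    ultimately show ?thesis by simp
  qed
  show "Im (cis \<beta> * cubic_period w) \<ge> 0"
  proof -
    have "cis \<beta> * cubic_period w = (\<integral>u. cis \<beta> * (indicator {0<..} u *\<^sub>R f u) \<partial>lborel)"
      unfolding N by (rule integral_mult_right_zero[symmetric])
    also have "Im \<dots> = (\<integral>u. Im (cis \<beta> * (indicator {0<..} u *\<^sub>R f u)) \<partial>lborel)"
      by (rule integral_Im[OF integrable_mult_right[OF f], symmetric])
    also have "\<dots> \<ge> 0"
    proof (intro integral_nonneg_AE AE_I2)
      fix u :: real
      show "0 \<le> Im (cis \<beta> * (indicator {0<..} u *\<^sub>R f u))"
        using cone[of u] by (cases "u > 0") auto
    qed
    finally show ?thesis .
  qed
  have R1: "Re (cubic_period w) = (\<integral>u. Re (indicator {0<..} u *\<^sub>R f u) \<partial>lborel)"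
    unfolding N by (rule integral_Re[OF f, symmetric])
  have "1/2 * (LINT u:{0<..}|lborel. norm (f u)) = (\<integral>u. 1/2 * (indicator {0<..} u *\<^sub>R norm (f u)) \<partial>lborel)"
    unfolding set_lebesgue_integral_def by (rule integral_mult_right_zero[symmetric])
  also have "\<dots> \<le> (\<integral>u. Re (indicator {0<..} u *\<^sub>R f u) \<partial>lborel)"
  proof (rule integral_mono)
    have "integrable lborel (\<lambda>u. norm (indicator {0<..} u *\<^sub>R f u))" using f by (rule integrable_norm)
    then have "integrable lborel (\<lambda>u. indicator {0<..} u *\<^sub>R norm (f u))" by (simp add: mult.commute)
    then show "integrable lborel (\<lambda>u. 1/2 * (indicator {0<..} u *\<^sub>R norm (f u)))"
      by (rule integrable_mult_right)
    show "1/2 * (indicator {0<..} u *\<^sub>R norm (f u)) \<le> Re (indicator {0<..} u *\<^sub>R f u)" for u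
      using cone[of u] by (cases "u > 0") auto
  qed (use f in \<open>rule integrable_Re\<close>)
  finally show R: "Re (cubic_period w) \<ge> 1/2 * (LINT u:{0<..}|lborel. norm (complex_of_real (u powr (-1/3) * (norm w + u) powr (-2/3)) * (1 + sgn w * of_real u) powr of_real (-1/3)))"
    unfolding R1 f_def .
  moreover have "(LINT u:{0<..}|lborel. norm (complex_of_real (u powr (-1/3) * (norm w + u) powr (-2/3)) * (1 + sgn w * of_real u) powr of_real (-1/3))) \<ge> 0"
    unfolding set_lebesgue_integral_def by (intro integral_nonneg_AE AE_I2) auto
  ultimately show "Re (cubic_period w) \<ge> 0" by linarith
qed

text \<open>The sum lies in the convex sector spanned by 1 and \<open>cis \<psi>\<close>;
  multiplication by \<open>cis (- \<psi>)\<close> shows that it does not pass the second ray. For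
  \<open>\<psi> = pi\<close> the sector is the whole upper half-plane and the bound is
  \<open>Arg_le_pi\<close>.\<close>

lemma Arg_add_cone:
  assumes "a > 0" "b \<ge> 0" "0 \<le> \<psi>" "\<psi> \<le> pi"
  shows "0 \<le> Arg (of_real a + of_real b * cis \<psi>) \<and> Arg (of_real a + of_real b * cis \<psi>) \<le> \<psi>"
proof -
  define z where "z = of_real a + of_real b * cis \<psi>"
  have "Im z \<ge> 0" using assms by (simp add: z_def sin_ge_zero)
  then have A0: "Arg z \<ge> 0"
    by (metis Arg_less_0 not_le)
  show ?thesis
  proof (cases "z = 0 \<or> \<psi> = pi")
    case True
    then show ?thesis using A0 Arg_le_pi assms by (auto simp: z_def Arg_zero)
  next
    case False
    have "z = of_real (norm z) * cis (Arg z)" using False by (simp add: rcis_cmod_Arg[unfolded rcis_def])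
    then have "Im (cis (-\<psi>) * z) = Im (cis (-\<psi>) * (of_real (norm z) * cis (Arg z)))" by simp
    also have "\<dots> = norm z * sin (Arg z - \<psi>)" by (simp add: sin_diff algebra_simps)
    finally have "Im (cis (-\<psi>) * z) = norm z * sin (Arg z - \<psi>)" .
    moreover have "Im (cis (-\<psi>) * z) = - a * sin \<psi>" by (simp add: z_def algebra_simps)
    moreover have "sin \<psi> \<ge> 0" using assms by (simp add: sin_ge_zero)
    ultimately have s: "norm z * sin (Arg z - \<psi>) \<le> 0" using assms by (simp add: mult_nonpos_nonneg)
    have "Arg z \<le> \<psi>"
    proof (rule ccontr)
      assume *: "\<not> Arg z \<le> \<psi>"
      show False
      proof (cases "Arg z - \<psi> < pi")
        case True
        then have "sin (Arg z - \<psi>) > 0" using * by (intro sin_gt_zero) auto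
        then show False using s False by (simp add: mult_le_0_iff)
      next
        case 2: False
        then have "\<psi> = 0" using Arg_le_pi[of z] assms by linarith
        then have "z = of_real (a + b)" by (simp add: z_def)
        moreover have "a + b > 0" using assms by simp
        ultimately have "Arg z = 0" by (metis Arg_of_real not_less_iff_gr_or_eq)
        then show False using * assms by simp
      qed
    qed
    then show ?thesis using A0 by (simp add: z_def)
  qed
qed

text \<open>With \<open>\<theta> = - Arg z\<close> the two sectors have openings
  \<open>(pi - \<theta>) / 3\<close> and \<open>\<theta> / 3\<close>, so the phases of
  \<open>cubic_period (1 - z)\<close> and \<open>cnj (cubic_period z)\<close> add up to at most
  \<open>pi / 3\<close> in absolute value, whatever \<open>z\<close> is. The ratio of the periods
  thus stays in a sector well inside the right half-plane, also for \<open>z\<close> on the cut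
  \<open>(1, \<infinity>)\<close>.\<close>

lemma cubic_period_ratio_cone:
  assumes im: "Im z \<le> 0" and nn: "z \<notin> \<real>\<^sub>\<le>\<^sub>0" and ne: "z \<noteq> 1"
  shows "Re (cubic_period (1 - z) * cnj (cubic_period z)) \<ge> 1/2 * (norm (cubic_period (1 - z)) * norm (cubic_period z))"
    "Re (cubic_period (1 - z)) \<ge> 1/2 * (LINT u:{0<..}|lborel. norm (complex_of_real (u powr (-1/3) * (norm (1 - z) + u) powr (-2/3)) * (1 + sgn (1 - z) * of_real u) powr of_real (-1/3)))"
    "Re (cubic_period z) \<ge> 1/2 * (LINT u:{0<..}|lborel. norm (complex_of_real (u powr (-1/3) * (norm (cnj z) + u) powr (-2/3)) * (1 + sgn (cnj z) * of_real u) powr of_real (-1/3)))"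
proof -
  define \<theta> where "\<theta> = - Arg z"
  have l0: "z \<noteq> 0" using nn by auto
  have "Arg z \<noteq> pi" using nn by (metis Arg_eq_pi_iff complex_nonpos_Reals_iff less_eq_real_def Reals_0 complex_is_Real_iff)
  have "Arg z \<le> 0"
  proof (cases "Im z = 0")
    case True
    then have "Re z > 0" using nn by (auto simp: complex_nonpos_Reals_iff not_le)
    then show ?thesis using True by (metis Arg_eq_0 complex_is_Real_iff less_imp_le order_refl)
  next
    case False
    then show ?thesis using im Arg_less_0[of z] by linarith
  qed
  then have \<theta>: "0 \<le> \<theta>" "\<theta> \<le> pi" using mpi_less_Arg[of z] by (auto simp: \<theta>_def)
  have l: "z = of_real (norm z) * cis (-\<theta>)" using l0 by (simp add: \<theta>_def rcis_cmod_Arg[unfolded rcis_def])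
  have cis': "cis (pi - \<theta>) = - cis (-\<theta>)" by (simp add: complex_eq_iff cos_diff sin_diff)
  have arg1: "0 \<le> Arg (1 + (1 - z) * of_real v) \<and> Arg (1 + (1 - z) * of_real v) \<le> 3 * ((pi - \<theta>)/3)" if v: "v > 0" for v
  proof -
    have "1 + (1 - z) * of_real v = of_real (1 + v) + of_real (norm z * v) * cis (pi - \<theta>)"
      unfolding cis' by (subst l) (simp add: algebra_simps)
    then show ?thesis using Arg_add_cone[of "1 + v" "norm z * v" "pi - \<theta>"] v \<theta> by (simp del: of_real_add of_real_mult)
  qed
  have arg2: "0 \<le> Arg (1 + cnj z * of_real v) \<and> Arg (1 + cnj z * of_real v) \<le> 3 * (\<theta>/3)" if v: "v > 0" for v
  proof -
    have "1 + cnj z * of_real v = of_real 1 + of_real (norm z * v) * cis \<theta>"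
      by (subst l) (simp add: algebra_simps cis_cnj)
    then show ?thesis using Arg_add_cone[of "1" "norm z * v" "\<theta>"] v \<theta> by (simp del: of_real_add of_real_mult)
  qed
  note c1 = cubic_period_cone[of "1 - z" "(pi - \<theta>)/3", OF _ _ _ arg1]
  note c2 = cubic_period_cone[of "cnj z" "\<theta>/3", OF _ _ _ arg2]
  obtain r1 a1 where 1: "r1 \<ge> 0" "0 \<le> a1" "a1 \<le> (pi - \<theta>)/3" "cubic_period (1 - z) = of_real r1 * cis (-a1)"
  proof -
    have h: "1 - z \<noteq> 0" "0 \<le> (pi - \<theta>)/3" "(pi - \<theta>)/3 \<le> pi/3" "(pi - \<theta>)/3 \<le> pi/2" using ne \<theta> pi_gt_zero by auto
    show ?thesis by (rule cone_arg[OF c1(1-3)[OF h(1-3)] h(2,4)]) (assumption | rule that)+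
  qed
  obtain r2 a2 where 2: "r2 \<ge> 0" "0 \<le> a2" "a2 \<le> \<theta>/3" "cubic_period (cnj z) = of_real r2 * cis (-a2)"
  proof -
    have h: "cnj z \<noteq> 0" "0 \<le> \<theta>/3" "\<theta>/3 \<le> pi/3" "\<theta>/3 \<le> pi/2" using l0 \<theta> pi_gt_zero by auto
    show ?thesis by (rule cone_arg[OF c2(1-3)[OF h(1-3)] h(2,4)]) (assumption | rule that)+
  qed
  have cnj: "cnj (cubic_period z) = of_real r2 * cis (-a2)"
    using 2 cubic_period_cnj[OF nn] by simp
  have n1: "norm (cubic_period (1 - z)) = r1" using 1 by (simp add: norm_mult)
  have n2: "norm (cubic_period z) = r2"
    using arg_cong[OF cnj, of norm] 2 by (simp add: norm_mult)
  have "cubic_period (1 - z) * cnj (cubic_period z) = of_real (r1 * r2) * (cis (-a1) * cis (-a2))"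
    unfolding 1(4) cnj by simp
  then have eq: "cubic_period (1 - z) * cnj (cubic_period z) = of_real (r1 * r2) * cis (- (a1 + a2))"
    by (simp add: cis_mult)
  have "cos (pi/3) \<le> cos (a1 + a2)" using 1 2 pi_gt_zero \<theta> by (intro cos_monotone_0_pi_le) auto
  then have "(r1 * r2) * (1/2) \<le> (r1 * r2) * cos (a1 + a2)" using 1 2 by (intro mult_left_mono) (auto simp: cos_60)
  then show "Re (cubic_period (1 - z) * cnj (cubic_period z)) \<ge> 1/2 * (norm (cubic_period (1 - z)) * norm (cubic_period z))"
    unfolding n1 n2 eq using cos_minus[of "a1 + a2"] by (simp add: algebra_simps)
  show "Re (cubic_period (1 - z)) \<ge> 1/2 * (LINT u:{0<..}|lborel. norm (complex_of_real (u powr (-1/3) * (norm (1 - z) + u) powr (-2/3)) * (1 + sgn (1 - z) * of_real u) powr of_real (-1/3)))"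
    using c1(4) ne \<theta> by auto
  show "Re (cubic_period z) \<ge> 1/2 * (LINT u:{0<..}|lborel. norm (complex_of_real (u powr (-1/3) * (norm (cnj z) + u) powr (-2/3)) * (1 + sgn (cnj z) * of_real u) powr of_real (-1/3)))"
    using c2(4) l0 \<theta> cubic_period_cnj[OF nn] by auto
qed

section \<open>Growth bounds for the period and the period ratio\<close>

lemma norm_integral_lower_bound:
  assumes w: "w \<noteq> 0"
  shows "(LINT u:{0<..}|lborel. norm (complex_of_real (u powr (-1/3) * (norm w + u) powr (-2/3)) * (1 + sgn w * of_real u) powr of_real (-1/3)))
     \<ge> 3 powr (-4/3) * (1 + norm w) powr (-1/3)"
proof -
  define f where "f = (\<lambda>u. norm (complex_of_real (u powr (-1/3) * (norm w + u) powr (-2/3)) * (1 + sgn w * of_real u) powr of_real (-1/3)))"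
  \<comment> \<open>On \<open>[M, 2 * M]\<close> the bases \<open>u\<close>,
    \<open>norm w + u\<close> and the norm of \<open>1 + sgn w * of_real u\<close> are all at most
    \<open>3 * M\<close>, so the integrand is at least \<open>(3 * M) powr (-4/3)\<close>; the
    length \<open>M\<close> of the interval improves the exponent to \<open>-1/3\<close>.\<close>
  define M where "M = 1 + norm w"
  have M: "M \<ge> 1" by (simp add: M_def)
  have f: "set_integrable lborel {0<..} f"
    using set_integrable_norm[OF integrable_scaled[OF w]] unfolding f_def .
  have fI: "set_integrable lborel {M..2*M} f" by (rule set_integrable_subset[OF f]) (use M in auto)
  define c where "c = 3 powr (-4/3) * M powr (-4/3)"
  have "(LINT u:{M..2*M}|lborel. c) \<le> (LINT u:{M..2*M}|lborel. f u)"
  proof (rule set_integral_mono[OF _ fI])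
    fix u :: real assume u: "u \<in> {M..2*M}"
    define z where "z = 1 + sgn w * of_real u"
    have u0: "u \<ge> 1" using u M by auto
    have nz: "norm z \<le> 3 * M"
    proof -
      have "norm z \<le> norm (1::complex) + norm (sgn w * of_real u)" unfolding z_def by (rule norm_triangle_ineq)
      also have "\<dots> = 1 + u" using w u0 by (simp add: norm_mult norm_sgn)
      finally show ?thesis using u M by auto
    qed
    show "c \<le> f u"
    proof (cases "u = 1")
      case False
      have "\<bar>1 - u\<bar> \<le> norm z"
        using norm_triangle_ineq3[of 1 "- (sgn w * of_real u)"] w u0 by (simp add: z_def norm_mult norm_sgn)
      then have zpos: "norm z > 0" using False by auto
      have "c = 3 powr (-1/3) * M powr (-1/3) * (3 powr (-2/3) * M powr (-2/3)) * (3 powr (-1/3) * M powr (-1/3))"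
      proof -
        have "a powr (-1/3) * a powr (-2/3) * a powr (-1/3) = a powr (-4/3)" for a :: real
          unfolding powr_add[symmetric] by simp
        then have "c = (3 powr (-1/3) * 3 powr (-2/3) * 3 powr (-1/3)) * (M powr (-1/3) * M powr (-2/3) * M powr (-1/3))"
          by (simp only: c_def)
        then show ?thesis by (simp only: mult_ac)
      qed
      also have "\<dots> = (3 * M) powr (-1/3) * (3 * M) powr (-2/3) * (3 * M) powr (-1/3)"
        using M by (simp add: powr_mult)
      also have "\<dots> \<le> u powr (-1/3) * (norm w + u) powr (-2/3) * norm z powr (-1/3)"
      proof (intro mult_mono powr_mono2')
        have "norm w \<ge> 0" by simp
        then show "0 < u" "0 < norm w + u" using u0 by linarith+
        show "u \<le> 3 * M" "norm w + u \<le> 3 * M" using u by (auto simp: M_def)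
      qed (use nz zpos in auto)
      also have "norm z powr (-1/3) = norm (z powr of_real (-1/3))"
        by (subst norm_powr_real_powr') auto
      also have "u powr (-1/3) * (norm w + u) powr (-2/3) * norm (z powr of_real (-1/3)) = f u"
        unfolding f_def z_def[symmetric] norm_mult norm_of_real by (simp add: abs_mult)
      finally show ?thesis .
    next
      \<comment> \<open>Here \<open>u = 1\<close> forces \<open>M = 1\<close>, hence
        \<open>w = 0\<close>, which is excluded.\<close>
      case True
      then show ?thesis using u M w by (simp add: M_def)
    qed
  qed (auto simp: set_integrable_def emeasure_lborel_Icc_eq intro!: integrable_real_indicator)
  also have "\<dots> \<le> (LINT u:{0<..}|lborel. f u)"
    unfolding set_lebesgue_integral_def using f fI M unfolding set_integrable_def
    by (intro integral_mono) (auto simp: f_def indicator_def)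
  also have "(LINT u:{M..2*M}|lborel. c) = M * c" using M by (simp add: set_lebesgue_integral_def)
  also have "M * c = 3 powr (-4/3) * (M powr 1 * M powr (-4/3))" using M by (simp add: c_def)
  also have "M powr 1 * M powr (-4/3) = M powr (-1/3)" unfolding powr_add[symmetric] by simp
  finally show ?thesis unfolding f_def M_def .
qed

lemma cubic_period_lower_bounds:
  assumes "Im z \<le> 0" "z \<notin> \<real>\<^sub>\<le>\<^sub>0" "z \<noteq> 1"
  shows "norm (cubic_period (1 - z)) \<ge> 3 powr (-4/3) / 2 * (1 + norm (1 - z)) powr (-1/3)"
    "norm (cubic_period z) \<ge> 3 powr (-4/3) / 2 * (1 + norm z) powr (-1/3)"
proof -
  have "z \<noteq> 0" using assms by auto
  then show "norm (cubic_period (1 - z)) \<ge> 3 powr (-4/3) / 2 * (1 + norm (1 - z)) powr (-1/3)"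
    "norm (cubic_period z) \<ge> 3 powr (-4/3) / 2 * (1 + norm z) powr (-1/3)"
    using cubic_period_ratio_cone(2,3)[OF assms] norm_integral_lower_bound[of "1 - z"] norm_integral_lower_bound[of "cnj z"]
      complex_Re_le_cmod[of "cubic_period (1 - z)"] complex_Re_le_cmod[of "cubic_period z"] assms(3)
    by auto
qed

text \<open>In the right half-plane \<open>norm (1 + z * of_real v) >= norm z * v\<close>, which
  takes \<open>norm z powr (-1/3)\<close> out of the integral. What remains is the Beta value
  \<open>B(1/3, 1/3)\<close>, called \<open>D\<close>; passing to \<open>D + 1\<close> makes
  positivity evident.\<close>

lemma cubic_period_upper_bound:
  obtains C where "C > 0" "\<And>z. Re z \<ge> 1/2 \<Longrightarrow> norm (cubic_period z) \<le> C * norm z powr (-1/3)"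
proof -
  define D where "D = (LINT v:{0<..}|lborel. v powr (-2/3) * (1 + v) powr (-2/3 :: real))"
  have int: "set_integrable lborel {0<..} (\<lambda>v::real. v powr (-2/3) * (1 + v) powr (-2/3))"
    by (rule set_integrable_powr_mult_powr) auto
  have D: "D \<ge> 0" unfolding D_def set_lebesgue_integral_def by (intro integral_nonneg_AE AE_I2) auto
  have "norm (cubic_period z) \<le> D * norm z powr (-1/3)" if z: "Re z \<ge> 1/2" for z
  proof -
    have z0: "z \<noteq> 0" "z \<notin> \<real>\<^sub>\<le>\<^sub>0" using z by (auto simp: complex_nonpos_Reals_iff)
    define f where "f = (\<lambda>v. complex_of_real (v powr (-1/3) * (1 + v) powr (-2/3)) * (1 + z * of_real v) powr of_real (-1/3))"
    have f: "set_integrable lborel {0<..} f" unfolding f_def by (rule set_integrable_cubic_period[OF z0(2)])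
    have "norm (cubic_period z) \<le> (LINT v:{0<..}|lborel. norm (f v))"
      unfolding cubic_period_altdef f_def[symmetric] by (rule set_integral_norm_bound[OF f])
    also have "\<dots> \<le> (LINT v:{0<..}|lborel. norm z powr (-1/3) * (v powr (-2/3) * (1 + v) powr (-2/3)))"
    proof (rule set_integral_mono)
      fix v :: real assume "v \<in> {0<..}"
      then have v: "v > 0" by simp
      have "(norm z * v)\<^sup>2 \<le> (norm (1 + z * of_real v))\<^sup>2"
        unfolding cmod_power2 power_mult_distrib using z v by (simp add: power2_eq_square algebra_simps)
      then have "norm z * v \<le> norm (1 + z * of_real v)" by (rule power2_le_imp_le) simp
      then have "norm (1 + z * of_real v) powr (-1/3) \<le> (norm z * v) powr (-1/3)"
        using z0 v by (intro powr_mono2') auto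
      also have "\<dots> = norm z powr (-1/3) * v powr (-1/3)" by (rule powr_mult)
      finally have "v powr (-1/3) * (1 + v) powr (-2/3) * norm (1 + z * of_real v) powr (-1/3) \<le>
        v powr (-1/3) * (1 + v) powr (-2/3) * (norm z powr (-1/3) * v powr (-1/3))"
        by (intro mult_left_mono) auto
      also have "\<dots> = norm z powr (-1/3) * ((v powr (-1/3) * v powr (-1/3)) * (1 + v) powr (-2/3))"
        by (simp add: mult_ac)
      also have "v powr (-1/3) * v powr (-1/3) = v powr (-2/3)" by (simp flip: powr_add)
      finally have "v powr (-1/3) * (1 + v) powr (-2/3) * norm (1 + z * of_real v) powr (-1/3) \<le>
          norm z powr (-1/3) * (v powr (-2/3) * (1 + v) powr (-2/3))" .
      moreover have "norm (f v) = v powr (-1/3) * (1 + v) powr (-2/3) * norm (1 + z * of_real v) powr (-1/3)"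
      proof -
        have "norm ((1 + z * of_real v) powr of_real (-1/3)) = norm (1 + z * of_real v) powr (-1/3)"
          by (subst norm_powr_real_powr') auto
        then show ?thesis unfolding f_def norm_mult norm_of_real by (simp add: abs_mult)
      qed
      ultimately show "norm (f v) \<le> norm z powr (-1/3) * (v powr (-2/3) * (1 + v) powr (-2/3))" by simp
    qed (use int set_integrable_norm[OF f] in auto)
    also have "\<dots> = norm z powr (-1/3) * D" unfolding D_def by simp
    finally show ?thesis by (simp add: mult.commute)
  qed
  then have *: "norm (cubic_period z) \<le> D * norm z powr (-1/3)" if "Re z \<ge> 1/2" for z using that .
  have "norm (cubic_period z) \<le> (D + 1) * norm z powr (-1/3)" if "Re z \<ge> 1/2" for z
    using *[OF that] by (rule order_trans) (auto intro: mult_right_mono)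
  then show ?thesis using D by (intro that[of "D + 1"]) auto
qed

text \<open>The lower bound for the numerator and the upper bound for the denominator scale alike,
  as \<open>norm z powr (-1/3)\<close>, and the sector estimate transfers the bound on the norm of
  the ratio to its real part. For \<open>tau\<close> this means the height is at least
  \<open>c / sqrt 3\<close>.\<close>

lemma cubic_ratio_Re_lower_bound:
  obtains c where "c > 0"
    "\<And>z. Re z \<ge> 1/2 \<Longrightarrow> Im z \<le> 0 \<Longrightarrow> z \<noteq> 1 \<Longrightarrow> Re (cubic_period (1 - z) / cubic_period z) \<ge> c"
proof -
  obtain C where C: "C > 0" "\<And>z. Re z \<ge> 1/2 \<Longrightarrow> norm (cubic_period z) \<le> C * norm z powr (-1/3)"
    using cubic_period_upper_bound by blast
  define c where "c = 1/2 * (3 powr (-4/3) / 2 * 5 powr (-1/3) / C)"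
  have "Re (cubic_period (1 - z) / cubic_period z) \<ge> c" if z: "Re z \<ge> 1/2" "Im z \<le> 0" "z \<noteq> 1" for z
  proof -
    have nn: "z \<notin> \<real>\<^sub>\<le>\<^sub>0" using z by (auto simp: complex_nonpos_Reals_iff)
    have nz: "norm z \<ge> 1/2" using z(1) complex_Re_le_cmod[of z] by linarith
    have "(1 + norm z) powr (-1/3) > 0" using norm_ge_zero[of z] by (subst powr_gt_zero) linarith
    then have "0 < 3 powr (-4/3) / 2 * (1 + norm z) powr (-1/3)" by (intro mult_pos_pos) auto
    then have pos: "norm (cubic_period z) > 0"
      using cubic_period_lower_bounds(2)[OF z(2) nn z(3)] by (rule less_le_trans)
    have low: "3 powr (-4/3) / 2 * (5 powr (-1/3) * norm z powr (-1/3)) \<le> norm (cubic_period (1 - z))"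
    proof -
      \<comment> \<open>The left side is at most \<open>2 + norm z\<close>, and
        \<open>2 <= 4 * norm z\<close>.\<close>
      have "1 + norm (1 - z) \<le> 5 * norm z" using nz norm_triangle_ineq4[of 1 z] by simp
      then have "(5 * norm z) powr (-1/3) \<le> (1 + norm (1 - z)) powr (-1/3)"
        by (intro powr_mono2') (auto intro: add_pos_nonneg)
      then have "3 powr (-4/3) / 2 * (5 * norm z) powr (-1/3) \<le> 3 powr (-4/3) / 2 * (1 + norm (1 - z)) powr (-1/3)"
        by (intro mult_left_mono) auto
      also have "\<dots> \<le> norm (cubic_period (1 - z))" by (rule cubic_period_lower_bounds(1)[OF z(2) nn z(3)])
      finally show ?thesis by (simp add: powr_mult)
    qed
    have zp: "norm z powr (-1/3) > 0" using nz by (cases "z = 0") auto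
    have "3 powr (-4/3) / 2 * 5 powr (-1/3) / C = (3 powr (-4/3) / 2 * (5 powr (-1/3) * norm z powr (-1/3))) / (C * norm z powr (-1/3))"
      using zp C by (simp add: field_simps)
    also have "\<dots> \<le> norm (cubic_period (1 - z)) / norm (cubic_period z)"
      using low C(2)[OF z(1)] pos by (intro frac_le) auto
    finally have "c \<le> 1/2 * (norm (cubic_period (1 - z)) / norm (cubic_period z))" by (simp add: c_def)
    also have "\<dots> = (1/2 * (norm (cubic_period (1 - z)) * norm (cubic_period z))) / (norm (cubic_period z))\<^sup>2"
      using pos by (simp add: power2_eq_square)
    also have "\<dots> \<le> Re (cubic_period (1 - z) * cnj (cubic_period z)) / (norm (cubic_period z))\<^sup>2"
      by (intro divide_right_mono cubic_period_ratio_cone(1)[OF z(2) nn z(3)]) auto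
    also have "\<dots> = Re (cubic_period (1 - z) * cnj (cubic_period z) / of_real ((norm (cubic_period z))\<^sup>2))"
      by (simp only: Re_divide_of_real)
    also have "cubic_period (1 - z) * cnj (cubic_period z) / of_real ((norm (cubic_period z))\<^sup>2) = cubic_period (1 - z) / cubic_period z"
      by (metis complex_div_cnj of_real_power)
    finally show ?thesis .
  qed
  moreover have "c > 0" using C by (simp add: c_def)
  ultimately show ?thesis using that by blast
qed

text \<open>For the negative argument \<open>1 - x\<close> the integrand is real up to
  \<open>v = 1 / (x - 1)\<close> and has phase \<open>cis (- (pi / 3))\<close> beyond. The imaginary
  part is therefore \<open>- sin (pi / 3)\<close> times a tail integral, and this tail is again a
  period. The identity is the monodromy behind \<open>\<tau> \<mapsto> \<tau> + 1\<close>.\<close>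

lemma Im_cubic_period_cut:
  fixes x :: real
  assumes x: "x > 1"
  shows "Im (cubic_period (of_real (1 - x))) = - (sqrt 3 / 2) * cubic_period_real x"
proof -
  define y where "y = x - 1"
  have y: "y > 0" "1 + y = x" using x by (auto simp: y_def)
  define f where "f = (\<lambda>v. complex_of_real (v powr (-1/3) * (1 + v) powr (-2/3)) * (1 + of_real (-y) * of_real v) powr of_real (-1/3))"
  have N: "cubic_period (of_real (1 - x)) = (\<integral>v. indicator {0<..} v *\<^sub>R f v \<partial>lborel)"
    unfolding cubic_period_altdef f_def set_lebesgue_integral_def y_def by simp
  have int: "integrable lborel (\<lambda>v. indicator {0<..} v *\<^sub>R f v)"
  proof -
    have "integrable lborel (\<lambda>v. indicator {0<..} (0 + y * v) *\<^sub>R (complex_of_real ((0 + y * v) powr (-1/3) * (norm (of_real (-y) :: complex) + (0 + y * v)) powr (-2/3)) *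
      (1 + sgn (of_real (-y)) * of_real (0 + y * v)) powr of_real (-1/3)))"
      using integrable_scaled[of "of_real (-y)"] y unfolding set_integrable_def
      by (intro lborel_integrable_real_affine) auto
    then have "integrable lborel (\<lambda>v. y *\<^sub>R (indicator {0<..} (0 + y * v) *\<^sub>R (complex_of_real ((0 + y * v) powr (-1/3) * (norm (of_real (-y) :: complex) + (0 + y * v)) powr (-2/3)) *
      (1 + sgn (of_real (-y)) * of_real (0 + y * v)) powr of_real (-1/3))))"
      by (rule integrable_scaleR_right)
    moreover have "y *\<^sub>R (indicator {0<..} (0 + y * v) *\<^sub>R (complex_of_real ((0 + y * v) powr (-1/3) * (norm (of_real (-y) :: complex) + (0 + y * v)) powr (-2/3)) *
      (1 + sgn (of_real (-y)) * of_real (0 + y * v)) powr of_real (-1/3))) = indicator {0<..} v *\<^sub>R f v" for v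
    proof (cases "v > 0")
      case True
      have s: "sgn (complex_of_real (-y)) * of_real (0 + y * v) = of_real (-y) * of_real v"
        using y by (simp add: sgn_of_real)
      have "norm (complex_of_real (-y)) + (0 + y * v) = y * (1 + v)" using y by (simp add: algebra_simps)
      then have a: "(norm (complex_of_real (-y)) + (0 + y * v)) powr (-2/3) = y powr (-2/3) * (1 + v) powr (-2/3)"
        by (simp add: powr_mult)
      have "y * ((0 + y * v) powr (-1/3) * (y powr (-2/3) * (1 + v) powr (-2/3)))
         = (y powr 1 * y powr (-1/3) * y powr (-2/3)) * (v powr (-1/3) * (1 + v) powr (-2/3))"
        using y by (simp add: powr_mult)
      also have "y powr 1 * y powr (-1/3) * y powr (-2/3) = 1" using y unfolding powr_add[symmetric] by simp
      finally have b: "y * ((0 + y * v) powr (-1/3) * (y powr (-2/3) * (1 + v) powr (-2/3))) = v powr (-1/3) * (1 + v) powr (-2/3)" by simp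
      show ?thesis unfolding a s f_def b[symmetric] using True y
        by (simp add: scaleR_conv_of_real mult_ac)
    next
      case False
      then have "\<not> 0 + y * v > 0" using y by (simp add: zero_less_mult_iff)
      then show ?thesis using False by simp
    qed
    ultimately show ?thesis by simp
  qed
  define g where "g = (\<lambda>v. indicator {1/y<..} v *\<^sub>R (v powr (-1/3) * (1 + v) powr (-2/3) * (y * v - 1) powr (-1/3)))"
  have Imf: "Im (indicator {0<..} v *\<^sub>R f v) = - (sqrt 3 / 2) * g v" for v
  proof (cases "v > 1/y")
    case True
    have v: "v > 0" using True y by (smt (verit) zero_less_divide_1_iff)
    have neg: "1 + (-y) * v < 0" using True y by (simp add: field_simps)
    have "(1 + of_real (-y) * of_real v :: complex) powr of_real (-1/3) = of_real (1 + (-y) * v) powr of_real (-1/3)" by simp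
    also have "\<dots> = of_real ((y * v - 1) powr (-1/3)) * exp (\<i> * pi * of_real (-1/3))"
      using neg by (subst powr_of_real_if) (simp add: abs_if)
    also have "exp (\<i> * pi * of_real (-1/3)) = cis (- (pi / 3))" by (simp add: cis_conv_exp)
    finally show ?thesis using True v by (simp add: f_def g_def sin_60)
  next
    case False
    show ?thesis
    proof (cases "v > 0")
      case True
      have "1 + (-y) * v \<ge> 0" using False y by (simp add: field_simps)
      then have "(of_real (1 + (-y) * v) :: complex) powr of_real (-1/3) = of_real ((1 + (-y) * v) powr (-1/3))"
        by (rule powr_of_real)
      then have "f v = of_real (v powr (-1/3) * (1 + v) powr (-2/3) * (1 + (-y) * v) powr (-1/3))" by (simp add: f_def)
      then show ?thesis using False by (simp add: g_def)
    qed (use False in \<open>auto simp: g_def\<close>)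
  qed
  have "Im (cubic_period (of_real (1 - x))) = (\<integral>v. - (sqrt 3 / 2) * g v \<partial>lborel)"
    unfolding N integral_Im[OF int, symmetric] Imf ..
  also have "\<dots> = - (sqrt 3 / 2) * (\<integral>v. g v \<partial>lborel)" by (rule integral_mult_right_zero)
  \<comment> \<open>This affine map sends \<open>{0<..}\<close> onto \<open>{1/y<..}\<close> and
    permutes the linear factors up to scale: \<open>v\<close>, \<open>1 + v\<close>,
    \<open>y * v - 1\<close> become \<open>1 + x * s\<close>, \<open>1 + s\<close>,
    \<open>s\<close>.\<close>
  also have "(\<integral>v. g v \<partial>lborel) = \<bar>x/y\<bar> *\<^sub>R (\<integral>s. g (1/y + x/y * s) \<partial>lborel)"
    using x y by (intro lborel_integral_real_affine) auto
  also have "\<dots> = (\<integral>s. \<bar>x/y\<bar> *\<^sub>R g (1/y + x/y * s) \<partial>lborel)" by (rule Bochner_Integration.integral_scaleR_right[symmetric])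
  also have "\<dots> = cubic_period_real x"
    unfolding cubic_period_real_def set_lebesgue_integral_def
  proof (rule Bochner_Integration.integral_cong[OF refl])
    fix s :: real
    show "\<bar>x/y\<bar> *\<^sub>R g (1/y + x/y * s) = indicator {0<..} s *\<^sub>R (s powr (-1/3) * (1 + s) powr (-2/3) * (1 + x * s) powr (-1/3))"
    proof (cases "s > 0")
      case True
      have v1: "1/y + x/y * s = (1 + x * s) / y" using y by (simp add: field_simps)
      have "1 + (1/y + x/y * s) = x * (1 + s) / y" using y by (simp add: field_simps)
      then have v2: "(1 + (1/y + x/y * s)) powr (-2/3) = x powr (-2/3) * (1 + s) powr (-2/3) / y powr (-2/3)"
        using x y True by (simp add: powr_mult powr_divide)
      have v3: "y * (1/y + x/y * s) - 1 = x * s" using y by (simp add: field_simps)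
      have v4: "(1/y + x/y * s) powr (-1/3) = (1 + x * s) powr (-1/3) / y powr (-1/3)"
        unfolding v1 using x y True by (simp add: powr_divide)
      have p1: "y powr (-1/3) * y powr (-2/3) * y = 1"
        using y powr_add[of y "-1/3" "-2/3"] powr_add[of y "-1" 1] by simp
      have p2: "x powr (-1/3) * x powr (-2/3) * x = 1"
        using x powr_add[of x "-1/3" "-2/3"] powr_add[of x "-1" 1] by simp
      have "g (1/y + x/y * s) = (1/y + x/y * s) powr (-1/3) * (1 + (1/y + x/y * s)) powr (-2/3) * (y * (1/y + x/y * s) - 1) powr (-1/3)"
        using True x y by (simp add: g_def)
      also have "\<dots> = ((1 + x * s) powr (-1/3) / y powr (-1/3)) * (x powr (-2/3) * (1 + s) powr (-2/3) / y powr (-2/3)) * (x powr (-1/3) * s powr (-1/3))"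
        unfolding v2 v3 v4 powr_mult ..
      finally have g: "g (1/y + x/y * s) = \<dots>" .
      have "\<bar>x/y\<bar> *\<^sub>R g (1/y + x/y * s) = (x powr (-1/3) * x powr (-2/3) * x) / (y powr (-1/3) * y powr (-2/3) * y) *
          (s powr (-1/3) * (1 + s) powr (-2/3) * (1 + x * s) powr (-1/3))"
        unfolding g using x y by (simp add: mult_ac)
      then show ?thesis unfolding p1 p2 using True by simp
    next
      case False
      then have "\<not> 1/y + x/y * s > 1/y" using x y by (simp add: zero_less_mult_iff zero_less_divide_iff)
      then show ?thesis using False by (simp add: g_def)
    qed
  qed
  finally show ?thesis .
qed

section \<open>Logarithmic growth of the period at 0\<close>

lemma cubic_period_real_log_lower_bound:
  assumes e: "\<epsilon> > 0"
  shows "cubic_period_real \<epsilon> \<ge> 2 powr (-1/3) * ln (1 / \<epsilon>)"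
proof -
  define f where "f = (\<lambda>v. v powr (-1/3) * (1 + v) powr (-2/3) * (1 + \<epsilon> * v) powr (-1/3))"
  have f: "set_integrable lborel {0<..} f" unfolding f_def by (rule set_integrable_cubic_period_real[OF e])
  have fI: "set_integrable lborel {0<..1/\<epsilon>} f" by (rule set_integrable_subset[OF f]) auto
  have cont: "continuous_on {0..1/\<epsilon>} (\<lambda>v::real. 2 powr (-1/3) * (1 / (1 + v)))"
    by (intro continuous_intros) auto
  have gI: "set_integrable lborel {0..1/\<epsilon>} (\<lambda>v::real. 2 powr (-1/3) * (1 / (1 + v)))"
    using cont unfolding set_integrable_def by (intro borel_integrable_compact) auto
  have hi: "((\<lambda>v. 2 powr (-1/3) * (1 / (1 + v))) has_integral (2 powr (-1/3) * ln (1 + 1/\<epsilon>) - 2 powr (-1/3) * ln (1 + 0))) {0..1/\<epsilon>}"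
    using e by (intro fundamental_theorem_of_calculus)
      (auto intro!: derivative_eq_intros simp flip: has_real_derivative_iff_has_vector_derivative)
  have "2 powr (-1/3) * ln (1 / \<epsilon>) \<le> 2 powr (-1/3) * ln (1 + 1/\<epsilon>)"
    using e by (intro mult_left_mono) (auto intro!: ln_mono add_pos_pos)
  also have "\<dots> = (LINT v:{0..1/\<epsilon>}|lborel. 2 powr (-1/3) * (1 / (1 + v)))"
    using set_borel_integral_eq_integral(2)[OF gI] integral_unique[OF hi] by simp
  also have "\<dots> = (LINT v:{0<..1/\<epsilon>}|lborel. 2 powr (-1/3) * (1 / (1 + v)))"
    by (rule set_integral_discrete_difference[of "{0}"]) auto
  also have "\<dots> \<le> (LINT v:{0<..1/\<epsilon>}|lborel. f v)"
  proof (rule set_integral_mono[OF set_integrable_subset[OF gI] fI])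
    fix v assume "v \<in> {0<..1/\<epsilon>}"
    then have v: "v > 0" "\<epsilon> * v \<le> 1" using e by (auto simp: field_simps)
    \<comment> \<open>\<open>v powr (-1/3)\<close> exceeds \<open>(1 + v) powr (-1/3)\<close>, and
      the third factor of \<open>f\<close> is at least \<open>2 powr (-1/3)\<close> because
      \<open>\<epsilon> * v <= 1\<close>.\<close>
    have "2 powr (-1/3) * (1 / (1 + v)) = (1 + v) powr (-1/3) * (1 + v) powr (-2/3) * 2 powr (-1/3)"
      using v powr_add[of "1 + v" "-1/3" "-2/3"] by simp
    also have "\<dots> \<le> f v" unfolding f_def using v e
      by (intro mult_mono powr_mono2') (auto intro: add_pos_pos)
    finally show "2 powr (-1/3) * (1 / (1 + v)) \<le> f v" .
  qed auto
  also have "\<dots> \<le> (LINT v:{0<..}|lborel. f v)"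
    unfolding set_lebesgue_integral_def using f fI unfolding set_integrable_def
    by (intro integral_mono) (auto simp: f_def indicator_def)
  finally show ?thesis unfolding cubic_period_real_def f_def .
qed

text \<open>From \<open>x >= 1/2\<close> follows \<open>1 + x * v >= (1 + v) / 2\<close>, the source
  of \<open>2 powr (1/3)\<close>. What remains is at most \<open>v powr (-1/3)\<close> up to 1 and
  \<open>v powr (-4/3)\<close> beyond, with integrals \<open>3/2\<close> and \<open>3\<close>, in
  all \<open>9/2\<close>.\<close>

lemma cubic_period_real_upper_bound:
  assumes x: "x \<ge> 1/2"
  shows "cubic_period_real x \<le> 2 powr (1/3) * (9/2)"
proof -
  have abs: "set_integrable lborel A f" if "f integrable_on A" "\<And>x. x \<in> A \<Longrightarrow> f x \<ge> 0" "A \<in> sets borel"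
     "f \<in> borel_measurable borel" for A and f :: "real \<Rightarrow> real"
  proof -
    have "f absolutely_integrable_on A" using that by (intro nonnegative_absolutely_integrable_1)
    then show ?thesis using that by (simp add: set_integrable_def integrable_completion)
  qed
  have h1: "((\<lambda>v::real. v powr (-1/3)) has_integral (1 powr (-1/3+1) / (-1/3+1))) {0..1}"
    by (rule has_integral_powr_from_0) auto
  have h2: "((\<lambda>v::real. v powr (-4/3)) has_integral (- (1 powr (-4/3+1)) / (-4/3+1))) {1..}"
    by (rule has_integral_powr_to_inf) auto
  have i1: "set_integrable lborel {0..1} (\<lambda>v::real. v powr (-1/3))"
    using h1 by (intro abs) (auto simp: integrable_on_def)
  have i2: "set_integrable lborel {1..} (\<lambda>v::real. v powr (-4/3))"
    using h2 by (intro abs) (auto simp: integrable_on_def)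
  have v1: "(LINT v:{0..1::real}|lborel. v powr (-1/3)) = 3/2"
    using set_borel_integral_eq_integral(2)[OF i1] integral_unique[OF h1] by simp
  have v2: "(LINT v:{1..}|lborel. v powr (-4/3 :: real)) = 3"
    using set_borel_integral_eq_integral(2)[OF i2] integral_unique[OF h2] by simp
  define f where "f = (\<lambda>v. v powr (-1/3) * (1 + v) powr (-2/3) * (1 + x * v) powr (-1/3))"
  have f: "set_integrable lborel {0<..} f" unfolding f_def by (rule set_integrable_cubic_period_real) (use x in auto)
  have "(LINT v:{0<..}|lborel. f v) \<le> (\<integral>v. 2 powr (1/3) * (indicator {0..1} v *\<^sub>R v powr (-1/3) + indicator {1..} v *\<^sub>R v powr (-4/3)) \<partial>lborel)"
    unfolding set_lebesgue_integral_def
  proof (rule integral_mono)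
    show "integrable lborel (\<lambda>v. 2 powr (1/3) * (indicator {0..1} v *\<^sub>R v powr (-1/3) + indicator {1..} v *\<^sub>R v powr (-4/3 :: real)))"
      using i1 i2 unfolding set_integrable_def by (intro integrable_mult_right integrable_add) auto
    fix v :: real
    show "indicator {0<..} v *\<^sub>R f v \<le> 2 powr (1/3) * (indicator {0..1} v *\<^sub>R v powr (-1/3) + indicator {1..} v *\<^sub>R v powr (-4/3))"
    proof (cases "v > 0")
      case True
      have "v * (1/2) \<le> v * x" using x True by (intro mult_left_mono) auto
      then have "1/2 * (1 + v) \<le> 1 + x * v" by (simp add: algebra_simps)
      then have "(1 + x * v) powr (-1/3) \<le> (1/2 * (1 + v)) powr (-1/3)" using True by (intro powr_mono2') auto
      also have "\<dots> = 2 powr (1/3) * (1 + v) powr (-1/3)"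
        unfolding powr_mult by (simp add: powr_divide powr_minus)
      finally have "f v \<le> v powr (-1/3) * (1 + v) powr (-2/3) * (2 powr (1/3) * (1 + v) powr (-1/3))"
        unfolding f_def by (intro mult_left_mono) auto
      also have "\<dots> = 2 powr (1/3) * (v powr (-1/3) * ((1 + v) powr (-2/3) * (1 + v) powr (-1/3)))" by (simp only: mult_ac)
      also have "(1 + v) powr (-2/3) * (1 + v) powr (-1/3) = 1 / (1 + v)" using True
        by (simp add: powr_minus_divide flip: powr_add)
      finally have b: "f v \<le> 2 powr (1/3) * (v powr (-1/3) * (1 / (1 + v)))" .
      show ?thesis
      proof (cases "v \<le> 1")
        case v1: True
        have "v powr (-1/3) * (1 / (1 + v)) \<le> v powr (-1/3) * 1" using True by (intro mult_left_mono) auto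
        then have "2 powr (1/3) * (v powr (-1/3) * (1 / (1 + v))) \<le> 2 powr (1/3) * (v powr (-1/3) * 1)"
          by (rule mult_left_mono) simp
        then have "f v \<le> 2 powr (1/3) * (v powr (-1/3))" using b by (simp only: mult_1_right)
        also have "\<dots> \<le> 2 powr (1/3) * (indicator {0..1} v *\<^sub>R v powr (-1/3) + indicator {1..} v *\<^sub>R v powr (-4/3))"
          using v1 True by (intro mult_left_mono) auto
        finally show ?thesis using True by simp
      next
        case v1: False
        have "v powr (-1/3) * (1 / (1 + v)) \<le> v powr (-1/3) * (1 / v)" using True by (intro mult_left_mono divide_left_mono) auto
        also have "\<dots> = v powr (-1/3) * v powr (-1)" using True by (simp add: powr_minus_divide)
        also have "\<dots> = v powr (-4/3)" unfolding powr_add[symmetric] by simp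
        finally have "2 powr (1/3) * (v powr (-1/3) * (1 / (1 + v))) \<le> 2 powr (1/3) * (v powr (-4/3))"
          by (rule mult_left_mono) simp
        then show ?thesis using v1 b True by simp
      qed
    qed auto
  qed (use f in \<open>simp add: set_integrable_def\<close>)
  also have "\<dots> = 2 powr (1/3) * ((LINT v:{0..1}|lborel. v powr (-1/3)) + (LINT v:{1..}|lborel. v powr (-4/3)))"
    unfolding set_lebesgue_integral_def integral_mult_right_zero
    using i1 i2 unfolding set_integrable_def by (subst Bochner_Integration.integral_add) auto
  finally show ?thesis unfolding cubic_period_real_def f_def[symmetric] v1 v2 by simp
qed

text \<open>\<open>13/100\<close> is a rational number below
  \<open>2 powr (-1/3) / (2 powr (1/3) * (9/2))\<close>, verified through
  \<open>2 powr (2/3) <= 1.6\<close>. The sharp factor would be \<open>sqrt 3 / (2 * pi)\<close>;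
  the constant has to supply divergence at 0 and a margin against \<alpha> >= 4/3.\<close>

lemma cubic_ratio_log_lower_bound:
  assumes "0 < \<epsilon>" "\<epsilon> \<le> 1/2"
  shows "cubic_period_real \<epsilon> / cubic_period_real (1 - \<epsilon>) \<ge> 13/100 * ln (1 / \<epsilon>)"
proof -
  have l: "ln (1 / \<epsilon>) \<ge> 0" using assms by simp
  have num: "(2::real) powr (-1/3) \<ge> 13/100 * (2 powr (1/3) * (9/2))"
  proof -
    have "(2::real) powr (2/3) \<le> 1.6"
    proof (rule power_le_imp_le_base[of _ 2])
      have "((2::real) powr (2/3)) ^ Suc 2 = 4" by (simp add: powr_power)
      then show "((2::real) powr (2/3)) ^ Suc 2 \<le> 1.6 ^ Suc 2" by (simp add: power_divide)
    qed auto
    then have "13/100 * (9/2) * (2::real) powr (2/3) \<le> 1" by simp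
    then have "2 powr (-1/3) * (13/100 * (9/2) * (2::real) powr (2/3)) \<le> 2 powr (-1/3) * 1" by (intro mult_left_mono) auto
    moreover have "2 powr (-1/3) * (2::real) powr (2/3) = 2 powr (1/3)" by (simp flip: powr_add)
    ultimately show ?thesis by (simp only: mult_ac)
  qed
  have "13/100 * ln (1 / \<epsilon>) * cubic_period_real (1 - \<epsilon>) \<le> 13/100 * ln (1 / \<epsilon>) * (2 powr (1/3) * (9/2))"
    using l assms by (intro mult_left_mono cubic_period_real_upper_bound) auto
  also have "\<dots> = (13/100 * (2 powr (1/3) * (9/2))) * ln (1 / \<epsilon>)" by simp
  also have "\<dots> \<le> 2 powr (-1/3) * ln (1 / \<epsilon>)" by (intro mult_right_mono num l)
  also have "\<dots> \<le> cubic_period_real \<epsilon>" by (rule cubic_period_real_log_lower_bound[OF assms(1)])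
  finally show ?thesis using cubic_period_real_pos[of "1 - \<epsilon>"] assms by (simp add: le_divide_eq)
qed

section \<open>The hypergeometric equation and the Wronskian\<close>

definition cubic_period_deriv :: "complex \<Rightarrow> complex" where
  "cubic_period_deriv w = - (1/3) * euler_integral (2/3) (-4/3) w"

text \<open>The constant is \<open>(-1/3) * (-4/3)\<close>, collected from two differentiations of
  the Euler integral.\<close>

definition cubic_period_deriv2 :: "complex \<Rightarrow> complex" where
  "cubic_period_deriv2 w = 4/9 * euler_integral (5/3) (-7/3) w"

lemma cubic_period_has_field_derivative:
  assumes "w \<notin> \<real>\<^sub>\<le>\<^sub>0"
  shows "(cubic_period has_field_derivative cubic_period_deriv w) (at w)"
proof -
  have "(euler_integral (-1/3) (-1/3) has_field_derivative of_real (-1/3) * euler_integral (-1/3 + 1) (-1/3 - 1) w) (at w)"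
    by (rule has_field_derivative_euler_integral(1)[OF assms]) auto
  then show ?thesis unfolding cubic_period_def[abs_def] cubic_period_deriv_def by simp
qed

lemma cubic_period_deriv_has_field_derivative:
  assumes "w \<notin> \<real>\<^sub>\<le>\<^sub>0"
  shows "(cubic_period_deriv has_field_derivative cubic_period_deriv2 w) (at w)"
proof -
  have "(euler_integral (2/3) (-4/3) has_field_derivative of_real (-4/3) * euler_integral (2/3 + 1) (-4/3 - 1) w) (at w)"
    by (rule has_field_derivative_euler_integral(1)[OF assms]) auto
  from DERIV_cmult[OF this, of "-(1/3)"] show ?thesis
    unfolding cubic_period_deriv_def[abs_def] cubic_period_deriv2_def by simp
qed

text \<open>The hypergeometric operator maps the integrand to the derivative of
  \<open>- 1/3 * v\<^bsup>2/3\<^esup> (1 + v)\<^bsup>1/3\<^esup> (1 + w v)\<^bsup>-4/3\<^esup>\<close>.\<close>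

lemma cubic_period_ode:
  assumes w: "w \<notin> \<real>\<^sub>\<le>\<^sub>0"
  shows "w * (1 - w) * cubic_period_deriv2 w + (1 - 2 * w) * cubic_period_deriv w = 2/9 * cubic_period w"
proof -
  define e where "e = (\<lambda>p s v. complex_of_real (v powr p * (1 + v) powr (-2/3)) * (1 + w * of_real v) powr of_real s)"
  have int: "set_integrable lborel {0<..} (e (-1/3) (-1/3))" "set_integrable lborel {0<..} (e (2/3) (-4/3))"
     "set_integrable lborel {0<..} (e (5/3) (-7/3))"
    unfolding e_def by (rule has_field_derivative_euler_integral(2)[OF w]; simp)+
  define q where "q = (\<lambda>v. w * (1 - w) * (4/9) * e (5/3) (-7/3) v + (1 - 2 * w) * (- (1/3)) * e (2/3) (-4/3) v
     - 2/9 * e (-1/3) (-1/3) v)"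
  have qint: "set_integrable lborel {0<..} q" unfolding q_def
    by (intro set_integral_diff(1) set_integral_add(1) set_integrable_mult_right int)
  have q: "(LINT v:{0<..}|lborel. q v) = w * (1 - w) * cubic_period_deriv2 w + (1 - 2 * w) * cubic_period_deriv w - 2/9 * cubic_period w"
  proof -
    note m = set_integrable_mult_right[OF int(3), of "w * (1 - w) * (4/9)"]
      set_integrable_mult_right[OF int(2), of "(1 - 2 * w) * (- (1/3))"]
      set_integrable_mult_right[OF int(1), of "2/9"]
    have "(LINT v:{0<..}|lborel. q v) = w * (1 - w) * (4/9) * (LINT v:{0<..}|lborel. e (5/3) (-7/3) v)
       + (1 - 2 * w) * (- (1/3)) * (LINT v:{0<..}|lborel. e (2/3) (-4/3) v) - 2/9 * (LINT v:{0<..}|lborel. e (-1/3) (-1/3) v)"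
      unfolding q_def set_integral_diff(2)[OF set_integral_add(1)[OF m(1,2)] m(3)]
        set_integral_add(2)[OF m(1,2)] set_integral_mult_right ..
    then show ?thesis
      unfolding cubic_period_deriv2_def cubic_period_deriv_def cubic_period_def euler_integral_def e_def
      by (simp only: mult.assoc)
  qed
  define Q where "Q = (\<lambda>v. - (1/3) * of_real (v powr (2/3) * (1 + v) powr (1/3)) * (1 + w * of_real v) powr of_real (-4/3))"
  have nn: "1 + w * of_real v \<notin> \<real>\<^sub>\<le>\<^sub>0" if "v > 0" for v
    using one_plus_mult_not_nonpos[OF w, of v] that by simp
  have der: "(Q has_vector_derivative q v) (at v)" if v: "v > 0" for v
  proof -
    \<comment> \<open>All powers are reduced to the lowest exponents \<open>-1/3\<close>,
      \<open>-2/3\<close> and \<open>-7/3\<close>, after which the equality of the derivative of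
      \<open>Q\<close> with \<open>q\<close> is a polynomial identity in \<open>v\<close> and
      \<open>w\<close>.\<close>
    define A where "A = v powr (-1/3)"
    define B where "B = (1 + v) powr (-2/3)"
    define Z where "Z = (1 + w * of_real v) powr of_real (-7/3)"
    have nz: "1 + w * of_real v \<noteq> 0" using nn[OF v] by auto
    have "((\<lambda>v. v powr (2/3) * (1 + v) powr (1/3)) has_real_derivative
        (2/3 * A * (1 + v) powr (1/3) + v powr (2/3) * (1/3 * B))) (at v)"
      using v unfolding A_def B_def by (auto intro!: derivative_eq_intros simp: powr_diff)
    then have d1: "((\<lambda>v. complex_of_real (v powr (2/3) * (1 + v) powr (1/3))) has_vector_derivative
        of_real (2/3 * A * (1 + v) powr (1/3) + v powr (2/3) * (1/3 * B))) (at v)"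
      by (intro has_vector_derivative_of_real) (simp add: has_real_derivative_iff_has_vector_derivative)
    have "((\<lambda>z. (1 + w * z) powr of_real (-4/3)) has_field_derivative of_real (-4/3) * Z * w) (at (of_real v))"
      using nn[OF v] unfolding Z_def by (auto intro!: derivative_eq_intros)
    then have d2: "((\<lambda>v. (1 + w * of_real v) powr of_real (-4/3)) has_vector_derivative of_real (-4/3) * Z * w) (at v)"
      by (rule has_vector_derivative_real_field)
    have a1: "v powr (2/3) = A * v" "v powr (5/3) = A * v\<^sup>2"
      using v powr_add[of v "-1/3" 1] powr_add[of v "-1/3" 2] unfolding A_def by simp_all
    have a2: "(1 + v) powr (1/3) = B * (1 + v)" using v powr_add[of "1 + v" "-2/3" 1] unfolding B_def by simp
    have a3: "(1 + w * of_real v) powr of_real (-4/3) = Z * (1 + w * of_real v)"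
      using nz powr_add[of "1 + w * of_real v" "-7/3" 1] unfolding Z_def by simp
    have a4: "(1 + w * of_real v) powr of_real (-1/3) = Z * (1 + w * of_real v)\<^sup>2"
      using nz powr_add[of "1 + w * of_real v" "-7/3" 2] unfolding Z_def by simp
    have "(Q has_vector_derivative - (1/3) * (of_real (v powr (2/3) * (1 + v) powr (1/3)) * (of_real (-4/3) * Z * w) +
       of_real (2/3 * A * (1 + v) powr (1/3) + v powr (2/3) * (1/3 * B)) * (1 + w * of_real v) powr of_real (-4/3))) (at v)"
      unfolding Q_def mult.assoc[of "-(1/3)"]
      by (intro has_vector_derivative_mult_right has_vector_derivative_mult d1 d2)
    moreover have "- (1/3) * (of_real (v powr (2/3) * (1 + v) powr (1/3)) * (of_real (-4/3) * Z * w) +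
       of_real (2/3 * A * (1 + v) powr (1/3) + v powr (2/3) * (1/3 * B)) * (1 + w * of_real v) powr of_real (-4/3)) = q v"
      unfolding q_def e_def a1 a2 a3 a4 A_def[symmetric] B_def[symmetric] Z_def[symmetric]
      by (simp add: field_simps power2_eq_square)
    ultimately show ?thesis by simp
  qed
  have "(LBINT v=0..\<infinity>. q v) = 0 - 0"
  proof (rule interval_integral_FTC_integrable)
    show "(Q has_vector_derivative q v) (at v)" if "0 < ereal v" for v using der that by simp
    show "isCont q v" if "0 < ereal v" for v
    proof -
      have "isCont (e p s) v" for p s
      proof -
        have "((\<lambda>z. (1 + w * z) powr of_real s) has_field_derivative of_real s * (1 + w * of_real v) powr (of_real s - 1) * w) (at (of_real v))"
          using nn[of v] that by (auto intro!: derivative_eq_intros)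
        then have "isCont (\<lambda>v. (1 + w * of_real v) powr of_real s) v"
          by (intro has_vector_derivative_continuous has_vector_derivative_real_field)
        moreover have "isCont (\<lambda>v. complex_of_real (v powr p * (1 + v) powr (-2/3))) v"
          using that by (intro continuous_intros) auto
        ultimately show ?thesis unfolding e_def by (intro continuous_mult)
      qed
      then show ?thesis unfolding q_def by (intro continuous_intros)
    qed
    show "set_integrable lborel (einterval 0 \<infinity>) q"
      using qint by (simp add: einterval_def greaterThan_def zero_ereal_def)
    have lim1: "((\<lambda>v::real. v powr (2/3) * (1 + v) powr (1/3)) \<longlongrightarrow> 0) (at_right 0)" by real_asymp
    have lim2: "((\<lambda>v. (1 + w * of_real v) powr of_real (-4/3)) \<longlongrightarrow> (1 + w * of_real 0) powr of_real (-4/3)) (at_right 0)"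
      by (intro tendsto_intros) auto
    have "(Q \<longlongrightarrow> - (1/3) * of_real 0 * (1 + w * of_real 0) powr of_real (-4/3)) (at_right 0)"
      unfolding Q_def by (intro tendsto_mult tendsto_const tendsto_of_real lim1 lim2)
    then show "((Q \<circ> real_of_ereal) \<longlongrightarrow> 0) (at_right 0)"
      by (simp add: zero_ereal_def ereal_tendsto_simps)
    show "((Q \<circ> real_of_ereal) \<longlongrightarrow> 0) (at_left \<infinity>)"
    proof -
      \<comment> \<open>The exponents \<open>2/3\<close>, \<open>1/3\<close> and \<open>-4/3\<close>
        of \<open>Q\<close> leave decay of order \<open>-1/3\<close> at infinity.\<close>
      obtain r c where rc: "c > 0" "\<And>v. v \<ge> 0 \<Longrightarrow> norm (1 + w * of_real v) \<ge> c * (1 + v)"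
        using one_plus_mult_bound[OF w] by (metis centre_in_ball)
      have "eventually (\<lambda>v. norm (Q v) \<le> c powr (-4/3) * (1 + v) powr (-1/3)) at_top"
        using eventually_gt_at_top[of 0]
      proof eventually_elim
        case (elim v)
        have "norm ((1 + w * of_real v) powr of_real (-4/3)) = norm (1 + w * of_real v) powr (-4/3)"
          by (subst norm_powr_real_powr') auto
        also have "\<dots> \<le> (c * (1 + v)) powr (-4/3)" using rc elim by (intro powr_mono2') auto
        also have "\<dots> = c powr (-4/3) * (1 + v) powr (-4/3)" by (rule powr_mult)
        finally have b: "norm ((1 + w * of_real v) powr of_real (-4/3)) \<le> c powr (-4/3) * (1 + v) powr (-4/3)" .
        have "v powr (2/3) \<le> (1 + v) powr (2/3)" using elim by (intro powr_mono2) auto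
        then have "v powr (2/3) * (1 + v) powr (1/3) * norm ((1 + w * of_real v) powr of_real (-4/3)) \<le>
           (1 + v) powr (2/3) * (1 + v) powr (1/3) * (c powr (-4/3) * (1 + v) powr (-4/3))"
          by (intro mult_mono b) auto
        also have "\<dots> = c powr (-4/3) * ((1 + v) powr (2/3) * (1 + v) powr (1/3) * (1 + v) powr (-4/3))"
          by (simp only: mult_ac)
        also have "(1 + v) powr (2/3) * (1 + v) powr (1/3) * (1 + v) powr (-4/3) = (1 + v) powr (-1/3)"
          unfolding powr_add[symmetric] by simp
        finally have "v powr (2/3) * (1 + v) powr (1/3) * norm ((1 + w * of_real v) powr of_real (-4/3))
           \<le> c powr (-4/3) * (1 + v) powr (-1/3)" .
        moreover have "norm (Q v) = 1/3 * (v powr (2/3) * (1 + v) powr (1/3) * norm ((1 + w * of_real v) powr of_real (-4/3)))"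
          by (simp add: Q_def norm_mult abs_mult mult.assoc)
        moreover have "0 \<le> v powr (2/3) * (1 + v) powr (1/3) * norm ((1 + w * of_real v) powr of_real (-4/3))"
          by simp
        ultimately show ?case by linarith
      qed
      moreover have "((\<lambda>v. c powr (-4/3) * (1 + v) powr (-1/3)) \<longlongrightarrow> 0) at_top"
        by real_asymp
      ultimately have "(Q \<longlongrightarrow> 0) at_top" by (rule Lim_null_comparison)
      then show ?thesis by (simp add: ereal_tendsto_simps)
    qed
  qed (auto simp: zero_ereal_def)
  moreover have "(LBINT v=0..\<infinity>. q v) = (LINT v:{0<..}|lborel. q v)"
    by (simp add: interval_lebesgue_integral_def einterval_def greaterThan_def zero_ereal_def)
  ultimately show ?thesis using q by simp
qed

text \<open>The equation in \<open>cubic_period_ode\<close> is invariant under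
  \<open>w -> 1 - w\<close>, so \<open>cubic_period z\<close> and
  \<open>cubic_period (1 - z)\<close> solve the same equation, and by Abel's identity
  \<open>z * (1 - z)\<close> times their Wronskian is constant on the strip. The plus sign comes
  from the chain rule.\<close>

lemma cubic_period_wronskian:
  obtains c where "\<And>z. 0 < Re z \<Longrightarrow> Re z < 1 \<Longrightarrow>
    z * (1 - z) * (cubic_period_deriv z * cubic_period (1 - z) + cubic_period z * cubic_period_deriv (1 - z)) = c"
proof -
  define S where "S = {z::complex. 0 < Re z} \<inter> {z. Re z < 1}"
  define W where "W = (\<lambda>z. z * (1 - z) * (cubic_period_deriv z * cubic_period (1 - z) + cubic_period z * cubic_period_deriv (1 - z)))"
  have "\<exists>c. \<forall>z\<in>S. W z = c"
  proof (rule has_field_derivative_zero_constant)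
    show "convex S" unfolding S_def by (intro convex_Int convex_halfspace_Re_gt convex_halfspace_Re_lt)
    fix z assume z: "z \<in> S"
    then have nn: "z \<notin> \<real>\<^sub>\<le>\<^sub>0" "1 - z \<notin> \<real>\<^sub>\<le>\<^sub>0" by (auto simp: S_def complex_nonpos_Reals_iff)
    note [derivative_intros] = DERIV_chain2[OF cubic_period_has_field_derivative] DERIV_chain2[OF cubic_period_deriv_has_field_derivative]
    note ode = cubic_period_ode[OF nn(1)] cubic_period_ode[OF nn(2)]
    have "(W has_field_derivative
       (1 - 2 * z) * (cubic_period_deriv z * cubic_period (1 - z) + cubic_period z * cubic_period_deriv (1 - z)) +
       z * (1 - z) * (cubic_period_deriv2 z * cubic_period (1 - z) - cubic_period z * cubic_period_deriv2 (1 - z))) (at z)"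
      unfolding W_def using nn by (auto intro!: derivative_eq_intros simp: algebra_simps)
    also have "(1 - 2 * z) * (cubic_period_deriv z * cubic_period (1 - z) + cubic_period z * cubic_period_deriv (1 - z)) +
       z * (1 - z) * (cubic_period_deriv2 z * cubic_period (1 - z) - cubic_period z * cubic_period_deriv2 (1 - z))
      = cubic_period (1 - z) * (z * (1 - z) * cubic_period_deriv2 z + (1 - 2 * z) * cubic_period_deriv z)
       - cubic_period z * ((1 - z) * (1 - (1 - z)) * cubic_period_deriv2 (1 - z) + (1 - 2 * (1 - z)) * cubic_period_deriv (1 - z))"
      by (simp add: algebra_simps)
    also have "\<dots> = 0" unfolding ode by simp
    finally show "(W has_field_derivative 0) (at z within S)" by (rule has_field_derivative_at_within)
  qed
  then show ?thesis using that unfolding S_def W_def by blast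
qed

lemma cubic_ratio_deriv:
  obtains c where "\<And>z. 0 < Re z \<Longrightarrow> Re z < 1 \<Longrightarrow> cubic_period z \<noteq> 0 \<Longrightarrow>
    ((\<lambda>z. cubic_period (1 - z) / cubic_period z) has_field_derivative c / (z * (1 - z) * (cubic_period z)\<^sup>2)) (at z)"
proof -
  obtain c where c: "\<And>z. 0 < Re z \<Longrightarrow> Re z < 1 \<Longrightarrow>
    z * (1 - z) * (cubic_period_deriv z * cubic_period (1 - z) + cubic_period z * cubic_period_deriv (1 - z)) = c"
    using cubic_period_wronskian by blast
  show ?thesis
  proof (rule that[of "-c"])
    fix z assume z: "0 < Re z" "Re z < 1" "cubic_period z \<noteq> 0"
    then have nn: "z \<notin> \<real>\<^sub>\<le>\<^sub>0" "1 - z \<notin> \<real>\<^sub>\<le>\<^sub>0" by (auto simp: complex_nonpos_Reals_iff)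
    have z0: "z \<noteq> 0" "1 - z \<noteq> 0" using nn by auto
    note [derivative_intros] = DERIV_chain2[OF cubic_period_has_field_derivative]
    have "((\<lambda>z. cubic_period (1 - z) / cubic_period z) has_field_derivative
       - (cubic_period_deriv z * cubic_period (1 - z) + cubic_period z * cubic_period_deriv (1 - z)) / (cubic_period z)\<^sup>2) (at z)"
      using nn z by (auto intro!: derivative_eq_intros simp: algebra_simps power2_eq_square)
    also have "- (cubic_period_deriv z * cubic_period (1 - z) + cubic_period z * cubic_period_deriv (1 - z)) / (cubic_period z)\<^sup>2
       = - c / (z * (1 - z) * (cubic_period z)\<^sup>2)"
      using z0 z by (simp add: field_simps flip: c[OF z(1,2)])
    finally show "((\<lambda>z. cubic_period (1 - z) / cubic_period z) has_field_derivative - c / (z * (1 - z) * (cubic_period z)\<^sup>2)) (at z)" .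
  qed
qed

section \<open>Schwarz--Christoffel maps\<close>

text \<open>Along a radius the derivative is bounded by \<open>C * (1 - s) powr (- \<beta>)\<close>,
  which is integrable as \<open>\<beta> < 1\<close>. Hence the dilates
  \<open>f0 (of_real (r n) * z)\<close> are uniformly Cauchy on the closed disc, and their limit is
  the continuous extension.\<close>

lemma holomorphic_primitive_extends_to_cball:
  fixes g :: "complex \<Rightarrow> complex"
  assumes hol: "g holomorphic_on ball 0 1" and \<beta>: "\<beta> < 1"
    and bound: "\<And>z. z \<in> ball 0 1 \<Longrightarrow> norm (g z) \<le> C * (1 - norm z) powr (- \<beta>)"
    and \<beta>0: "\<beta> \<ge> 0"
  obtains f where "continuous_on (cball 0 1) f"
    "\<And>z. z \<in> ball 0 1 \<Longrightarrow> (f has_field_derivative g z) (at z)"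
proof -
  obtain f0 where f0: "\<And>z. z \<in> ball 0 1 \<Longrightarrow> (f0 has_field_derivative g z) (at z within ball 0 1)"
    using holomorphic_convex_primitive'[OF _ _ hol] by auto
  have f0: "(f0 has_field_derivative g z) (at z)" if "z \<in> ball 0 1" for z
    using f0[OF that] that by (simp add: at_within_open[of z "ball 0 1"])
  have C: "C \<ge> 0" using order_trans[OF norm_ge_zero bound[of 0]] by simp
  define r where "r = (\<lambda>n::nat. 1 - 1 / (real n + 2))"
  have r: "0 < r n" "r n < 1" for n by (auto simp: r_def field_simps)
  have rmono: "r n \<le> r m" if "n \<le> m" for n m using that by (auto simp: r_def frac_le)
  define F where "F = (\<lambda>n z. f0 (of_real (r n) * z))"
  define K where "K = C / (1 - \<beta>)"
  have inball: "of_real s * z \<in> ball 0 1" if "0 \<le> s" "s < 1" "z \<in> cball 0 1" for s and z :: complex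
  proof -
    have "norm (complex_of_real s * z) \<le> s * 1" unfolding norm_mult using that by (intro mult_mono) auto
    then show ?thesis using that by simp
  qed
  have diff: "norm (F m z - F n z) \<le> K * (1 - r n) powr (1 - \<beta>)" if nm: "n \<le> m" and z: "z \<in> cball 0 1" for n m z
  proof (cases "r n = r m")
    case True
    then show ?thesis using C \<beta> by (simp add: F_def K_def)
  next
    case False
    then have lt: "r n < r m" using rmono[OF nm] by simp
    \<comment> \<open>\<open>- (K * (1 - s) powr (1 - \<beta>))\<close> is a primitive of the radial
      majorant.\<close>
    have "norm (f0 (of_real (r m) * z) - f0 (of_real (r n) * z)) \<le>
        - (K * (1 - r m) powr (1 - \<beta>)) - - (K * (1 - r n) powr (1 - \<beta>))"
    proof (rule differentiable_bound_general[OF lt])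
      have der: "((\<lambda>s. f0 (of_real s * z)) has_vector_derivative g (of_real s * z) * z) (at s)" if "0 < s" "s < 1" for s
      proof -
        have "((\<lambda>w. f0 (w * z)) has_field_derivative g (of_real s * z) * z) (at (of_real s))"
          using inball[of s z] that z by (intro DERIV_chain2[OF f0]) (auto intro!: derivative_eq_intros)
        then show ?thesis by (rule has_vector_derivative_real_field)
      qed
      show "((\<lambda>s. f0 (of_real s * z)) has_vector_derivative g (of_real s * z) * z) (at s)" if "r n < s" "s < r m" for s
        using that r[of n] r[of m] by (intro der) auto
      show "continuous_on {r n..r m} (\<lambda>s. f0 (of_real s * z))"
        using r[of n] r[of m]
        by (intro continuous_at_imp_continuous_on ballI has_vector_derivative_continuous[OF der]) auto
      show "continuous_on {r n..r m} (\<lambda>s. - (K * (1 - s) powr (1 - \<beta>)))"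
        using r[of m] by (intro continuous_intros) auto
      show "((\<lambda>s. - (K * (1 - s) powr (1 - \<beta>))) has_vector_derivative C * (1 - s) powr (- \<beta>)) (at s)" if "r n < s" "s < r m" for s
      proof -
        have s1: "s < 1" using that r[of m] by linarith
        then have "((\<lambda>s. (1 - s) powr (1 - \<beta>)) has_real_derivative (1 - \<beta>) * (1 - s) powr (- \<beta>) * (-1)) (at s)"
          by (auto intro!: derivative_eq_intros)
        from DERIV_minus[OF DERIV_cmult[OF this, of K]]
        have "((\<lambda>s. - (K * (1 - s) powr (1 - \<beta>))) has_real_derivative K * (1 - \<beta>) * (1 - s) powr (- \<beta>)) (at s)"
          by (simp add: mult.assoc)
        then show ?thesis using \<beta> by (simp add: K_def has_real_derivative_iff_has_vector_derivative)
      qed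
      show "norm (g (of_real s * z) * z) \<le> C * (1 - s) powr (- \<beta>)" if s: "r n < s" "s < r m" for s
      proof -
        have s01: "0 < s" "s < 1" using s r[of n] r[of m] by auto
        have nz: "norm (of_real s * z) \<le> s" using z s01 by (simp add: norm_mult mult_left_le)
        have "norm (g (of_real s * z)) \<le> C * (1 - norm (of_real s * z)) powr (- \<beta>)"
          using s01 z by (intro bound inball) auto
        also have "\<dots> \<le> C * (1 - s) powr (- \<beta>)"
          using s01 nz C \<beta>0 by (intro mult_left_mono powr_mono2') auto
        finally have "norm (g (of_real s * z)) * norm z \<le> (C * (1 - s) powr (- \<beta>)) * 1"
          using z C by (intro mult_mono) auto
        then show ?thesis by (simp add: norm_mult)
      qed
    qed
    also have "\<dots> \<le> K * (1 - r n) powr (1 - \<beta>)" using C \<beta> by (simp add: K_def)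
    finally show ?thesis by (simp add: F_def)
  qed
  have lim0: "(\<lambda>n. K * (1 - r n) powr (1 - \<beta>)) \<longlonglongrightarrow> 0"
  proof -
    have "(\<lambda>n. 1 - r n) \<longlonglongrightarrow> 0" unfolding r_def by real_asymp
    then have "(\<lambda>n. (1 - r n) powr (1 - \<beta>)) \<longlonglongrightarrow> 0"
      using \<beta> by (intro tendsto_zero_powrI[where b = "1 - \<beta>"]) (auto simp: r_def)
    then show ?thesis by (rule tendsto_mult_right_zero)
  qed
  have "uniformly_Cauchy_on (cball 0 1) F"
  proof (rule uniformly_Cauchy_onI')
    fix e :: real assume "e > 0"
    then have "eventually (\<lambda>n. K * (1 - r n) powr (1 - \<beta>) < e) sequentially"
      using order_tendstoD(2)[OF lim0] by blast
    then obtain M where M: "\<And>n. n \<ge> M \<Longrightarrow> K * (1 - r n) powr (1 - \<beta>) < e"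
      by (auto simp: eventually_sequentially)
    show "\<exists>M. \<forall>z\<in>cball 0 1. \<forall>m\<ge>M. \<forall>n>m. dist (F m z) (F n z) < e"
    proof (intro exI ballI allI impI)
      fix z m n assume *: "z \<in> cball (0::complex) 1" "m \<ge> M" "n > m"
      have "dist (F m z) (F n z) \<le> K * (1 - r m) powr (1 - \<beta>)"
        using diff[of m n z] * by (simp add: dist_norm norm_minus_commute)
      then show "dist (F m z) (F n z) < e" using M[OF *(2)] by linarith
    qed
  qed
  then obtain f where f: "uniform_limit (cball 0 1) F f sequentially"
    using Cauchy_uniformly_convergent uniformly_convergent_on_def by blast
  have contF: "continuous_on (cball 0 1) (F n)" for n
  proof -
    have "continuous_on (ball 0 1) f0"
      using f0 by (intro continuous_at_imp_continuous_on ballI DERIV_isCont)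
    then show ?thesis unfolding F_def
      by (rule continuous_on_compose2) (use inball r[of n] in \<open>auto intro!: continuous_intros\<close>)
  qed
  have "continuous_on (cball 0 1) f"
    by (rule uniform_limit_theorem[OF _ f]) (use contF in auto)
  moreover have eq: "f z = f0 z" if z: "z \<in> ball 0 1" for z
  proof -
    have "(\<lambda>n. F n z) \<longlonglongrightarrow> f z" by (rule tendsto_uniform_limitI[OF f]) (use z in auto)
    moreover have "(\<lambda>n. F n z) \<longlonglongrightarrow> f0 (of_real 1 * z)"
    proof -
      have "r \<longlonglongrightarrow> 1" unfolding r_def by real_asymp
      then have "(\<lambda>n. complex_of_real (r n) * z) \<longlonglongrightarrow> of_real 1 * z" by (intro tendsto_intros)
      moreover have "isCont f0 (of_real 1 * z)" using f0[of z] z by (auto intro: DERIV_isCont)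
      ultimately show ?thesis unfolding F_def by (rule isCont_tendsto_compose[rotated])
    qed
    ultimately show ?thesis using LIMSEQ_unique by fastforce
  qed
  moreover have "(f has_field_derivative g z) (at z)" if z: "z \<in> ball 0 1" for z
    using f0[OF z] by (rule has_field_derivative_transform_within_open[where S = "ball 0 1"]) (use z eq in auto)
  ultimately show ?thesis using that by blast
qed

text \<open>Subtracting the linear function of slope \<open>h (of_real t)\<close> leaves a
  derivative of norm at most \<open>e/2\<close> on a half-disc, which is convex. The resulting
  Lipschitz bound reaches the real axis by continuity, with points approached from
  \<open>1 / (n + 1)\<close> above.\<close>

lemma has_field_derivative_at_real_boundary:
  fixes \<Psi> h :: "complex \<Rightarrow> complex" and t :: real
  assumes cont: "continuous_on {z. Im z \<ge> 0} \<Psi>"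
    and der: "\<And>z. Im z > 0 \<Longrightarrow> (\<Psi> has_field_derivative h z) (at z)"
    and h: "continuous (at (of_real t) within {z. Im z \<ge> 0}) h"
  shows "(\<Psi> has_field_derivative h (of_real t)) (at (of_real t) within {z. Im z \<ge> 0})"
  unfolding has_field_derivative_iff
proof (rule LIM_zero_cancel, rule tendstoI)
  fix e :: real assume e: "e > 0"
  define z0 where "z0 = complex_of_real t"
  obtain d where d: "d > 0" "\<And>z. Im z \<ge> 0 \<Longrightarrow> dist z z0 < d \<Longrightarrow> dist (h z) (h z0) < e/2"
    using h e unfolding continuous_within_eps_delta z0_def by (metis half_gt_zero mem_Collect_eq)
  define G where "G = (\<lambda>z. \<Psi> z - h z0 * z)"
  have G: "norm (G x - G y) \<le> e/2 * norm (x - y)"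
    if "Im x > 0" "Im y > 0" "x \<in> ball z0 d" "y \<in> ball z0 d" for x y
  proof (rule field_differentiable_bound[of "{z. Im z > 0} \<inter> ball z0 d" G "\<lambda>z. h z - h z0"])
    show "convex ({z. Im z > 0} \<inter> ball z0 d)" by (intro convex_Int convex_halfspace_Im_gt convex_ball)
    fix z assume z: "z \<in> {z. Im z > 0} \<inter> ball z0 d"
    have "(G has_field_derivative h z - h z0) (at z)" unfolding G_def
      using der[of z] z by (auto intro!: derivative_eq_intros)
    then show "(G has_field_derivative h z - h z0) (at z within {z. Im z > 0} \<inter> ball z0 d)"
      by (rule has_field_derivative_at_within)
    show "norm (h z - h z0) \<le> e/2" using d(2)[of z] z by (auto simp: dist_norm norm_minus_commute)
  qed (use that in auto)
  have contG: "continuous_on {z. Im z \<ge> 0} G" unfolding G_def by (intro continuous_intros cont)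
  have key: "norm (G z - G z0) \<le> e/2 * norm (z - z0)" if z: "Im z \<ge> 0" "z \<in> ball z0 d" for z
  proof -
    define X where "X = (\<lambda>w n. w + \<i> * of_real (1 / (real n + 1)))"
    have X: "X w \<longlonglongrightarrow> w" for w
    proof -
      have "(\<lambda>n. 1 / (real n + 1)) \<longlonglongrightarrow> 0" by real_asymp
      then have "X w \<longlonglongrightarrow> w + \<i> * of_real 0" unfolding X_def by (intro tendsto_intros)
      then show ?thesis by simp
    qed
    have GX: "(\<lambda>n. G (X w n)) \<longlonglongrightarrow> G w" if "Im w \<ge> 0" for w
      by (rule continuous_on_tendsto_compose[OF contG X]) (use that in \<open>auto simp: X_def intro!: always_eventually add_nonneg_nonneg\<close>)
    have ev: "eventually (\<lambda>n. X w n \<in> ball z0 d) sequentially" if "w \<in> ball z0 d" for w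
      using X[of w] that by (intro topological_tendstoD) auto
    have Im0: "Im (X w n) > 0" if "Im w \<ge> 0" for w n
      using that by (auto simp: X_def intro!: add_nonneg_pos)
    have iz0: "Im z0 \<ge> 0" by (simp add: z0_def)
    have le: "eventually (\<lambda>n. norm (G (X z n) - G (X z0 n)) \<le> e/2 * norm (X z n - X z0 n)) sequentially"
    proof -
      have "z0 \<in> ball z0 d" using d(1) by simp
      from ev[OF z(2)] ev[OF this] show ?thesis
        by eventually_elim (rule G; auto intro!: Im0 z iz0)
    qed
    show ?thesis
      by (intro tendsto_le[OF _ _ _ le]) (auto intro!: tendsto_intros GX z X iz0)
  qed
  have "eventually (\<lambda>z. z \<in> ball z0 d \<and> z \<noteq> z0 \<and> Im z \<ge> 0) (at z0 within {z. Im z \<ge> 0})"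
    using d(1) unfolding eventually_at by (intro exI[of _ d]) (auto simp: dist_commute)
  then show "eventually (\<lambda>z. dist ((\<Psi> z - \<Psi> (of_real t)) / (z - of_real t) - h (of_real t)) 0 < e) (at (of_real t) within {z. Im z \<ge> 0})"
    unfolding z0_def[symmetric]
  proof eventually_elim
    case (elim z)
    have "(\<Psi> z - \<Psi> z0) / (z - z0) - h z0 = (G z - G z0) / (z - z0)"
      using elim by (simp add: G_def field_simps)
    also have "norm \<dots> \<le> e/2" using key[of z] elim by (simp add: norm_divide divide_le_eq)
    finally show ?case using e by (simp add: dist_norm)
  qed
qed

text \<open>At most one index \<open>j\<close> can have \<open>D j < \<delta>\<close>. Its factor
  contributes \<open>s powr (- \<gamma>)\<close> and every other at most
  \<open>\<delta> powr (- \<gamma>)\<close>, so the exponents of the singular factors do not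
  accumulate.\<close>

lemma prod_powr_minus_le:
  fixes D \<beta> :: "'i \<Rightarrow> real"
  assumes I: "finite I" and \<gamma>: "\<gamma> \<ge> 0" and \<delta>: "0 < \<delta>" "\<delta> \<le> 1" and s: "0 < s" "s \<le> 1"
    and \<beta>: "\<And>i. i \<in> I \<Longrightarrow> 0 \<le> \<beta> i \<and> \<beta> i \<le> \<gamma>"
    and D: "\<And>i. i \<in> I \<Longrightarrow> s \<le> D i"
    and pair: "\<And>i j. i \<in> I \<Longrightarrow> j \<in> I \<Longrightarrow> i \<noteq> j \<Longrightarrow> \<delta> \<le> D i \<or> \<delta> \<le> D j"
  shows "(\<Prod>i\<in>I. D i powr (- \<beta> i)) \<le> (\<delta> powr (- \<gamma>)) ^ card I * s powr (- \<gamma>)"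
proof (cases "I = {}")
  case True
  then show ?thesis using s \<gamma> powr_mono'[of "-\<gamma>" 0 s] by simp
next
  case False
  have aux: "X powr (- \<beta> i) \<le> e powr (- \<gamma>)" if "i \<in> I" "0 < e" "e \<le> X" "e \<le> 1" for X e i
  proof -
    have "X powr (- \<beta> i) \<le> e powr (- \<beta> i)" using \<beta>[OF that(1)] that by (intro powr_mono2') auto
    also have "\<dots> \<le> e powr (- \<gamma>)" using \<beta>[OF that(1)] that by (intro powr_mono') auto
    finally show ?thesis .
  qed
  obtain j where j: "j \<in> I" "\<And>i. i \<in> I \<Longrightarrow> i \<noteq> j \<Longrightarrow> \<delta> \<le> D i"
  proof (cases "\<exists>j\<in>I. D j < \<delta>")
    case True
    then obtain j where "j \<in> I" "D j < \<delta>" by blast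
    then show ?thesis using pair by (intro that[of j]) force+
  next
    case no: False
    then show ?thesis using False that by (metis all_not_in_conv not_less)
  qed
  have ge1: "\<delta> powr (- \<gamma>) \<ge> 1"
    using powr_mono'[of "-\<gamma>" 0 \<delta>] \<gamma> \<delta> by simp
  have "(\<Prod>i\<in>I. D i powr (- \<beta> i)) = D j powr (- \<beta> j) * (\<Prod>i\<in>I - {j}. D i powr (- \<beta> i))"
    using I j(1) by (rule prod.remove)
  also have "\<dots> \<le> s powr (- \<gamma>) * (\<Prod>i\<in>I - {j}. \<delta> powr (- \<gamma>))"
    using j s \<delta> D by (intro mult_mono prod_mono aux conjI prod_nonneg) auto
  also have "\<dots> = s powr (- \<gamma>) * (\<delta> powr (- \<gamma>)) ^ (card (I - {j}))" by simp
  also have "\<dots> \<le> s powr (- \<gamma>) * (\<delta> powr (- \<gamma>)) ^ card I"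
    using ge1 I by (intro mult_left_mono power_increasing card_mono) auto
  finally show ?thesis by (simp add: mult.commute)
qed

text \<open>\<open>b a\<close> is the exterior angle at the image of the prevertex \<open>a\<close>,
  divided by \<open>pi\<close>. These numbers add up to 2 for a closed polygon, so the total
  \<open>4/3\<close> leaves \<open>2/3\<close> for one more prevertex at infinity. The bound
  \<open>2/3\<close> means interior angles of at least \<open>pi / 3\<close> and keeps every
  singularity integrable.\<close>

locale schwarz_christoffel =
  fixes A :: "real set" and b :: "real \<Rightarrow> real"
  assumes finite_A: "finite A" and b_bounds: "\<And>a. a \<in> A \<Longrightarrow> 0 < b a \<and> b a \<le> 2/3"
    and sum_b: "sum b A = 4/3"
begin

definition integrand :: "complex \<Rightarrow> complex" where
  "integrand z = (\<Prod>a\<in>A. (z - of_real a) powr of_real (- b a))"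

text \<open>In the disc the prevertex at infinity becomes the ordinary boundary point 1, so all
  prevertices can be treated alike and the closed domain is compact.\<close>

definition cayley :: "complex \<Rightarrow> complex" where
  "cayley \<zeta> = \<i> * (1 + \<zeta>) / (1 - \<zeta>)"

lemma Im_cayley: "\<zeta> \<in> ball 0 1 \<Longrightarrow> Im (cayley \<zeta>) > 0"
proof -
  assume z: "\<zeta> \<in> ball 0 1"
  then have ne: "1 - \<zeta> \<noteq> 0" by auto
  have "cayley \<zeta> = \<i> * (1 + \<zeta>) * cnj (1 - \<zeta>) / of_real ((norm (1 - \<zeta>))\<^sup>2)"
    unfolding cayley_def by (metis complex_div_cnj of_real_power)
  also have "Im \<dots> = Im (\<i> * (1 + \<zeta>) * cnj (1 - \<zeta>)) / (norm (1 - \<zeta>))\<^sup>2" by (rule Im_divide_of_real)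
  also have "Im (\<i> * (1 + \<zeta>) * cnj (1 - \<zeta>)) = Re ((1 + \<zeta>) * cnj (1 - \<zeta>))"
    unfolding mult.assoc by simp
  also have "\<dots> = 1 - (norm \<zeta>)\<^sup>2"
    unfolding cmod_power2 by (simp add: power2_eq_square algebra_simps)
  finally have "Im (cayley \<zeta>) = (1 - (norm \<zeta>)\<^sup>2) / (norm (1 - \<zeta>))\<^sup>2" .
  moreover have "(norm \<zeta>)\<^sup>2 < 1" using z by (simp add: abs_square_less_1)
  ultimately show ?thesis using ne by simp
qed

lemma integrand_holomorphic: "integrand holomorphic_on {z. Im z > 0}"
  unfolding integrand_def
  by (intro holomorphic_on_prod holomorphic_on_powr holomorphic_intros)
     (auto simp: complex_nonpos_Reals_iff)

lemma integrand_continuous: "continuous_on ({z. Im z \<ge> 0} - of_real ` A) integrand"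
  unfolding integrand_def
proof (intro continuous_on_prod)
  fix a assume "a \<in> A"
  then show "continuous_on ({z. Im z \<ge> 0} - of_real ` A) (\<lambda>z. (z - of_real a) powr of_real (- b a))"
    by (intro continuous_on_compose2[OF continuous_on_powr_upper_half])
       (auto intro!: continuous_intros)
qed

lemma norm_integrand: "norm (integrand z) = (\<Prod>a\<in>A. norm (z - of_real a) powr (- b a))"
  unfolding integrand_def prod_norm[symmetric]
  by (intro prod.cong) (auto simp: norm_powr_real_powr')

text \<open>The factor \<open>2 * \<i> / (1 - \<zeta>)\<^sup>2\<close> is the derivative of
  \<open>cayley\<close>. With it the integrand has, up to a constant, the norm of a product of
  negative powers of linear forms in \<zeta>: the numerators of
  \<open>cayley \<zeta> - of_real a\<close> with exponents \<open>b a\<close>, and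
  \<open>1 - \<zeta>\<close> with exponent \<open>2 - 4/3 = 2/3\<close>. Each form is at least
  \<open>1 - norm \<zeta>\<close>, and two of them are never small together.\<close>

lemma norm_disc_integrand_bound:
  obtains C where "\<And>\<zeta>. \<zeta> \<in> ball 0 1 \<Longrightarrow>
    norm (integrand (cayley \<zeta>) * (2 * \<i> / (1 - \<zeta>)\<^sup>2)) \<le> C * (1 - norm \<zeta>) powr (- (2/3))"
proof -
  define p where "p = (\<lambda>\<zeta> a. norm ((\<i> - of_real a) + (\<i> + of_real a) * \<zeta>))"
  \<comment> \<open>The index \<open>None\<close> stands for the prevertex at infinity.\<close>
  define D where "D = (\<lambda>\<zeta>. case_option (norm (1 - \<zeta>)) (p \<zeta>))"
  define \<beta> where "\<beta> = case_option (2/3) b"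
  define I where "I = insert None (Some ` A)"
  have finI: "finite I" using finite_A by (simp add: I_def)
  define M where "M = Max (insert 1 ((\<lambda>a. norm (\<i> + complex_of_real a)) ` A))"
  have M: "M \<ge> 1" "\<And>a. a \<in> A \<Longrightarrow> norm (\<i> + complex_of_real a) \<le> M"
    unfolding M_def using finite_A by auto
  define g where "g = Min (insert 1 ((\<lambda>(a, a'). \<bar>a - a'\<bar>) ` {(a, a'). a \<in> A \<and> a' \<in> A \<and> a \<noteq> a'}))"
  have fin2: "finite {(a, a'). a \<in> A \<and> a' \<in> A \<and> a \<noteq> a'}"
    by (rule finite_subset[of _ "A \<times> A"]) (use finite_A in auto)
  have g: "g > 0" "g \<le> 1" "\<And>a a'. a \<in> A \<Longrightarrow> a' \<in> A \<Longrightarrow> a \<noteq> a' \<Longrightarrow> g \<le> \<bar>a - a'\<bar>"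
    unfolding g_def using fin2 by (auto intro!: Min_le)
  define \<delta> where "\<delta> = g / M"
  have \<delta>: "0 < \<delta>" "\<delta> \<le> 1" "\<delta> * M = g" using g M by (auto simp: \<delta>_def divide_le_eq)
  have small: "\<not> (X < \<delta> \<and> Y < \<delta> \<and> 2 * g \<le> X * u + Y * v)"
    if "0 \<le> u" "u \<le> M" "0 \<le> v" "v \<le> M" "0 \<le> X" "0 \<le> Y" for X Y u v
  proof
    assume *: "X < \<delta> \<and> Y < \<delta> \<and> 2 * g \<le> X * u + Y * v"
    have "X * u \<le> X * M" "Y * v \<le> Y * M" using that by (auto intro: mult_left_mono)
    moreover have "X * M < \<delta> * M" "Y * M < \<delta> * M" using * M by auto
    ultimately show False using * \<delta>(3) by linarith
  qed
  define C where "C = 2 * (\<delta> powr (- (2/3))) ^ card I"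
  show ?thesis
  proof (rule that[of C])
    fix \<zeta> :: complex assume z: "\<zeta> \<in> ball 0 1"
    define s where "s = 1 - norm \<zeta>"
    have s: "0 < s" "s \<le> 1" using z by (auto simp: s_def)
    have d: "norm (1 - \<zeta>) \<ge> s" using norm_triangle_ineq2[of 1 \<zeta>] by (simp add: s_def)
    have norm_eq: "norm (\<i> - complex_of_real a) = norm (\<i> + complex_of_real a)" for a
      by (simp add: cmod_def)
    have norm_ge: "norm (\<i> + complex_of_real a) \<ge> 1" for a
      using abs_Im_le_cmod[of "\<i> + complex_of_real a"] by simp
    have pa: "p \<zeta> a \<ge> s" for a
    proof -
      have "1 * s \<le> norm (\<i> + complex_of_real a) * s" using norm_ge s by (intro mult_right_mono) auto
      also have "\<dots> = norm (\<i> - complex_of_real a) - norm (- ((\<i> + complex_of_real a) * \<zeta>))"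
        unfolding norm_eq norm_minus_cancel norm_mult by (simp add: s_def algebra_simps)
      also have "\<dots> \<le> p \<zeta> a" unfolding p_def
        using norm_triangle_ineq2[of "\<i> - complex_of_real a" "- ((\<i> + complex_of_real a) * \<zeta>)"] by simp
      finally show ?thesis by simp
    qed
    \<comment> \<open>Any two of the linear forms, with bounded coefficients, combine to a nonzero
      constant: here infinity and a finite prevertex, in the next claim two finite
      prevertices.\<close>
    have mix: "2 \<le> norm (1 - \<zeta>) * norm (\<i> + complex_of_real a) + p \<zeta> a * 1" for a
    proof -
      have "2 * \<i> = (1 - \<zeta>) * (\<i> + of_real a) + ((\<i> - of_real a) + (\<i> + of_real a) * \<zeta>)" by (simp add: algebra_simps)
      then have "norm (2 * \<i>) \<le> norm ((1 - \<zeta>) * (\<i> + of_real a)) + norm ((\<i> - of_real a) + (\<i> + of_real a) * \<zeta>)"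
        by (metis norm_triangle_ineq)
      then show ?thesis by (simp add: norm_mult p_def)
    qed
    have two: "2 * \<bar>a - a'\<bar> \<le> p \<zeta> a * norm (\<i> + complex_of_real a') + p \<zeta> a' * norm (\<i> + complex_of_real a)" for a a'
    proof -
      have "2 * \<i> * of_real (a' - a) = ((\<i> - of_real a) + (\<i> + of_real a) * \<zeta>) * (\<i> + of_real a')
          - ((\<i> - of_real a') + (\<i> + of_real a') * \<zeta>) * (\<i> + of_real a)" by (simp add: algebra_simps)
      then have "norm (2 * \<i> * of_real (a' - a)) \<le> norm (((\<i> - of_real a) + (\<i> + of_real a) * \<zeta>) * (\<i> + of_real a'))
          + norm (((\<i> - of_real a') + (\<i> + of_real a') * \<zeta>) * (\<i> + of_real a))"
        by (metis norm_triangle_ineq4)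
      moreover have "norm (2 * \<i> * of_real (a' - a) :: complex) = 2 * \<bar>a - a'\<bar>"
        unfolding norm_mult norm_of_real by simp
      ultimately show ?thesis by (simp add: norm_mult p_def)
    qed
    have "(\<Prod>i\<in>I. D \<zeta> i powr (- \<beta> i)) \<le> (\<delta> powr (- (2/3))) ^ card I * s powr (- (2/3))"
    proof (rule prod_powr_minus_le[OF finI _ \<delta>(1,2) s])
      show "0 \<le> \<beta> i \<and> \<beta> i \<le> 2/3" if "i \<in> I" for i
        using that b_bounds by (auto simp: I_def \<beta>_def intro: less_imp_le)
      show "s \<le> D \<zeta> i" if "i \<in> I" for i using d pa by (cases i) (auto simp: D_def)
      fix i j assume ij: "i \<in> I" "j \<in> I" "i \<noteq> j"
      have nn: "p \<zeta> a \<ge> 0" for a by (simp add: p_def)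
      show "\<delta> \<le> D \<zeta> i \<or> \<delta> \<le> D \<zeta> j"
      proof (rule ccontr)
        assume "\<not> ?thesis"
        then have lt: "D \<zeta> i < \<delta>" "D \<zeta> j < \<delta>" by auto
        consider a where "i = None" "j = Some a" "a \<in> A" | a where "j = None" "i = Some a" "a \<in> A"
          | a a' where "i = Some a" "j = Some a'" "a \<in> A" "a' \<in> A" "a \<noteq> a'"
          using ij by (auto simp: I_def)
        then show False
        proof cases
          case (1 a)
          then show False using small[of "norm (\<i> + complex_of_real a)" 1 "norm (1 - \<zeta>)" "p \<zeta> a"] mix[of a] lt M g nn
            by (auto simp: D_def)
        next
          case (2 a)
          then show False using small[of "norm (\<i> + complex_of_real a)" 1 "norm (1 - \<zeta>)" "p \<zeta> a"] mix[of a] lt M g nn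
            by (auto simp: D_def)
        next
          case (3 a a')
          then show False using small[of "norm (\<i> + complex_of_real a')" "norm (\<i> + complex_of_real a)" "p \<zeta> a" "p \<zeta> a'"] two[of a a'] lt M g(3)[of a a'] nn
            by (auto simp: D_def)
        qed
      qed
    qed simp
    moreover have "(\<Prod>i\<in>I. D \<zeta> i powr (- \<beta> i)) = norm (1 - \<zeta>) powr (- (2/3)) * (\<Prod>a\<in>A. p \<zeta> a powr (- b a))"
      unfolding I_def using finite_A by (subst prod.insert) (auto simp: prod.reindex D_def \<beta>_def)
    moreover have "norm (integrand (cayley \<zeta>) * (2 * \<i> / (1 - \<zeta>)\<^sup>2)) = 2 * (norm (1 - \<zeta>) powr (- (2/3)) * (\<Prod>a\<in>A. p \<zeta> a powr (- b a)))"
    proof -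
      have dpos: "norm (1 - \<zeta>) > 0" using d s by linarith
      have m: "cayley \<zeta> - of_real a = ((\<i> - of_real a) + (\<i> + of_real a) * \<zeta>) / (1 - \<zeta>)" for a
        using dpos by (auto simp: cayley_def field_simps)
      have "norm (integrand (cayley \<zeta>)) = (\<Prod>a\<in>A. p \<zeta> a powr (- b a) * norm (1 - \<zeta>) powr (b a))"
        unfolding norm_integrand m norm_divide p_def[symmetric]
        by (intro prod.cong) (auto simp: powr_divide p_def powr_minus field_simps)
      also have "\<dots> = (\<Prod>a\<in>A. p \<zeta> a powr (- b a)) * norm (1 - \<zeta>) powr (sum b A)"
        using dpos by (simp add: prod.distrib powr_sum)
      finally have "norm (integrand (cayley \<zeta>) * (2 * \<i> / (1 - \<zeta>)\<^sup>2)) =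
          (\<Prod>a\<in>A. p \<zeta> a powr (- b a)) * (norm (1 - \<zeta>) powr (4/3) * (2 / (norm (1 - \<zeta>))\<^sup>2))"
        by (simp add: norm_mult norm_divide norm_power sum_b)
      also have "norm (1 - \<zeta>) powr (4/3) * (2 / (norm (1 - \<zeta>))\<^sup>2) = 2 * norm (1 - \<zeta>) powr (- (2/3))"
        using dpos powr_diff[of "norm (1 - \<zeta>)" "4/3" 2] by simp
      finally show ?thesis by (simp add: mult_ac)
    qed
    ultimately show "norm (integrand (cayley \<zeta>) * (2 * \<i> / (1 - \<zeta>)\<^sup>2)) \<le> C * (1 - norm \<zeta>) powr (- (2/3))"
      unfolding C_def s_def[symmetric] by simp
  qed
qed

end

context schwarz_christoffel
begin

lemma ex_disc_map:
  "\<exists>f. continuous_on (cball 0 1) f \<and>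
     (\<forall>\<zeta>\<in>ball 0 1. (f has_field_derivative integrand (cayley \<zeta>) * (2 * \<i> / (1 - \<zeta>)\<^sup>2)) (at \<zeta>))"
proof -
  obtain C where C: "\<And>\<zeta>. \<zeta> \<in> ball 0 1 \<Longrightarrow>
    norm (integrand (cayley \<zeta>) * (2 * \<i> / (1 - \<zeta>)\<^sup>2)) \<le> C * (1 - norm \<zeta>) powr (- (2/3))"
    using norm_disc_integrand_bound by blast
  have "(\<lambda>\<zeta>. integrand (cayley \<zeta>) * (2 * \<i> / (1 - \<zeta>)\<^sup>2)) holomorphic_on ball 0 1"
  proof (intro holomorphic_intros)
    have "cayley holomorphic_on ball 0 1" unfolding cayley_def by (intro holomorphic_intros) auto
    then show "(\<lambda>\<zeta>. integrand (cayley \<zeta>)) holomorphic_on ball 0 1"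
      by (rule holomorphic_on_compose_gen[OF _ integrand_holomorphic, unfolded o_def])
         (use Im_cayley in auto)
  qed auto
  then show ?thesis
  proof (rule holomorphic_primitive_extends_to_cball[of _ "2/3" C])
    fix f assume "continuous_on (cball 0 1) f" "\<And>\<zeta>. \<zeta> \<in> ball 0 1 \<Longrightarrow>
      (f has_field_derivative integrand (cayley \<zeta>) * (2 * \<i> / (1 - \<zeta>)\<^sup>2)) (at \<zeta>)"
    then show ?thesis by blast
  qed (use C in auto)
qed

text \<open>The choice leaves an additive constant open; the polygon maps are built from differences
  of values, in which it cancels.\<close>

definition disc_map :: "complex \<Rightarrow> complex" where
  "disc_map = (SOME f. continuous_on (cball 0 1) f \<and>
     (\<forall>\<zeta>\<in>ball 0 1. (f has_field_derivative integrand (cayley \<zeta>) * (2 * \<i> / (1 - \<zeta>)\<^sup>2)) (at \<zeta>)))"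

lemma disc_map_continuous: "continuous_on (cball 0 1) disc_map"
  and disc_map_deriv: "\<zeta> \<in> ball 0 1 \<Longrightarrow>
    (disc_map has_field_derivative integrand (cayley \<zeta>) * (2 * \<i> / (1 - \<zeta>)\<^sup>2)) (at \<zeta>)"
  using someI_ex[OF ex_disc_map] unfolding disc_map_def[symmetric] by blast+

lemma disc_map_holomorphic: "disc_map holomorphic_on ball 0 1"
  using disc_map_deriv by (meson field_differentiable_at_within field_differentiable_def holomorphic_on_def)

definition cayley_inv :: "complex \<Rightarrow> complex" where "cayley_inv z = (z - \<i>) / (z + \<i>)"

definition half_map :: "complex \<Rightarrow> complex" where "half_map z = disc_map (cayley_inv z)"

lemma plus_i_nonzero: "Im z \<ge> 0 \<Longrightarrow> z + \<i> \<noteq> 0"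
  by (auto simp: complex_eq_iff)

lemma norm_minus_i_le: "Im z \<ge> 0 \<Longrightarrow> norm (z - \<i>) \<le> norm (z + \<i>)"
  by (rule power2_le_imp_le, unfold cmod_power2) (auto simp: power2_eq_square algebra_simps)

lemma norm_minus_i_less: "Im z > 0 \<Longrightarrow> norm (z - \<i>) < norm (z + \<i>)"
  by (rule power2_less_imp_less, unfold cmod_power2) (auto simp: power2_eq_square algebra_simps)

lemma cayley_inv_cball: "Im z \<ge> 0 \<Longrightarrow> cayley_inv z \<in> cball 0 1"
  using norm_minus_i_le[of z] plus_i_nonzero[of z] by (auto simp: cayley_inv_def norm_divide divide_le_eq)

lemma cayley_inv_ball: "Im z > 0 \<Longrightarrow> cayley_inv z \<in> ball 0 1"
  using norm_minus_i_less[of z] plus_i_nonzero[of z] by (auto simp: cayley_inv_def norm_divide divide_less_eq)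

lemma cayley_cayley_inv: "Im z \<ge> 0 \<Longrightarrow> cayley (cayley_inv z) = z"
proof -
  assume "Im z \<ge> 0"
  then have nz: "z + \<i> \<noteq> 0" by (rule plus_i_nonzero)
  have "1 + cayley_inv z = 2 * z / (z + \<i>)" "1 - cayley_inv z = 2 * \<i> / (z + \<i>)"
    using nz by (simp_all add: cayley_inv_def field_simps)
  then show ?thesis using nz by (simp add: cayley_def)
qed

lemma sphere_cayley_inv:
  assumes "\<zeta> \<in> sphere 0 1"
  obtains "\<zeta> = 1" | t where "\<zeta> = cayley_inv (of_real t)"
proof (cases "\<zeta> = 1")
  case False
  then have ne: "1 - \<zeta> \<noteq> 0" by auto
  define w where "w = cayley \<zeta>"
  have "w = \<i> * (1 + \<zeta>) * cnj (1 - \<zeta>) / of_real ((norm (1 - \<zeta>))\<^sup>2)"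
    unfolding w_def cayley_def by (metis complex_div_cnj of_real_power)
  then have "Im w = Im (\<i> * (1 + \<zeta>) * cnj (1 - \<zeta>)) / (norm (1 - \<zeta>))\<^sup>2" by (metis Im_divide_of_real)
  also have "Im (\<i> * (1 + \<zeta>) * cnj (1 - \<zeta>)) = Re ((1 + \<zeta>) * cnj (1 - \<zeta>))"
    unfolding mult.assoc by simp
  also have "\<dots> = 1 - (norm \<zeta>)\<^sup>2"
    unfolding cmod_power2 by (simp add: power2_eq_square algebra_simps)
  finally have "Im w = 0" using assms by simp
  then have w: "w = of_real (Re w)" by (simp add: complex_eq_iff)
  have "w + \<i> = 2 * \<i> / (1 - \<zeta>)" "w - \<i> = 2 * \<i> * \<zeta> / (1 - \<zeta>)"
    using ne by (simp_all add: w_def cayley_def field_simps)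
  then have "cayley_inv w = \<zeta>" using ne by (simp add: cayley_inv_def)
  then show ?thesis using that w by metis
qed (use that in auto)

lemma half_map_continuous: "continuous_on {z. Im z \<ge> 0} half_map"
  unfolding half_map_def
proof (rule continuous_on_compose2[OF disc_map_continuous])
  show "continuous_on {z. 0 \<le> Im z} cayley_inv" unfolding cayley_inv_def
    using plus_i_nonzero by (intro continuous_intros) auto
qed (use cayley_inv_cball in auto)

lemma half_map_deriv_interior:
  assumes z: "Im z > 0"
  shows "(half_map has_field_derivative integrand z) (at z)"
proof -
  have nz: "z + \<i> \<noteq> 0" using z plus_i_nonzero by simp
  have d1: "(cayley_inv has_field_derivative 2 * \<i> / (z + \<i>)\<^sup>2) (at z)"
    unfolding cayley_inv_def[abs_def] using nz
    by (auto intro!: derivative_eq_intros simp: power2_eq_square field_simps)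
  have e: "1 - cayley_inv z = 2 * \<i> / (z + \<i>)" using nz by (simp add: cayley_inv_def field_simps)
  have "(half_map has_field_derivative integrand (cayley (cayley_inv z)) * (2 * \<i> / (1 - cayley_inv z)\<^sup>2) * (2 * \<i> / (z + \<i>)\<^sup>2)) (at z)"
    unfolding half_map_def by (rule DERIV_chain2[OF disc_map_deriv[OF cayley_inv_ball[OF z]] d1])
  also have "integrand (cayley (cayley_inv z)) * (2 * \<i> / (1 - cayley_inv z)\<^sup>2) * (2 * \<i> / (z + \<i>)\<^sup>2) = integrand z"
  proof -
    have "2 * \<i> / (2 * \<i> / w)\<^sup>2 * (2 * \<i> / w\<^sup>2) = 1" if "w \<noteq> 0" for w :: complex
      using that by (simp add: power2_eq_square field_simps)
    from this[OF nz] have "integrand z * (2 * \<i> / (2 * \<i> / (z + \<i>))\<^sup>2) * (2 * \<i> / (z + \<i>)\<^sup>2) = integrand z"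
      by (simp only: mult.assoc mult_1_right)
    moreover have "cayley (cayley_inv z) = z" using z by (simp add: cayley_cayley_inv)
    ultimately show ?thesis unfolding e by simp
  qed
  finally show ?thesis .
qed

text \<open>Away from the prevertices the integrand is continuous from the closed half-plane, so the
  interior derivative persists at real points and can be restricted to the axis.\<close>

lemma half_map_deriv_real:
  assumes t: "t \<notin> A"
  shows "((\<lambda>t. half_map (of_real t)) has_vector_derivative integrand (of_real t)) (at t)"
proof -
  have "complex_of_real t \<in> {z. Im z \<ge> 0} - of_real ` A" using t by auto
  moreover have "at (complex_of_real t) within ({z. Im z \<ge> 0} - of_real ` A) = at (complex_of_real t) within {z. Im z \<ge> 0}"
  proof (rule at_within_nhd)
    have "closed (complex_of_real ` A)" using finite_A by (simp add: finite_imp_closed)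
    then show "open (- complex_of_real ` A)" by (simp add: open_Compl)
    show "complex_of_real t \<in> - complex_of_real ` A" using t by auto
  qed auto
  ultimately have "continuous (at (complex_of_real t) within {z. Im z \<ge> 0}) integrand"
    using integrand_continuous unfolding continuous_on_eq_continuous_within by metis
  then have d: "(half_map has_field_derivative integrand (of_real t)) (at (of_real t) within {z. Im z \<ge> 0})"
    by (intro has_field_derivative_at_real_boundary half_map_continuous half_map_deriv_interior)
  have "((half_map \<circ> complex_of_real) has_vector_derivative 1 * integrand (of_real t)) (at t within UNIV)"
  proof (rule field_vector_diff_chain_within)
    show "(complex_of_real has_vector_derivative 1) (at t within UNIV)"
      using has_vector_derivative_of_real[of "\<lambda>x. x" 1 "at t"] by (auto intro!: has_vector_derivative_real_field derivative_eq_intros)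
    show "(half_map has_field_derivative integrand (of_real t)) (at (of_real t) within range of_real)"
      by (rule has_field_derivative_subset[OF d]) auto
  qed
  then show ?thesis by (simp add: o_def)
qed

text \<open>A prevertex \<open>a\<close> to the right of \<open>t\<close> contributes
  \<open>cis (- pi * b a)\<close>, the phase of a power of the negative number \<open>t - a\<close>.
  Because the condition is \<open>a \<ge> t\<close> and not strict, the value at a prevertex is the
  direction of the side that ends there.\<close>

definition direction :: "real \<Rightarrow> complex" where
  "direction t = cis (- pi * (\<Sum>a | a \<in> A \<and> a \<ge> t. b a))"

lemma integrand_real:
  assumes "t \<notin> A"
  shows "integrand (of_real t) = of_real (norm (integrand (of_real t))) * direction t"
proof -
  have "integrand (of_real t) = (\<Prod>a\<in>A. of_real (norm (complex_of_real t - of_real a) powr (- b a)) * (if a \<ge> t then cis (- pi * b a) else 1))"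
    unfolding integrand_def
  proof (intro prod.cong refl)
    fix a assume a: "a \<in> A"
    then have "a \<noteq> t" using assms by auto
    have "(complex_of_real (t - a)) powr of_real (- b a) = of_real (\<bar>t - a\<bar> powr (- b a)) * (if a \<ge> t then cis (- pi * b a) else 1)"
      by (subst powr_of_real_if) (use \<open>a \<noteq> t\<close> in \<open>auto simp: cis_conv_exp mult_ac\<close>)
    then show "(complex_of_real t - of_real a) powr of_real (- b a) = of_real (norm (complex_of_real t - of_real a) powr (- b a)) * (if a \<ge> t then cis (- pi * b a) else 1)"
      by (simp flip: of_real_diff)
  qed
  also have "\<dots> = of_real (norm (integrand (of_real t))) * (\<Prod>a\<in>A. if a \<ge> t then cis (- pi * b a) else 1)"
    unfolding norm_integrand by (simp add: prod.distrib)
  also have "(\<Prod>a\<in>A. if a \<ge> t then cis (- pi * b a) else 1) = (\<Prod>a | a \<in> A \<and> a \<ge> t. cis (- pi * b a))"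
    using prod.inter_filter[OF finite_A, of "\<lambda>a. cis (- pi * b a)" "\<lambda>a. a \<ge> t"] by simp
  also have "\<dots> = direction t"
    unfolding direction_def cis_conv_exp using finite_A
    by (subst exp_sum[symmetric]) (auto simp: sum_distrib_left of_real_sum)
  finally show ?thesis .
qed

lemma norm_integrand_pos: "t \<notin> A \<Longrightarrow> norm (integrand (of_real t)) > 0"
  unfolding norm_integrand using finite_A by (intro prod_pos) (auto simp: powr_gt_zero)

lemma half_map_real_continuous: "continuous_on S (\<lambda>t. half_map (of_real t))"
  by (rule continuous_on_compose2[OF half_map_continuous]) (auto intro!: continuous_intros)

text \<open>After rotation by \<open>cnj (direction t2)\<close> the derivative along the side is a
  positive real number, so the real part increases strictly and the imaginary part is
  constant.\<close>

lemma half_map_side: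
  assumes t: "t1 < t2" and A: "{t1<..<t2} \<inter> A = {}"
  obtains \<rho> where "\<rho> > 0" "half_map (of_real t2) - half_map (of_real t1) = of_real \<rho> * direction t2"
proof -
  define u where "u = cnj (direction t2)"
  have uu: "u * direction t2 = 1" by (simp add: u_def direction_def cis_cnj cis_mult)
  define G where "G = (\<lambda>t. u * half_map (of_real t))"
  have dir: "direction t = direction t2" if "t1 < t" "t < t2" for t
  proof -
    have "t2 \<le> a" if "a \<in> A" "t \<le> a" for a
    proof (rule ccontr)
      assume "\<not> t2 \<le> a"
      then have "a \<in> {t1<..<t2} \<inter> A" using that \<open>t1 < t\<close> by auto
      then show False using A by blast
    qed
    then have "{a. a \<in> A \<and> t \<le> a} = {a. a \<in> A \<and> t2 \<le> a}" using that by auto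
    then show ?thesis by (simp add: direction_def)
  qed
  have der: "(G has_vector_derivative of_real (norm (integrand (of_real t)))) (at t)" if "t1 < t" "t < t2" for t
  proof -
    have tA: "t \<notin> A" using A that by auto
    have "(G has_vector_derivative u * integrand (of_real t)) (at t)"
      unfolding G_def by (intro has_vector_derivative_mult_right half_map_deriv_real tA)
    moreover have "u * integrand (of_real t) = of_real (norm (integrand (of_real t)))"
      by (subst integrand_real[OF tA]) (use uu dir[OF that] in \<open>simp add: mult_ac\<close>)
    ultimately show ?thesis by simp
  qed
  have contG: "continuous_on {t1..t2} G" unfolding G_def by (intro continuous_intros half_map_real_continuous)
  have "Re (G t1) < Re (G t2)"
  proof (rule DERIV_pos_imp_increasing_open[OF t])
    fix t assume "t1 < t" "t < t2"
    then have "((\<lambda>t. Re (G t)) has_real_derivative norm (integrand (of_real t))) (at t)"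
      using bounded_linear.has_vector_derivative[OF bounded_linear_Re der[of t]]
      by (simp add: has_real_derivative_iff_has_vector_derivative)
    moreover have "norm (integrand (of_real t)) > 0" using A \<open>t1 < t\<close> \<open>t < t2\<close> by (intro norm_integrand_pos) auto
    ultimately show "\<exists>y. ((\<lambda>t. Re (G t)) has_real_derivative y) (at t) \<and> 0 < y" by blast
  next
    show "continuous_on {t1..t2} (\<lambda>t. Re (G t))" by (intro continuous_intros contG)
  qed
  moreover have "Im (G t2) = Im (G t1)"
  proof (rule DERIV_isconst_end[OF t, of "\<lambda>t. Im (G t)"])
    show "continuous_on {t1..t2} (\<lambda>t. Im (G t))" by (intro continuous_intros contG)
    fix t assume "t1 < t" "t < t2"
    then show "((\<lambda>t. Im (G t)) has_real_derivative 0) (at t)"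
      using bounded_linear.has_vector_derivative[OF bounded_linear_Im der[of t]]
      by (simp add: has_real_derivative_iff_has_vector_derivative)
  qed
  ultimately have "u * (half_map (of_real t2) - half_map (of_real t1)) = of_real (Re (G t2) - Re (G t1))"
    by (simp add: G_def complex_eq_iff algebra_simps)
  then have "direction t2 * (u * (half_map (of_real t2) - half_map (of_real t1))) = of_real (Re (G t2) - Re (G t1)) * direction t2"
    by simp
  then have "half_map (of_real t2) - half_map (of_real t1) = of_real (Re (G t2) - Re (G t1)) * direction t2"
    using uu by (metis mult.assoc mult.commute mult_1)
  then show ?thesis using \<open>Re (G t1) < Re (G t2)\<close> by (intro that[of "Re (G t2) - Re (G t1)"]) auto
qed

lemma half_map_at_infinity:
  "((\<lambda>t. half_map (of_real t)) \<longlongrightarrow> disc_map 1) at_top" "((\<lambda>t. half_map (of_real t)) \<longlongrightarrow> disc_map 1) at_bot"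
proof -
  have c: "continuous (at 1 within cball 0 1) disc_map"
    using disc_map_continuous by (simp add: continuous_on_eq_continuous_within)
  have *: "((\<lambda>t. half_map (of_real t)) \<longlongrightarrow> disc_map 1) F" if "((\<lambda>t. 2 / (complex_of_real t + \<i>)) \<longlongrightarrow> 0) F" for F
  proof -
    have e: "cayley_inv (of_real t) = 1 - \<i> * (2 / (complex_of_real t + \<i>))" for t
      using plus_i_nonzero[of "of_real t"] by (simp add: cayley_inv_def field_simps)
    have "((\<lambda>t. cayley_inv (of_real t)) \<longlongrightarrow> 1 - \<i> * 0) F" unfolding e by (intro tendsto_intros that)
    then have "((\<lambda>t. cayley_inv (of_real t)) \<longlongrightarrow> 1) F" by simp
    then show ?thesis unfolding half_map_def
      by (intro continuous_within_tendsto_compose[OF c]) (auto intro!: always_eventually cayley_inv_cball[simplified])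
  qed
  have n: "norm (2 / (complex_of_real t + \<i>)) \<le> 2 / \<bar>t\<bar>" if "t \<noteq> 0" for t
  proof -
    have "\<bar>t\<bar> \<le> norm (complex_of_real t + \<i>)" using abs_Re_le_cmod[of "complex_of_real t + \<i>"] by simp
    then show ?thesis using that by (simp add: norm_divide frac_le)
  qed
  have top: "((\<lambda>t::real. 2 / \<bar>t\<bar>) \<longlongrightarrow> 0) at_top" and bot: "((\<lambda>t::real. 2 / \<bar>t\<bar>) \<longlongrightarrow> 0) at_bot" by real_asymp+
  show "((\<lambda>t. half_map (of_real t)) \<longlongrightarrow> disc_map 1) at_top"
    by (rule *, rule Lim_null_comparison[OF _ top]) (rule eventually_mono[OF eventually_gt_at_top[of 0]], rule n, simp)
  show "((\<lambda>t. half_map (of_real t)) \<longlongrightarrow> disc_map 1) at_bot"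
    by (rule *, rule Lim_null_comparison[OF _ bot]) (rule eventually_mono[OF eventually_gt_at_bot[of 0]], rule n, simp)
qed

lemma half_map_side_has_real_derivative:
  assumes "t \<notin> A" "direction t = d"
  shows "((\<lambda>t. Re (cnj d * half_map (of_real t))) has_real_derivative norm (integrand (of_real t))) (at t)"
proof -
  have "cnj d * integrand (of_real t) = of_real (norm (integrand (of_real t))) * (cnj d * d)"
    by (subst integrand_real[OF assms(1)]) (simp add: assms(2))
  also have "cnj d * d = 1" unfolding assms(2)[symmetric] by (simp add: direction_def cis_cnj cis_mult)
  finally have e: "cnj d * integrand (of_real t) = of_real (norm (integrand (of_real t)))" by simp
  have "((\<lambda>t. cnj d * half_map (of_real t)) has_vector_derivative cnj d * integrand (of_real t)) (at t)"
    by (intro has_vector_derivative_mult_right half_map_deriv_real assms)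
  from bounded_linear.has_vector_derivative[OF bounded_linear_Re this] show ?thesis
    unfolding e by (simp add: has_real_derivative_iff_has_vector_derivative)
qed

lemma isCont_norm_integrand:
  assumes "t \<notin> A"
  shows "isCont (\<lambda>t. norm (integrand (of_real t))) t"
  unfolding norm_integrand using assms by (intro continuous_intros) auto

text \<open>Beyond all prevertices the direction is 1. The length integral over the unbounded
  interval is evaluated by the fundamental theorem for nonnegative derivatives, with
  \<open>disc_map 1\<close> as the limit at infinity.\<close>

lemma half_map_right_side:
  assumes le: "\<And>a. a \<in> A \<Longrightarrow> a \<le> p"
  defines "L \<equiv> LINT t:{p<..}|lborel. norm (integrand (of_real t))"
  shows "disc_map 1 - half_map (of_real p) = of_real L" "L > 0"
proof -
  have dir: "direction t = 1" if "t > p" for t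
  proof -
    have e: "{a. a \<in> A \<and> t \<le> a} = {}" using le that by force
    show ?thesis unfolding direction_def e by simp
  qed
  have notA: "t \<notin> A" if "t > p" for t using le that by force
  define G where "G = (\<lambda>t. half_map (of_real t) - half_map (of_real p))"
  have side: "\<exists>\<rho>>0. G t2 - G t1 = of_real \<rho>" if "p \<le> t1" "t1 < t2" for t1 t2
  proof -
    have "{t1<..<t2} \<inter> A = {}" using le that by force
    then obtain \<rho> where "\<rho> > 0" "half_map (of_real t2) - half_map (of_real t1) = of_real \<rho> * direction t2"
      using half_map_side[OF \<open>t1 < t2\<close>] by blast
    then show ?thesis using dir[of t2] that by (auto simp: G_def)
  qed
  have lim: "(G \<longlongrightarrow> disc_map 1 - half_map (of_real p)) at_top"
    unfolding G_def by (intro tendsto_intros half_map_at_infinity)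
  have "((\<lambda>t. Im (G t)) \<longlongrightarrow> Im (disc_map 1 - half_map (of_real p))) at_top" by (intro tendsto_intros lim)
  moreover have "eventually (\<lambda>t. Im (G t) = 0) at_top"
    using eventually_gt_at_top[of p]
  proof eventually_elim
    case (elim t)
    then obtain \<rho> where "G t - G p = of_real \<rho>" using side[of p t] by auto
    moreover have "G p = 0" by (simp add: G_def)
    ultimately show ?case by simp
  qed
  ultimately have Im0: "Im (disc_map 1 - half_map (of_real p)) = 0"
    using tendsto_unique[OF _ _ tendsto_eventually] trivial_limit_at_top_linorder by blast
  have limRe: "((\<lambda>t. Re (G t)) \<longlongrightarrow> Re (disc_map 1 - half_map (of_real p))) at_top" by (intro tendsto_intros lim)
  obtain \<rho>1 where \<rho>1: "\<rho>1 > 0" "G (p+1) - G p = of_real \<rho>1" using side[of p "p+1"] by auto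
  have "Re (G (p+1)) \<le> Re (disc_map 1 - half_map (of_real p))"
  proof (rule tendsto_lowerbound[OF limRe])
    show "eventually (\<lambda>t. Re (G (p+1)) \<le> Re (G t)) at_top"
      using eventually_gt_at_top[of "p+1"]
    proof eventually_elim
      case (elim t)
      then obtain \<rho> where "\<rho> > 0" "G t - G (p+1) = of_real \<rho>" using side[of "p+1" t] by auto
      then have "Re (G t) - Re (G (p+1)) = \<rho>" by (simp flip: minus_complex.simps(1))
      then show ?case using \<open>\<rho> > 0\<close> by linarith
    qed
  qed simp
  moreover have "Re (G (p+1)) = \<rho>1" using \<rho>1(2) by (simp add: G_def)
  ultimately have pos: "Re (disc_map 1 - half_map (of_real p)) > 0" using \<rho>1 by linarith
  have "(LBINT t=ereal p..\<infinity>. norm (integrand (of_real t))) = Re (disc_map 1 - half_map (of_real p)) - 0"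
  proof (rule interval_integral_FTC_nonneg(2))
    show "((\<lambda>t. Re (G t)) has_real_derivative norm (integrand (of_real t))) (at t)" if "ereal p < ereal t" for t
      using DERIV_diff[OF half_map_side_has_real_derivative[of t 1] DERIV_const[of "Re (half_map (of_real p))"]] notA dir that
      by (simp add: G_def)
    show "isCont (\<lambda>t. norm (integrand (of_real t))) t" if "ereal p < ereal t" for t
      using that notA by (intro isCont_norm_integrand) auto
    have "continuous_on UNIV (\<lambda>t. Re (G t))" unfolding G_def by (intro continuous_intros half_map_real_continuous)
    then have "isCont (\<lambda>t. Re (G t)) p" by (simp add: continuous_on_eq_continuous_at)
    then have "((\<lambda>t. Re (G t)) \<longlongrightarrow> Re (G p)) (at_right p)"
      unfolding isCont_def by (rule filterlim_mono) (auto intro: at_le)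
    then show "(((\<lambda>t. Re (G t)) \<circ> real_of_ereal) \<longlongrightarrow> 0) (at_right (ereal p))"
      by (simp add: ereal_tendsto_simps G_def)
    show "(((\<lambda>t. Re (G t)) \<circ> real_of_ereal) \<longlongrightarrow> Re (disc_map 1 - half_map (of_real p))) (at_left \<infinity>)"
      using limRe by (simp add: ereal_tendsto_simps)
  qed auto
  then have L: "L = Re (disc_map 1 - half_map (of_real p))"
    unfolding L_def interval_integral_to_infinity_eq by simp
  then show "disc_map 1 - half_map (of_real p) = of_real L" "L > 0" using Im0 pos by (auto simp: complex_eq_iff)
qed

text \<open>Every prevertex now lies to the right, so the accumulated phase is the full
  \<open>- pi * (4/3)\<close>.\<close>

lemma half_map_left_side:
  assumes le: "\<And>a. a \<in> A \<Longrightarrow> p \<le> a"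
  defines "L \<equiv> LINT t:{..<p}|lborel. norm (integrand (of_real t))"
  shows "half_map (of_real p) - disc_map 1 = of_real L * cis (- (4 * pi / 3))" "L > 0"
proof -
  define d where "d = cis (- (4 * pi / 3))"
  have dd: "cnj d * d = 1" by (simp add: d_def cis_cnj cis_mult)
  have dir: "direction t = d" if "t \<le> p" for t
  proof -
    have "{a. a \<in> A \<and> t \<le> a} = A" using le that by force
    then show ?thesis by (simp add: direction_def sum_b d_def mult.commute)
  qed
  have notA: "t \<notin> A" if "t < p" for t using le that by force
  define G where "G = (\<lambda>t. cnj d * (half_map (of_real t) - half_map (of_real p)))"
  have side: "\<exists>\<rho>>0. G t2 - G t1 = of_real \<rho>" if "t2 \<le> p" "t1 < t2" for t1 t2
  proof -
    have "{t1<..<t2} \<inter> A = {}" using le that by force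
    then obtain \<rho> where "\<rho> > 0" "half_map (of_real t2) - half_map (of_real t1) = of_real \<rho> * direction t2"
      using half_map_side[OF \<open>t1 < t2\<close>] by blast
    moreover have "G t2 - G t1 = cnj d * (half_map (of_real t2) - half_map (of_real t1))" by (simp add: G_def algebra_simps)
    ultimately show ?thesis using dir[of t2] that dd by (auto simp: mult.left_commute)
  qed
  define Z where "Z = cnj d * (disc_map 1 - half_map (of_real p))"
  have lim: "(G \<longlongrightarrow> Z) at_bot"
    unfolding G_def Z_def by (intro tendsto_intros half_map_at_infinity)
  have "((\<lambda>t. Im (G t)) \<longlongrightarrow> Im Z) at_bot" by (intro tendsto_intros lim)
  moreover have "eventually (\<lambda>t. Im (G t) = 0) at_bot"
    using eventually_gt_at_bot[of p]
  proof eventually_elim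
    case (elim t)
    then obtain \<rho> where "G p - G t = of_real \<rho>" using side[of p t] by auto
    moreover have "G p = 0" by (simp add: G_def)
    ultimately have "G t = of_real (- \<rho>)" by (simp add: neg_eq_iff_add_eq_0 eq_neg_iff_add_eq_0)
    then show ?case by simp
  qed
  ultimately have Im0: "Im Z = 0"
    using tendsto_unique[OF _ _ tendsto_eventually] trivial_limit_at_bot_linorder by blast
  have limRe: "((\<lambda>t. Re (G t)) \<longlongrightarrow> Re Z) at_bot" by (intro tendsto_intros lim)
  obtain \<rho>1 where \<rho>1: "\<rho>1 > 0" "G p - G (p - 1) = of_real \<rho>1" using side[of p "p-1"] by auto
  have "Re (G (p-1)) \<ge> Re Z"
  proof (rule tendsto_upperbound[OF limRe])
    show "eventually (\<lambda>t. Re (G (p-1)) \<ge> Re (G t)) at_bot"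
      using eventually_gt_at_bot[of "p-1"]
    proof eventually_elim
      case (elim t)
      then obtain \<rho> where "\<rho> > 0" "G (p-1) - G t = of_real \<rho>" using side[of "p-1" t] by auto
      then have "Re (G (p-1)) - Re (G t) = \<rho>" by (simp flip: minus_complex.simps(1))
      then show ?case using \<open>\<rho> > 0\<close> by linarith
    qed
  qed simp
  moreover have "Re (G (p-1)) = - \<rho>1"
    using arg_cong[OF \<rho>1(2), of Re] by (simp add: G_def)
  ultimately have pos: "Re Z < 0" using \<rho>1 by linarith
  have "(LBINT t=-\<infinity>..ereal p. norm (integrand (of_real t))) = 0 - Re Z"
  proof (rule interval_integral_FTC_nonneg(2))
    show "((\<lambda>t. Re (G t)) has_real_derivative norm (integrand (of_real t))) (at t)" if "ereal t < ereal p" for t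
      using DERIV_diff[OF half_map_side_has_real_derivative[of t d] DERIV_const[of "Re (cnj d * half_map (of_real p))"]] notA dir that
      by (simp add: G_def algebra_simps)
    show "isCont (\<lambda>t. norm (integrand (of_real t))) t" if "ereal t < ereal p" for t
      using that notA by (intro isCont_norm_integrand) auto
    have "continuous_on UNIV (\<lambda>t. Re (G t))" unfolding G_def by (intro continuous_intros half_map_real_continuous)
    then have "isCont (\<lambda>t. Re (G t)) p" by (simp add: continuous_on_eq_continuous_at)
    then have "((\<lambda>t. Re (G t)) \<longlongrightarrow> Re (G p)) (at_left p)"
      unfolding isCont_def by (rule filterlim_mono) (auto intro: at_le)
    then show "(((\<lambda>t. Re (G t)) \<circ> real_of_ereal) \<longlongrightarrow> 0) (at_left (ereal p))"
      by (simp add: ereal_tendsto_simps G_def)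
    show "(((\<lambda>t. Re (G t)) \<circ> real_of_ereal) \<longlongrightarrow> Re Z) (at_right (-\<infinity>))"
      using limRe by (simp add: ereal_tendsto_simps)
  qed auto
  moreover have "(LBINT t=-\<infinity>..ereal p. norm (integrand (of_real t))) = L"
    unfolding L_def interval_lebesgue_integral_def by simp
  ultimately have L: "L = - Re Z" by simp
  then show "L > 0" using pos by simp
  have "Z = of_real (- L)" using L Im0 by (simp add: complex_eq_iff)
  then have "d * Z = of_real (- L) * d" by simp
  moreover have "d * Z = disc_map 1 - half_map (of_real p)"
    using dd unfolding Z_def by (metis mult.assoc mult.commute mult_1)
  ultimately show "half_map (of_real p) - disc_map 1 = of_real L * cis (- (4 * pi / 3))"
    by (simp add: d_def algebra_simps)
qed

end

section \<open>Conformal maps of the closed disc onto convex polygons\<close>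

definition conformal_disc_map :: "(complex \<Rightarrow> complex) \<Rightarrow> complex set \<Rightarrow> bool" where
  "conformal_disc_map f P \<longleftrightarrow> continuous_on (cball 0 1) f \<and> f holomorphic_on ball 0 1 \<and>
     inj_on f (cball 0 1) \<and> f ` ball 0 1 = interior P \<and> f ` cball 0 1 = P"

lemma conformal_disc_mapI:
  assumes cont: "continuous_on (cball 0 1) f" and hol: "f holomorphic_on ball 0 1"
    and inj: "inj_on f (sphere 0 1)"
    and P: "compact P" "convex P" and sph: "f ` sphere 0 1 \<subseteq> frontier P"
  shows "conformal_disc_map f P"
proof -
  have nc: "\<not> f constant_on ball 0 1"
  proof
    assume "f constant_on ball 0 1"
    then obtain c where c: "\<And>z. z \<in> ball 0 1 \<Longrightarrow> f z = c" by (auto simp: constant_on_def)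
    have "f z = c" if "z \<in> closure (ball 0 1)" for z
      by (rule continuous_constant_on_closure[of "ball 0 1" f c]) (use cont c that in auto)
    then have "f 1 = c" "f (-1) = c" by auto
    then have "(1::complex) = -1" using inj_onD[OF inj, of 1 "-1"] by simp
    then show False by simp
  qed
  note im = holomorphic_ball_image_eq_interior[OF cont hol nc P sph]
  have "f ` ball 0 1 \<inter> f ` sphere 0 1 = {}" using im(1) sph by (auto simp: frontier_def)
  from holomorphic_inj_on_ball_if_inj_on_sphere[OF cont hol inj this] show ?thesis
    using cont hol im by (simp add: conformal_disc_map_def)
qed

lemma not_interior_halfspace:
  assumes sub: "P \<subseteq> {z. c \<le> d \<bullet> z}" and d: "d \<noteq> 0" and z: "d \<bullet> z = c"
  shows "z \<notin> interior (P :: complex set)"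
proof
  assume "z \<in> interior P"
  then obtain e where e: "e > 0" "ball z e \<subseteq> P" by (meson mem_interior)
  define w where "w = z - (e / (2 * norm d)) *\<^sub>R d"
  have "dist z w = e / 2" using d e by (simp add: w_def dist_norm)
  then have "w \<in> P" using e by auto
  then have "c \<le> d \<bullet> w" using sub by auto
  moreover have "d \<bullet> w = c - (e / (2 * norm d)) * (d \<bullet> d)" by (simp add: w_def inner_diff_right z)
  moreover have "(e / (2 * norm d)) * (d \<bullet> d) > 0" using e d by simp
  ultimately show False by linarith
qed

text \<open>A supporting line with inward normal \<open>d\<close> certifies a frontier point, and by
  convexity its inequality has to be checked at the vertices alone.\<close>

lemma hull_frontierI:
  assumes fin: "finite S" and z: "z \<in> convex hull S" and d: "d \<noteq> 0"
    and "\<And>w. w \<in> S \<Longrightarrow> c \<le> d \<bullet> w" "d \<bullet> z = c"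
  shows "z \<in> frontier (convex hull (S :: complex set))"
proof -
  have "convex hull S \<subseteq> {z. c \<le> d \<bullet> z}"
    by (intro hull_minimal convex_halfspace_ge subsetI) (use assms in auto)
  from not_interior_halfspace[OF this d] assms(5) have "z \<notin> interior (convex hull S)" by blast
  then show ?thesis using z closure_subset by (auto simp: frontier_def)
qed

lemma in_hull_segment:
  assumes "a \<in> S" "b \<in> S" "0 \<le> u" "u \<le> 1" "z = a + of_real u * (b - a)"
  shows "z \<in> convex hull S"
proof -
  have "z = (1 - u) *\<^sub>R a + u *\<^sub>R b" using assms(5) by (simp add: scaleR_conv_of_real algebra_simps)
  moreover have "a \<in> convex hull S" "b \<in> convex hull S" using assms by (auto intro: hull_inc)
  ultimately show ?thesis using convexD[OF convex_convex_hull, of a S b "1 - u" u] assms by simp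
qed

lemma cis_turns: "cis (pi/3) * cis (- pi) = - cis (pi/3)" "cis (pi/3) * cis (- (4 * pi / 3)) = -1"
  "cis (pi/3) * cis (- (pi / 3)) = 1"
  "cis (- (2 * pi / 3)) = - cis (pi/3)" "cis (- (4 * pi / 3)) = cis (pi/3) - 1"
proof -
  show 1: "cis (pi/3) * cis (- pi) = - cis (pi/3)" by (simp add: complex_eq_iff)
  have "cis (pi/3) * cis (- (4 * pi / 3)) = cis (- pi)" unfolding cis_mult by (rule arg_cong[of _ _ cis]) simp
  then show 2: "cis (pi/3) * cis (- (4 * pi / 3)) = -1" by (simp add: complex_eq_iff)
  show 3: "cis (pi/3) * cis (- (pi / 3)) = 1" unfolding cis_mult by simp
  have "cis (pi/3) * cis (- pi) = cis (- (2 * pi / 3))" unfolding cis_mult by (rule arg_cong[of _ _ cis]) simp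
  then show "cis (- (2 * pi / 3)) = - cis (pi/3)" using 1 by simp
  have "cis (- (4 * pi / 3)) = cis (-pi) * cis (- (pi/3))" unfolding cis_mult by (rule arg_cong[of _ _ cis]) simp
  also have "\<dots> = - cis (- (pi/3))" by (simp add: complex_eq_iff)
  also have "\<dots> = cis (pi/3) - 1" by (simp add: complex_eq_iff cos_60 sin_60)
  finally show "cis (- (4 * pi / 3)) = cis (pi/3) - 1" .
qed

lemma real_plus_cis60_eq_iff:
  "complex_of_real a + of_real b * cis (pi/3) = of_real c + of_real d * cis (pi/3) \<longleftrightarrow> a = c \<and> b = d"
  by (auto simp: complex_eq_iff cos_60 sin_60)

lemma real_cis60_coords:
  assumes "complex_of_real a + of_real b * cis (pi/3) = of_real c + of_real d * cis (pi/3)"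
  shows "a = c" "b = d"
  using assms real_plus_cis60_eq_iff by blast+

section \<open>The triangle and the parallelogram as Schwarz--Christoffel images\<close>

lemma schwarz_christoffel_triangle: "schwarz_christoffel {0, 1} (\<lambda>_. 2/3)"
  by unfold_locales auto

lemma schwarz_christoffel_parallelogram:
  "x > 1 \<Longrightarrow> schwarz_christoffel {0, 1, x} (\<lambda>a. if a = 1 then 2/3 else 1/3)"
  by unfold_locales auto

text \<open>The prevertices \<open>1\<close>, \<open>\<infinity>\<close>, \<open>0\<close> correspond to the vertices \<open>0\<close>, \<open>1\<close>, \<open>cis (pi / 3)\<close>.\<close>

lemma triangle_map:
  obtains f c where "conformal_disc_map f equilateral_triangle" "c \<noteq> 0"
    "\<And>t. f ((of_real t - \<i>) / (of_real t + \<i>)) = 0 \<longleftrightarrow> t = 1"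
    "f 1 = 1" "f (- 1) = cis (pi/3)"
    "((\<lambda>t. f ((of_real t - \<i>) / (of_real t + \<i>))) \<longlongrightarrow> 1) at_top"
    "((\<lambda>t. f ((of_real t - \<i>) / (of_real t + \<i>))) \<longlongrightarrow> 0) (at_right 1)"
    "\<And>t. t > 1 \<Longrightarrow> ((\<lambda>t. f ((of_real t - \<i>) / (of_real t + \<i>))) has_vector_derivative
        c * of_real (t powr (-2/3) * (t - 1) powr (-2/3))) (at t)"
proof -
  interpret schwarz_christoffel "{0, 1}" "\<lambda>_. 2/3" by (rule schwarz_christoffel_triangle)
  let ?e = "cis (pi/3)"
  define L where "L = (LINT t:{1<..}|lborel. norm (integrand (of_real t)))"
  have L: "disc_map 1 - half_map (of_real 1) = of_real L" "L > 0"
    unfolding L_def by (rule half_map_right_side; auto)+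
  define f where "f = (\<lambda>\<zeta>. (disc_map \<zeta> - half_map 1) / of_real L)"
  define \<Gamma> where "\<Gamma> = (\<lambda>t. f (cayley_inv (of_real t)))"
  have \<Gamma>: "\<Gamma> t = (half_map (of_real t) - half_map 1) / of_real L" for t
    by (simp add: \<Gamma>_def f_def half_map_def)
  have \<Gamma>diff: "\<Gamma> t2 - \<Gamma> t1 = (half_map (of_real t2) - half_map (of_real t1)) / of_real L" for t1 t2
    by (simp add: \<Gamma> diff_divide_distrib)
  have F: "\<exists>\<rho>>0. \<Gamma> t2 - \<Gamma> t1 = of_real \<rho> * direction t2" if "t1 < t2" "{t1<..<t2} \<inter> {0,1} = {}" for t1 t2
  proof -
    note st = that
    obtain \<rho> where "\<rho> > 0" "half_map (of_real t2) - half_map (of_real t1) = of_real \<rho> * direction t2"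
      using half_map_side[OF st] by blast
    then show ?thesis using L by (intro exI[of _ "\<rho> / L"]) (simp add: \<Gamma>diff)
  qed
  have F1: "\<exists>\<rho>>0. \<Gamma> t2 - \<Gamma> t1 = of_real \<rho>" if "1 \<le> t1" "t1 < t2" for t1 t2
  proof -
    have e: "{a. a \<in> {0,1} \<and> t2 \<le> a} = {}" using that by auto
    have "direction t2 = 1" unfolding direction_def e by simp
    then show ?thesis using F[of t1 t2] that by auto
  qed
  have F2: "\<exists>\<rho>>0. \<Gamma> t2 - \<Gamma> t1 = - of_real \<rho> * ?e" if "0 \<le> t1" "t1 < t2" "t2 \<le> 1" for t1 t2
  proof -
    have e: "{a. a \<in> {0,1} \<and> t2 \<le> a} = {1}" using that by auto
    have "direction t2 = cis (- (2 * pi / 3))" unfolding direction_def e by (simp add: mult.commute)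
    then show ?thesis using F[of t1 t2] that unfolding cis_turns by auto
  qed
  have F3: "\<exists>\<rho>>0. \<Gamma> t2 - \<Gamma> t1 = of_real \<rho> * (?e - 1)" if "t1 < t2" "t2 \<le> 0" for t1 t2
  proof -
    have e: "{a. a \<in> {0,1} \<and> t2 \<le> a} = {0,1}" using that by auto
    have "direction t2 = cis (- (4 * pi / 3))" unfolding direction_def e by (simp add: mult.commute)
    then show ?thesis using F[of t1 t2] that unfolding cis_turns by auto
  qed
  have f1: "f 1 = 1" using L by (simp add: f_def)
  have G1: "\<Gamma> 1 = 0" by (simp add: \<Gamma>)
  have F4: "\<exists>\<rho>>0. 1 - \<Gamma> t = of_real \<rho>" if "t \<ge> 1" for t
  proof -
    have "a \<le> t" if "a \<in> {0, 1}" for a using that \<open>t \<ge> 1\<close> by auto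
    note half_map_right_side[OF this]
    then obtain \<rho> where "\<rho> > 0" "disc_map 1 - half_map (of_real t) = of_real \<rho>"
      by blast
    moreover have "1 - \<Gamma> t = (disc_map 1 - half_map (of_real t)) / of_real L"
      using L by (simp add: \<Gamma> field_simps)
    ultimately show ?thesis using L(2) by (intro exI[of _ "\<rho> / L"]) simp
  qed
  have F5: "\<exists>\<rho>>0. \<Gamma> t - 1 = of_real \<rho> * (?e - 1)" if "t \<le> 0" for t
  proof -
    have "t \<le> a" if "a \<in> {0, 1}" for a using that \<open>t \<le> 0\<close> by auto
    note half_map_left_side[OF this, unfolded cis_turns]
    then obtain \<rho> where "\<rho> > 0" "half_map (of_real t) - disc_map 1 = of_real \<rho> * (?e - 1)"
      by blast
    moreover have "\<Gamma> t - 1 = (half_map (of_real t) - disc_map 1) / of_real L"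
      using L by (simp add: \<Gamma> field_simps)
    ultimately show ?thesis using L(2) by (intro exI[of _ "\<rho> / L"]) simp
  qed
  \<comment> \<open>The corner lies on the ray from 0 in direction \<open>cis (pi/3)\<close> and on
    the line through 1 in direction \<open>cis (pi/3) - 1\<close>; comparing coordinates with
    respect to \<open>1\<close> and \<open>cis (pi/3)\<close> determines both side lengths.\<close>
  have G0: "\<Gamma> 0 = ?e"
  proof -
    obtain v where v: "\<Gamma> 1 - \<Gamma> 0 = - of_real v * ?e" using F2[of 0 1] by auto
    obtain w where w: "\<Gamma> 0 - 1 = of_real w * (?e - 1)" using F5[of 0] by auto
    have "\<Gamma> 0 = of_real 0 + of_real v * ?e" using v G1 by simp
    moreover have "\<Gamma> 0 = of_real (1 - w) + of_real w * ?e" using w by (simp add: algebra_simps)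
    ultimately have "0 = 1 - w" "v = w" using real_cis60_coords by metis+
    then show ?thesis using \<open>\<Gamma> 0 = of_real 0 + of_real v * ?e\<close> by simp
  qed
  have form1: "\<exists>u. 0 \<le> u \<and> u < 1 \<and> \<Gamma> t = of_real u" if st: "t \<ge> 1" for t
  proof (cases "t = 1")
    case False
    obtain u where u: "u > 0" "\<Gamma> t - \<Gamma> 1 = of_real u" using F1[of 1 t] st False by auto
    obtain w where w: "w > 0" "1 - \<Gamma> t = of_real w" using F4[OF \<open>t \<ge> 1\<close>] by auto
    have "1 - complex_of_real u = of_real w" using u w G1 by simp
    then have "1 - u = w" by (metis of_real_1 of_real_diff of_real_eq_iff)
    then show ?thesis using u w G1 by (intro exI[of _ u]) auto
  qed (use G1 in \<open>auto intro!: exI[of _ 0]\<close>)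
  have form2: "\<exists>v. 0 < v \<and> v \<le> 1 \<and> \<Gamma> t = of_real v * ?e" if st: "0 \<le> t" "t < 1" for t
  proof (cases "t = 0")
    case False
    obtain v where v: "v > 0" "\<Gamma> 1 - \<Gamma> t = - of_real v * ?e" using F2[of t 1] st by auto
    obtain w where w: "w > 0" "\<Gamma> t - \<Gamma> 0 = - of_real w * ?e" using F2[of 0 t] st False by auto
    have vt: "\<Gamma> t = of_real 0 + of_real v * ?e" using v G1 by simp
    moreover have "\<Gamma> t = of_real 0 + of_real (1 - w) * ?e" using w G0 by (simp add: algebra_simps)
    ultimately have "v = 1 - w" using real_cis60_coords by metis
    then show ?thesis using v(1) w(1) vt by (intro exI[of _ v]) auto
  qed (use G0 in \<open>auto intro!: exI[of _ 1]\<close>)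
  have form3: "\<exists>w. 0 < w \<and> w < 1 \<and> \<Gamma> t = of_real (1 - w) + of_real w * ?e" if st: "t < 0" for t
  proof -
    obtain w where w: "w > 0" "\<Gamma> t - 1 = of_real w * (?e - 1)" using F5[of t] st by auto
    obtain v where v: "v > 0" "\<Gamma> 0 - \<Gamma> t = of_real v * (?e - 1)" using F3[of t 0] st by auto
    have 1: "\<Gamma> t = of_real (1 - w) + of_real w * ?e" using w by (simp add: algebra_simps)
    moreover have "\<Gamma> t = of_real v + of_real (1 - v) * ?e" using v G0 by (simp add: algebra_simps)
    ultimately have "w = 1 - v" using real_cis60_coords by metis
    then show ?thesis using 1 v w by (intro exI[of _ w]) auto
  qed
  have e0: "?e \<noteq> 0" "?e - 1 \<noteq> 0" by (auto simp: complex_eq_iff cos_60 sin_60)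
  have ne_lt: "\<Gamma> s \<noteq> \<Gamma> t" if st: "s < t" for s t
  proof -
    consider "s \<ge> 1" | "0 \<le> s" "s < 1" "t \<le> 1" | "0 \<le> s" "s < 1" "t > 1" | "s < 0" "t \<le> 0" | "s < 0" "0 < t" "t < 1" | "s < 0" "t \<ge> 1"
      using st by linarith
    then show ?thesis
    proof cases
      case 1 then show ?thesis using F1[of s t] st by auto
    next
      case 2 then show ?thesis using F2[of s t] st e0 by auto
    next
      case 3
      obtain v where v: "0 < v" "\<Gamma> s = of_real v * ?e" using form2[of s] 3 by auto
      obtain u where u: "\<Gamma> t = of_real u" using form1[of t] 3 by auto
      show ?thesis using v u real_cis60_coords(2)[of 0 v u 0] by auto
    next
      case 4 then show ?thesis using F3[of s t] st e0 by auto
    next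
      case 5
      obtain w where w: "0 < w" "w < 1" "\<Gamma> s = of_real (1 - w) + of_real w * ?e" using form3[of s] 5 by auto
      obtain v where v: "\<Gamma> t = of_real v * ?e" using form2[of t] 5 by auto
      show ?thesis using v w real_cis60_coords(1)[of 0 v "1 - w" w] by auto
    next
      case 6
      obtain w where w: "0 < w" "w < 1" "\<Gamma> s = of_real (1 - w) + of_real w * ?e" using form3[of s] 6 by auto
      obtain u where u: "\<Gamma> t = of_real u" using form1[of t] 6 by auto
      show ?thesis using w u real_cis60_coords(2)[of u 0 "1 - w" w] by auto
    qed
  qed
  have ne: "\<Gamma> s \<noteq> \<Gamma> t" if "s \<noteq> t" for s t using that ne_lt[of s t] ne_lt[of t s] by (metis linorder_neqE)
  have ne1: "\<Gamma> s \<noteq> 1" for s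
    using F4[of s] F5[of s] form2[of s] real_cis60_coords(1)[of 1 0 0] e0
    by (cases "s \<ge> 1"; cases "s \<le> 0") force+
  have cont: "continuous_on (cball 0 1) f" unfolding f_def using L(2)
    by (intro continuous_intros disc_map_continuous) auto
  have hol: "f holomorphic_on ball 0 1" unfolding f_def using L(2)
    by (intro holomorphic_intros disc_map_holomorphic) auto
  have inj: "inj_on f (sphere 0 1)"
  proof (rule inj_onI)
    fix a b assume ab: "a \<in> sphere 0 1" "b \<in> sphere 0 1" "f a = f b"
    show "a = b"
      using sphere_cayley_inv[OF ab(1)] sphere_cayley_inv[OF ab(2)] ab(3) ne ne1 f1
      unfolding \<Gamma>_def by metis
  qed
  have sph: "f ` sphere 0 1 \<subseteq> frontier equilateral_triangle"
  proof safe
    fix a assume a: "a \<in> sphere (0::complex) 1"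
    \<comment> \<open>In these three claims \<open>d\<close> is an inward normal of the side and
      \<open>c\<close> the value of the inner product with \<open>d\<close> along it.\<close>
    have bottom: "of_real u \<in> frontier equilateral_triangle" if "0 \<le> u" "u \<le> 1" for u
      unfolding equilateral_triangle_def
      by (rule hull_frontierI[where d = \<i> and c = 0]; (rule in_hull_segment[of 0 _ 1 u])?)
         (use that in \<open>auto simp: inner_complex_def cos_60 sin_60 Complex_eq_0\<close>)
    have left: "of_real v * ?e \<in> frontier equilateral_triangle" if "0 \<le> v" "v \<le> 1" for v
      unfolding equilateral_triangle_def
      by (rule hull_frontierI[where d = "Complex (sqrt 3) (-1)" and c = 0]; (rule in_hull_segment[of 0 _ ?e v])?)
         (use that in \<open>auto simp: inner_complex_def cos_60 sin_60 Complex_eq_0\<close>)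
    have right: "of_real (1 - w) + of_real w * ?e \<in> frontier equilateral_triangle" if "0 \<le> w" "w \<le> 1" for w
      unfolding equilateral_triangle_def
      by (rule hull_frontierI[where d = "Complex (- sqrt 3) (-1)" and c = "- sqrt 3"]; (rule in_hull_segment[of 1 _ ?e w])?)
         (use that in \<open>auto simp: inner_complex_def cos_60 sin_60 Complex_eq_0 algebra_simps\<close>)
    consider "a = 1" | t where "a = cayley_inv (of_real t)" using sphere_cayley_inv[OF a] by blast
    then show "f a \<in> frontier equilateral_triangle"
    proof cases
      case 1 then show ?thesis using f1 bottom[of 1] by simp
    next
      case (2 t)
      then have "f a = \<Gamma> t" by (simp add: \<Gamma>_def)
      consider "t \<ge> 1" | "0 \<le> t" "t < 1" | "t < 0" by linarith
      then show ?thesis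
        unfolding \<open>f a = \<Gamma> t\<close>
      proof cases
        case 1
        then obtain u where u: "0 \<le> u" "u < 1" "\<Gamma> t = of_real u" using form1 by blast
        then show "\<Gamma> t \<in> frontier equilateral_triangle" using bottom[of u] by simp
      next
        case 2
        then obtain v where v: "0 < v" "v \<le> 1" "\<Gamma> t = of_real v * ?e" using form2 by blast
        then show "\<Gamma> t \<in> frontier equilateral_triangle" using left[of v] by simp
      next
        case 3
        then obtain w where w: "0 < w" "w < 1" "\<Gamma> t = of_real (1 - w) + of_real w * ?e" using form3 by blast
        show "\<Gamma> t \<in> frontier equilateral_triangle" unfolding w(3) by (rule right) (use w in auto)
      qed
    qed
  qed
  have conf: "conformal_disc_map f equilateral_triangle"
    by (rule conformal_disc_mapI[OF cont hol inj _ _ sph])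
       (auto simp: equilateral_triangle_def intro!: finite_imp_compact_convex_hull)
  have cinv: "f ((of_real t - \<i>) / (of_real t + \<i>)) = \<Gamma> t" for t by (simp add: \<Gamma>_def cayley_inv_def)
  show ?thesis
  proof (rule that[of f "1 / of_real L"])
    show "conformal_disc_map f equilateral_triangle" by (rule conf)
    show "f 1 = 1" by (rule f1)
    have "cayley_inv (of_real 0) = -1" by (simp add: cayley_inv_def)
    then show "f (- 1) = ?e" using G0 by (simp add: \<Gamma>_def)
    show "f ((of_real t - \<i>) / (of_real t + \<i>)) = 0 \<longleftrightarrow> t = 1" for t unfolding cinv using ne[of t 1] G1 by auto
    show "1 / complex_of_real L \<noteq> 0" using L by simp
    have "((\<lambda>t. (half_map (of_real t) - half_map 1) / of_real L) \<longlongrightarrow> (disc_map 1 - half_map 1) / of_real L) at_top"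
      using L(2) by (intro tendsto_intros half_map_at_infinity) auto
    then show "((\<lambda>t. f ((of_real t - \<i>) / (of_real t + \<i>))) \<longlongrightarrow> 1) at_top" unfolding cinv \<Gamma> using f1 by (simp add: f_def)
    have "continuous_on UNIV \<Gamma>" unfolding \<Gamma> using L(2) by (intro continuous_intros half_map_real_continuous) auto
    then have "(\<Gamma> \<longlongrightarrow> \<Gamma> 1) (at 1)" by (simp add: continuous_on_eq_continuous_at isCont_def)
    then have "(\<Gamma> \<longlongrightarrow> \<Gamma> 1) (at_right 1)" by (rule filterlim_mono) (auto intro: at_le)
    then show "((\<lambda>t. f ((of_real t - \<i>) / (of_real t + \<i>))) \<longlongrightarrow> 0) (at_right 1)" unfolding cinv G1 .
    fix t :: real assume t: "t > 1"
    have e: "{a. a \<in> {0,1} \<and> t \<le> a} = {}" using t by auto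
    have "direction t = 1" unfolding direction_def e by simp
    then have "integrand (of_real t) = of_real (norm (integrand (of_real t)))" using integrand_real[of t] t by simp
    also have "norm (integrand (of_real t)) = t powr (-2/3) * (t - 1) powr (-2/3)"
    proof -
      have "norm (complex_of_real t - of_real a) = \<bar>t - a\<bar>" for a
        by (metis norm_of_real of_real_diff)
      from this[of 0] this[of 1] show ?thesis unfolding norm_integrand using t by simp
    qed
    finally have i: "integrand (of_real t) = of_real (t powr (-2/3) * (t - 1) powr (-2/3))" .
    have "(\<Gamma> has_vector_derivative integrand (of_real t) / of_real L) (at t)"
      unfolding \<Gamma> using half_map_deriv_real[of t] t
      by (intro has_vector_derivative_divide) (auto intro!: derivative_eq_intros)
    then show "((\<lambda>t. f ((of_real t - \<i>) / (of_real t + \<i>))) has_vector_derivative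
        1 / of_real L * of_real (t powr (-2/3) * (t - 1) powr (-2/3))) (at t)"
      unfolding cinv i by simp
  qed
qed

text \<open>The prevertices \<open>0\<close>, \<open>1\<close>, \<open>x\<close>, \<open>\<infinity>\<close> correspond to the vertices
  \<open>cis (pi / 3)\<close>, \<open>0\<close>, \<open>r\<close>, \<open>r + cis (pi / 3)\<close>; opposite sides having equal
  lengths, \<open>r\<close> is the ratio of the two unbounded sides.\<close>

lemma parallelogram_map:
  assumes x: "x > 1"
  defines "r \<equiv> cubic_period_real (1 / x) / cubic_period_real (1 - 1 / x)"
  obtains f where "conformal_disc_map f (parallelogram r)"
    "f ((1 - \<i>) / (1 + \<i>)) = 0" "f ((of_real x - \<i>) / (of_real x + \<i>)) = of_real r"
    "f 1 = of_real r + cis (pi/3)" "f (- 1) = cis (pi/3)"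
proof -
  interpret schwarz_christoffel "{0, 1, x}" "\<lambda>a. if a = 1 then 2/3 else 1/3"
    by (rule schwarz_christoffel_parallelogram[OF x])
  let ?e = "cis (pi/3)"
  have x0: "x \<noteq> 0" "x \<noteq> 1" "0 \<noteq> x" "1 \<noteq> x" using x by auto
  define L where "L = (LINT t:{x<..}|lborel. norm (integrand (of_real t)))"
  define U where "U = (LINT t:{..<0}|lborel. norm (integrand (of_real t)))"
  have L: "disc_map 1 - half_map (of_real x) = of_real L" "L > 0"
    unfolding L_def by (rule half_map_right_side; use x in auto)+
  have U: "half_map (of_real 0) - disc_map 1 = of_real U * cis (- (4 * pi / 3))" "U > 0"
    unfolding U_def by (rule half_map_left_side; use x in auto)+
  have nint: "norm (integrand (of_real t)) = \<bar>t\<bar> powr (-1/3) * \<bar>t - 1\<bar> powr (-2/3) * \<bar>t - x\<bar> powr (-1/3)" for t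
  proof -
    have "norm (complex_of_real t - of_real a) = \<bar>t - a\<bar>" for a
      by (metis norm_of_real of_real_diff)
    from this[of 0] this[of 1] this[of x] show ?thesis unfolding norm_integrand using x0 by simp
  qed
  \<comment> \<open>The reflection \<open>t -> - t\<close> turns the side over the negative axis
    into a period integral; the scale \<open>x powr (-1/3)\<close> occurs in \<open>L\<close> as
    well and cancels in the quotient.\<close>
  have U_eq: "U = x powr (-1/3) * cubic_period_real (1 / x)"
  proof -
    have "U = (\<integral>t. indicator {..<0} t *\<^sub>R (\<bar>t\<bar> powr (-1/3) * \<bar>t - 1\<bar> powr (-2/3) * \<bar>t - x\<bar> powr (-1/3)) \<partial>lborel)"
      unfolding U_def set_lebesgue_integral_def nint ..
    also have "\<dots> = \<bar>-1\<bar> *\<^sub>R (\<integral>t. indicator {..<0} (0 + (-1) * t) *\<^sub>R (\<bar>0 + (-1) * t\<bar> powr (-1/3) * \<bar>(0 + (-1) * t) - 1\<bar> powr (-2/3) * \<bar>(0 + (-1) * t) - x\<bar> powr (-1/3)) \<partial>lborel)"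
      by (rule lborel_integral_real_affine) auto
    also have "\<dots> = (\<integral>t. x powr (-1/3) * (indicator {0<..} t *\<^sub>R (t powr (-1/3) * (1 + t) powr (-2/3) * (1 + 1/x * t) powr (-1/3))) \<partial>lborel)"
      unfolding abs_minus abs_one scaleR_one
    proof (rule Bochner_Integration.integral_cong[OF refl])
      fix t :: real
      show "indicator {..<0} (0 + (-1) * t) *\<^sub>R (\<bar>0 + (-1) * t\<bar> powr (-1/3) * \<bar>(0 + (-1) * t) - 1\<bar> powr (-2/3) * \<bar>(0 + (-1) * t) - x\<bar> powr (-1/3))
        = x powr (-1/3) * (indicator {0<..} t *\<^sub>R (t powr (-1/3) * (1 + t) powr (-2/3) * (1 + 1/x * t) powr (-1/3)))"
      proof (cases "t > 0")
        case True
        have "\<bar>(0 + (-1) * t) - x\<bar> = x * (1 + 1/x * t)" using True x by (simp add: field_simps)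
        then have a: "\<bar>(0 + (-1) * t) - x\<bar> powr (-1/3) = x powr (-1/3) * (1 + 1/x * t) powr (-1/3)" by (simp only: powr_mult)
        have b: "\<bar>0 + (-1) * t\<bar> = t" "\<bar>(0 + (-1) * t) - 1\<bar> = 1 + t" using True by auto
        show ?thesis unfolding a b using True by simp
      qed auto
    qed
    also have "\<dots> = x powr (-1/3) * cubic_period_real (1 / x)"
      unfolding cubic_period_real_def set_lebesgue_integral_def by (rule integral_mult_right_zero)
    finally show ?thesis .
  qed
  have L_eq: "L = x powr (-1/3) * cubic_period_real (1 - 1 / x)"
  proof -
    \<comment> \<open>Under the substitution \<open>t -> x + y * t\<close> the three factors become
      proportional to \<open>1 + (1 - 1/x) * t\<close>, \<open>1 + t\<close> and
      \<open>t\<close>.\<close>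
    define y where "y = x - 1"
    have y: "y > 0" using x by (simp add: y_def)
    have "L = (\<integral>t. indicator {x<..} t *\<^sub>R (\<bar>t\<bar> powr (-1/3) * \<bar>t - 1\<bar> powr (-2/3) * \<bar>t - x\<bar> powr (-1/3)) \<partial>lborel)"
      unfolding L_def set_lebesgue_integral_def nint ..
    also have "\<dots> = \<bar>y\<bar> *\<^sub>R (\<integral>t. indicator {x<..} (x + y * t) *\<^sub>R (\<bar>x + y * t\<bar> powr (-1/3) * \<bar>(x + y * t) - 1\<bar> powr (-2/3) * \<bar>(x + y * t) - x\<bar> powr (-1/3)) \<partial>lborel)"
      using y by (intro lborel_integral_real_affine) auto
    also have "\<dots> = (\<integral>t. \<bar>y\<bar> *\<^sub>R (indicator {x<..} (x + y * t) *\<^sub>R (\<bar>x + y * t\<bar> powr (-1/3) * \<bar>(x + y * t) - 1\<bar> powr (-2/3) * \<bar>(x + y * t) - x\<bar> powr (-1/3))) \<partial>lborel)"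
      by (rule Bochner_Integration.integral_scaleR_right[symmetric])
    also have "\<dots> = (\<integral>t. x powr (-1/3) * (indicator {0<..} t *\<^sub>R (t powr (-1/3) * (1 + t) powr (-2/3) * (1 + (1 - 1/x) * t) powr (-1/3))) \<partial>lborel)"
    proof (rule Bochner_Integration.integral_cong[OF refl])
      fix t :: real
      show "\<bar>y\<bar> *\<^sub>R (indicator {x<..} (x + y * t) *\<^sub>R (\<bar>x + y * t\<bar> powr (-1/3) * \<bar>(x + y * t) - 1\<bar> powr (-2/3) * \<bar>(x + y * t) - x\<bar> powr (-1/3)))
        = x powr (-1/3) * (indicator {0<..} t *\<^sub>R (t powr (-1/3) * (1 + t) powr (-2/3) * (1 + (1 - 1/x) * t) powr (-1/3)))"
      proof (cases "t > 0")
        case True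
        have yt: "y * t > 0" using y True by simp
        have "\<bar>x + y * t\<bar> = x * (1 + (1 - 1/x) * t)" using yt x by (simp add: y_def field_simps)
        then have a: "\<bar>x + y * t\<bar> powr (-1/3) = x powr (-1/3) * (1 + (1 - 1/x) * t) powr (-1/3)" by (simp only: powr_mult)
        have "\<bar>(x + y * t) - 1\<bar> = y * (1 + t)" using yt y by (simp add: y_def field_simps)
        then have b: "\<bar>(x + y * t) - 1\<bar> powr (-2/3) = y powr (-2/3) * (1 + t) powr (-2/3)" by (simp only: powr_mult)
        have "\<bar>(x + y * t) - x\<bar> = y * t" using yt by simp
        then have c: "\<bar>(x + y * t) - x\<bar> powr (-1/3) = y powr (-1/3) * t powr (-1/3)" by (simp only: powr_mult)
        have "y powr 1 * y powr (-1/3) * y powr (-2/3) = 1" using y unfolding powr_add[symmetric] by simp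
        then have d: "y * (y powr (-1/3) * y powr (-2/3)) = 1" using y by (simp add: mult.assoc)
        have "\<bar>y\<bar> * (x powr (-1/3) * (1 + (1 - 1/x) * t) powr (-1/3) * (y powr (-2/3) * (1 + t) powr (-2/3)) * (y powr (-1/3) * t powr (-1/3)))
          = (y * (y powr (-1/3) * y powr (-2/3))) * (x powr (-1/3) * (t powr (-1/3) * (1 + t) powr (-2/3) * (1 + (1 - 1/x) * t) powr (-1/3)))"
          using y by (simp add: mult_ac)
        then show ?thesis unfolding a b c d using True yt by simp
      next
        case False
        then have "\<not> y * t > 0" using y by (simp add: zero_less_mult_iff)
        then show ?thesis using False by simp
      qed
    qed
    also have "\<dots> = x powr (-1/3) * cubic_period_real (1 - 1 / x)"
      unfolding cubic_period_real_def set_lebesgue_integral_def by (rule integral_mult_right_zero)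
    finally show ?thesis .
  qed
  have r: "r = U / L" using x by (simp add: r_def U_eq L_eq)
  have r0: "r > 0" using r L U by simp
  \<comment> \<open>The factor \<open>cis (pi/3)\<close> makes the side over \<open>[1, x]\<close>,
    of direction \<open>cis (- (pi / 3))\<close>, horizontal; division by \<open>L\<close> gives the
    side over \<open>{x<..}\<close> length 1.\<close>
  define f where "f = (\<lambda>\<zeta>. ?e * (disc_map \<zeta> - half_map 1) / of_real L)"
  define \<Gamma> where "\<Gamma> = (\<lambda>t. f (cayley_inv (of_real t)))"
  have \<Gamma>: "\<Gamma> t = ?e * (half_map (of_real t) - half_map 1) / of_real L" for t
    by (simp add: \<Gamma>_def f_def half_map_def)
  have \<Gamma>diff: "\<Gamma> t2 - \<Gamma> t1 = ?e * (half_map (of_real t2) - half_map (of_real t1)) / of_real L" for t1 t2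
    unfolding \<Gamma> diff_divide_distrib[symmetric] right_diff_distrib[symmetric] by simp
  have F: "\<exists>\<rho>>0. \<Gamma> t2 - \<Gamma> t1 = of_real \<rho> * (?e * direction t2)" if "t1 < t2" "{t1<..<t2} \<inter> {0,1,x} = {}" for t1 t2
  proof -
    note st = that
    obtain \<rho> where "\<rho> > 0" "half_map (of_real t2) - half_map (of_real t1) = of_real \<rho> * direction t2"
      using half_map_side[OF st] by blast
    then show ?thesis using L(2) by (intro exI[of _ "\<rho> / L"]) (simp add: \<Gamma>diff)
  qed
  have F1: "\<exists>\<rho>>0. \<Gamma> t2 - \<Gamma> t1 = of_real \<rho> * ?e" if "x \<le> t1" "t1 < t2" for t1 t2
  proof -
    have e: "{a. a \<in> {0,1,x} \<and> t2 \<le> a} = {}" using that x by auto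
    have "direction t2 = 1" unfolding direction_def e by simp
    then show ?thesis using F[of t1 t2] that x by auto
  qed
  have F2: "\<exists>\<rho>>0. \<Gamma> t2 - \<Gamma> t1 = of_real \<rho>" if "1 \<le> t1" "t1 < t2" "t2 \<le> x" for t1 t2
  proof -
    have e: "{a. a \<in> {0,1,x} \<and> t2 \<le> a} = {x}" using that by auto
    have "direction t2 = cis (- (pi / 3))" unfolding direction_def e using x0 by simp
    then have "?e * direction t2 = 1" by (simp add: cis_turns del: cis.simps)
    then show ?thesis using F[of t1 t2] that by auto
  qed
  have F3: "\<exists>\<rho>>0. \<Gamma> t2 - \<Gamma> t1 = - of_real \<rho> * ?e" if "0 \<le> t1" "t1 < t2" "t2 \<le> 1" for t1 t2
  proof -
    have e: "{a. a \<in> {0,1,x} \<and> t2 \<le> a} = {1,x}" using that x by auto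
    have "direction t2 = cis (- pi)" unfolding direction_def e using x0 by simp
    then have "?e * direction t2 = - ?e" unfolding cis_turns[symmetric] by simp
    then show ?thesis using F[of t1 t2] that x by auto
  qed
  have F4: "\<exists>\<rho>>0. \<Gamma> t2 - \<Gamma> t1 = - of_real \<rho>" if "t1 < t2" "t2 \<le> 0" for t1 t2
  proof -
    have e: "{a. a \<in> {0,1,x} \<and> t2 \<le> a} = {0,1,x}" using that x by auto
    have "direction t2 = cis (- (4 * pi / 3))" unfolding direction_def e using x0 by (simp add: mult.commute)
    then have "?e * direction t2 = - 1" using cis_turns(2) by simp
    then show ?thesis using F[of t1 t2] that x by auto
  qed
  have G1: "\<Gamma> 1 = 0" by (simp add: \<Gamma>)
  have f1x: "f 1 - \<Gamma> x = ?e" 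
  proof -
    have "f 1 - \<Gamma> x = ?e * (disc_map 1 - half_map (of_real x)) / of_real L" using L(2) by (simp add: f_def \<Gamma> field_simps)
    then show ?thesis unfolding L(1) using L(2) by simp
  qed
  have f10: "\<Gamma> 0 - f 1 = - of_real r"
  proof -
    have "\<Gamma> 0 - f 1 = ?e * (half_map (of_real 0) - disc_map 1) / of_real L" using L(2) by (simp add: f_def \<Gamma> field_simps)
    also have "\<dots> = of_real U * (?e * cis (- (4 * pi / 3))) / of_real L" unfolding U(1) by simp
    also have "\<dots> = - of_real r" unfolding cis_turns(2) r by simp
    finally show ?thesis .
  qed
  \<comment> \<open>The lengths \<open>R\<close> and \<open>V\<close> of the two bounded sides
    follow from closing up the polygon: the known unbounded sides force \<open>R = r\<close> and
    \<open>V = 1\<close>.\<close>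
  obtain R where R: "\<Gamma> x = of_real R" using F2[of 1 x] x G1 by auto
  obtain V where V: "\<Gamma> 0 = of_real V * ?e" using F3[of 0 1] G1 by auto
  have "of_real 0 + of_real V * ?e = of_real (R - r) + of_real 1 * ?e"
    using f1x f10 R V by (simp add: algebra_simps)
  then have "0 = R - r" "V = 1" using real_cis60_coords by metis+
  then have Gx: "\<Gamma> x = of_real r" and G0: "\<Gamma> 0 = ?e" using R V by auto
  have f1: "f 1 = of_real r + ?e" using f1x Gx by (simp add: algebra_simps)
  have F5: "\<exists>\<rho>>0. f 1 - \<Gamma> t = of_real \<rho> * ?e" if "t \<ge> x" for t
  proof -
    have "a \<le> t" if "a \<in> {0, 1, x}" for a using that \<open>t \<ge> x\<close> x by auto
    note half_map_right_side[OF this]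
    then obtain \<rho> where "\<rho> > 0" "disc_map 1 - half_map (of_real t) = of_real \<rho>"
      by blast
    moreover have "f 1 - \<Gamma> t = ?e * (disc_map 1 - half_map (of_real t)) / of_real L"
      using L(2) by (simp add: f_def \<Gamma> field_simps)
    ultimately show ?thesis using L(2) by (intro exI[of _ "\<rho> / L"]) simp
  qed
  have F6: "\<exists>\<rho>>0. \<Gamma> t - f 1 = - of_real \<rho>" if "t \<le> 0" for t
  proof -
    have "t \<le> a" if "a \<in> {0, 1, x}" for a using that \<open>t \<le> 0\<close> x by auto
    note half_map_left_side[OF this]
    then obtain \<rho> where \<rho>: "\<rho> > 0" "half_map (of_real t) - disc_map 1 = of_real \<rho> * cis (- (4 * pi / 3))"
      by blast
    have "\<Gamma> t - f 1 = ?e * (half_map (of_real t) - disc_map 1) / of_real L"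
      using L(2) by (simp add: f_def \<Gamma> field_simps)
    also have "\<dots> = of_real \<rho> * (?e * cis (- (4 * pi / 3))) / of_real L" unfolding \<rho>(2) by simp
    also have "\<dots> = - of_real (\<rho> / L)" unfolding cis_turns(2) by simp
    finally show ?thesis using \<rho>(1) L(2) by (intro exI[of _ "\<rho> / L"]) simp
  qed
  have form1: "\<exists>w. 0 \<le> w \<and> w < 1 \<and> \<Gamma> t = of_real r + of_real w * ?e" if st: "t \<ge> x" for t
  proof (cases "t = x")
    case False
    obtain w where w: "w > 0" "\<Gamma> t - \<Gamma> x = of_real w * ?e" using F1[of x t] st False by auto
    obtain v where v: "v > 0" "f 1 - \<Gamma> t = of_real v * ?e" using F5[OF st] by auto
    have 1: "\<Gamma> t = of_real r + of_real w * ?e" using w Gx by (simp add: algebra_simps)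
    moreover have "\<Gamma> t = of_real r + of_real (1 - v) * ?e" using v f1 by (simp add: algebra_simps)
    ultimately have "w = 1 - v" using real_cis60_coords by metis
    then show ?thesis using 1 v(1) w(1) by (intro exI[of _ w]) auto
  qed (use Gx in \<open>auto intro!: exI[of _ 0]\<close>)
  have form2: "\<exists>u. 0 \<le> u \<and> u < r \<and> \<Gamma> t = of_real u" if st: "1 \<le> t" "t < x" for t
  proof (cases "t = 1")
    case False
    obtain u where u: "u > 0" "\<Gamma> t - \<Gamma> 1 = of_real u" using F2[of 1 t] st False by auto
    obtain w where w: "w > 0" "\<Gamma> x - \<Gamma> t = of_real w" using F2[of t x] st by auto
    have 1: "\<Gamma> t = of_real u" using u G1 by simp
    then have "of_real r - complex_of_real u = of_real w" using w Gx by simp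
    then have "r - u = w" by (metis of_real_diff of_real_eq_iff)
    then show ?thesis using u(1) w(1) 1 by (intro exI[of _ u]) auto
  qed (use G1 r0 in \<open>auto intro!: exI[of _ 0]\<close>)
  have form3: "\<exists>v. 0 < v \<and> v \<le> 1 \<and> \<Gamma> t = of_real v * ?e" if st: "0 \<le> t" "t < 1" for t
  proof (cases "t = 0")
    case False
    obtain v where v: "v > 0" "\<Gamma> 1 - \<Gamma> t = - of_real v * ?e" using F3[of t 1] st by auto
    obtain w where w: "w > 0" "\<Gamma> t - \<Gamma> 0 = - of_real w * ?e" using F3[of 0 t] st False by auto
    have 1: "\<Gamma> t = of_real 0 + of_real v * ?e" using v G1 by simp
    moreover have "\<Gamma> t = of_real 0 + of_real (1 - w) * ?e" using w G0 by (simp add: algebra_simps)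
    ultimately have "v = 1 - w" using real_cis60_coords by metis
    then show ?thesis using v(1) w(1) 1 by (intro exI[of _ v]) auto
  qed (use G0 in \<open>auto intro!: exI[of _ 1]\<close>)
  have form4: "\<exists>u. 0 < u \<and> u < r \<and> \<Gamma> t = of_real u + ?e" if st: "t < 0" for t
  proof -
    obtain w where w: "w > 0" "\<Gamma> t - f 1 = - of_real w" using F6[of t] st by auto
    obtain v where v: "v > 0" "\<Gamma> 0 - \<Gamma> t = - of_real v" using F4[of t 0] st by auto
    have 1: "\<Gamma> t = of_real v + of_real 1 * ?e" using v G0 by (simp add: algebra_simps)
    moreover have "\<Gamma> t = of_real (r - w) + of_real 1 * ?e" using w f1 by (simp add: algebra_simps)
    ultimately have "v = r - w" using real_cis60_coords by metis
    then show ?thesis using 1 v(1) w(1) by (intro exI[of _ v]) auto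
  qed
  have e0: "?e \<noteq> 0" by (auto simp: complex_eq_iff cos_60 sin_60)
  have ne_lt: "\<Gamma> s \<noteq> \<Gamma> t" if st: "s < t" for s t
  proof -
    consider "s \<ge> x" | "1 \<le> s" "s < x" "t \<le> x" | "1 \<le> s" "s < x" "t > x"
      | "0 \<le> s" "s < 1" "t \<le> 1" | "0 \<le> s" "s < 1" "1 < t" "t < x" | "0 \<le> s" "s < 1" "t \<ge> x"
      | "s < 0" "t \<le> 0" | "s < 0" "0 < t" "t < 1" | "s < 0" "1 \<le> t" "t < x" | "s < 0" "t \<ge> x"
    proof -
      consider "s \<ge> x" | "1 \<le> s" "s < x" | "0 \<le> s" "s < 1" | "s < 0" by linarith
      then show thesis
      proof cases
        case 2 then show ?thesis using that(2,3) by (cases "t \<le> x") auto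
      next
        case 3 then show ?thesis using that(4,5,6) by (cases "t \<le> 1"; cases "t < x") auto
      next
        case 4 then show ?thesis using that(7-10) by (cases "t \<le> 0"; cases "t < 1"; cases "t < x") auto
      qed (rule that(1))
    qed
    then show ?thesis
    proof cases
      case 1 then show ?thesis using F1[of s t] st e0 by auto
    next
      case 2 then show ?thesis using F2[of s t] st by auto
    next
      case 3
      obtain u where u: "u < r" "\<Gamma> s = of_real u" using form2[of s] 3 by auto
      obtain w where w: "\<Gamma> t = of_real r + of_real w * ?e" using form1[of t] 3 by auto
      show ?thesis using u w real_cis60_coords(1)[of u 0 r w] by auto
    next
      case 4 then show ?thesis using F3[of s t] st e0 by auto
    next
      case 5
      obtain v where v: "0 < v" "\<Gamma> s = of_real v * ?e" using form3[of s] 5 by auto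
      obtain u where u: "\<Gamma> t = of_real u" using form2[of t] 5 by auto
      show ?thesis using u v real_cis60_coords(2)[of 0 v u 0] by auto
    next
      case 6
      obtain v where v: "\<Gamma> s = of_real v * ?e" using form3[of s] 6 by auto
      obtain w where w: "\<Gamma> t = of_real r + of_real w * ?e" using form1[of t] 6 by auto
      show ?thesis using v w r0 real_cis60_coords(1)[of 0 v r w] by auto
    next
      case 7 then show ?thesis using F4[of s t] st by auto
    next
      case 8
      obtain u where u: "0 < u" "\<Gamma> s = of_real u + ?e" using form4[of s] 8 by auto
      obtain v where v: "\<Gamma> t = of_real v * ?e" using form3[of t] 8 by auto
      show ?thesis using u v real_cis60_coords(1)[of u 1 0 v] by auto
    next
      case 9
      obtain u where u: "\<Gamma> s = of_real u + ?e" using form4[of s] 9 by auto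
      obtain v where v: "\<Gamma> t = of_real v" using form2[of t] 9 by auto
      show ?thesis using u v real_cis60_coords(2)[of u 1 v 0] by auto
    next
      case 10
      obtain u where u: "u < r" "\<Gamma> s = of_real u + ?e" using form4[of s] 10 by auto
      obtain w where w: "\<Gamma> t = of_real r + of_real w * ?e" using form1[of t] 10 by auto
      show ?thesis using u w real_cis60_coords(1)[of u 1 r w] by auto
    qed
  qed
  have ne: "\<Gamma> s \<noteq> \<Gamma> t" if "s \<noteq> t" for s t using that ne_lt[of s t] ne_lt[of t s] by (metis linorder_neqE)
  have ne1: "\<Gamma> s \<noteq> f 1" for s
  proof -
    consider "s \<ge> x" | "1 \<le> s" "s < x" | "0 \<le> s" "s < 1" | "s \<le> 0" by linarith
    then show ?thesis
    proof cases
      case 1 then show ?thesis using F5[of s] e0 by auto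
    next
      case 2
      then obtain u where "\<Gamma> s = of_real u" using form2[of s] by auto
      then show ?thesis using f1 real_cis60_coords(2)[of u 0 r 1] by auto
    next
      case 3
      then obtain v where "\<Gamma> s = of_real v * ?e" using form3[of s] by auto
      then show ?thesis using f1 r0 real_cis60_coords(1)[of 0 v r 1] by auto
    next
      case 4 then show ?thesis using F6[of s] by auto
    qed
  qed
  have cont: "continuous_on (cball 0 1) f" unfolding f_def using L(2)
    by (intro continuous_intros disc_map_continuous) auto
  have hol: "f holomorphic_on ball 0 1" unfolding f_def using L(2)
    by (intro holomorphic_intros disc_map_holomorphic) auto
  have inj: "inj_on f (sphere 0 1)"
  proof (rule inj_onI)
    fix a b assume ab: "a \<in> sphere 0 1" "b \<in> sphere 0 1" "f a = f b"
    show "a = b"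
      using sphere_cayley_inv[OF ab(1)] sphere_cayley_inv[OF ab(2)] ab(3) ne ne1
      unfolding \<Gamma>_def by metis
  qed
  have sph: "f ` sphere 0 1 \<subseteq> frontier (parallelogram r)"
  proof safe
    fix a assume a: "a \<in> sphere (0::complex) 1"
    have bottom: "of_real u \<in> frontier (parallelogram r)" if "0 \<le> u" "u \<le> r" for u
      unfolding parallelogram_def
      by (rule hull_frontierI[where d = \<i> and c = 0]; (rule in_hull_segment[of 0 _ "of_real r" "u / r"])?)
         (use that r0 in \<open>auto simp: inner_complex_def cos_60 sin_60 Complex_eq_0\<close>)
    have top: "of_real u + ?e \<in> frontier (parallelogram r)" if "0 \<le> u" "u \<le> r" for u
      unfolding parallelogram_def
      by (rule hull_frontierI[where d = "-\<i>" and c = "- sqrt 3 / 2"]; (rule in_hull_segment[of ?e _ "of_real r + ?e" "u / r"])?)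
         (use that r0 in \<open>auto simp: inner_complex_def cos_60 sin_60 Complex_eq_0\<close>)
    have left: "of_real v * ?e \<in> frontier (parallelogram r)" if "0 \<le> v" "v \<le> 1" for v
      unfolding parallelogram_def
      by (rule hull_frontierI[where d = "Complex (sqrt 3) (-1)" and c = 0]; (rule in_hull_segment[of 0 _ ?e v])?)
         (use that r0 in \<open>auto simp: inner_complex_def cos_60 sin_60 Complex_eq_0 algebra_simps\<close>)
    have right: "of_real r + of_real w * ?e \<in> frontier (parallelogram r)" if "0 \<le> w" "w \<le> 1" for w
      unfolding parallelogram_def
      by (rule hull_frontierI[where d = "Complex (- sqrt 3) 1" and c = "- sqrt 3 * r"]; (rule in_hull_segment[of "of_real r" _ "of_real r + ?e" w])?)
         (use that r0 in \<open>auto simp: inner_complex_def cos_60 sin_60 Complex_eq_0 algebra_simps\<close>)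
    consider "a = 1" | t where "a = cayley_inv (of_real t)" using sphere_cayley_inv[OF a] by blast
    then show "f a \<in> frontier (parallelogram r)"
    proof cases
      case 1 then show ?thesis using f1 top[of r] r0 by simp
    next
      case (2 t)
      then have fa: "f a = \<Gamma> t" by (simp add: \<Gamma>_def)
      consider "t \<ge> x" | "1 \<le> t" "t < x" | "0 \<le> t" "t < 1" | "t < 0" by linarith
      then show ?thesis
        unfolding fa
      proof cases
        case 1
        then obtain w where w: "0 \<le> w" "w < 1" "\<Gamma> t = of_real r + of_real w * ?e" using form1 by blast
        show "\<Gamma> t \<in> frontier (parallelogram r)" unfolding w(3) by (rule right) (use w in auto)
      next
        case 2
        then obtain u where u: "0 \<le> u" "u < r" "\<Gamma> t = of_real u" using form2 by blast
        then show "\<Gamma> t \<in> frontier (parallelogram r)" using bottom[of u] by simp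
      next
        case 3
        then obtain v where v: "0 < v" "v \<le> 1" "\<Gamma> t = of_real v * ?e" using form3 by blast
        then show "\<Gamma> t \<in> frontier (parallelogram r)" using left[of v] by simp
      next
        case 4
        then obtain u where u: "0 < u" "u < r" "\<Gamma> t = of_real u + ?e" using form4 by blast
        show "\<Gamma> t \<in> frontier (parallelogram r)" unfolding u(3) by (rule top) (use u in auto)
      qed
    qed
  qed
  have conf: "conformal_disc_map f (parallelogram r)"
    by (rule conformal_disc_mapI[OF cont hol inj _ _ sph])
       (auto simp: parallelogram_def intro!: finite_imp_compact_convex_hull)
  have cinv: "f ((of_real t - \<i>) / (of_real t + \<i>)) = \<Gamma> t" for t by (simp add: \<Gamma>_def cayley_inv_def)
  show ?thesis
  proof (rule that[OF conf])
    show "f ((1 - \<i>) / (1 + \<i>)) = 0" using cinv[of 1] G1 by simp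
    show "f ((of_real x - \<i>) / (of_real x + \<i>)) = of_real r" using cinv[of x] Gx by simp
    show "f 1 = of_real r + ?e" by (rule f1)
    have "cayley_inv (of_real 0) = -1" by (simp add: cayley_inv_def)
    then show "f (- 1) = ?e" using G0 by (simp add: \<Gamma>_def)
  qed
qed

section \<open>The Carleson map of a parallelogram\<close>

lemma conformal_disc_map_inverse:
  assumes "conformal_disc_map f P"
  obtains k where "homeomorphism (cball 0 1) P f k" "k holomorphic_on interior P" "k ` interior P = ball 0 1"
proof -
  have f: "continuous_on (cball 0 1) f" "f holomorphic_on ball 0 1" "inj_on f (cball 0 1)"
    "f ` ball 0 1 = interior P" "f ` cball 0 1 = P"
    using assms by (auto simp: conformal_disc_map_def)
  obtain k where k: "homeomorphism (cball 0 1) P f k"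
    using homeomorphism_compact[of "cball 0 1" f P] f by auto
  have inj: "inj_on f (ball 0 1)" using f(3) by (rule inj_on_subset) auto
  obtain k' where k': "k' holomorphic_on interior P" "\<And>z. z \<in> ball 0 1 \<Longrightarrow> k' (f z) = z"
    using holomorphic_has_inverse[OF f(2) open_ball inj] f(4) by metis
  have kf: "k (f z) = z" if "z \<in> cball 0 1" for z using k that by (auto simp: homeomorphism_def)
  have "k holomorphic_on interior P"
    using k'(1)
  proof (rule holomorphic_transform)
    fix w assume "w \<in> interior P"
    then obtain z where z: "z \<in> ball 0 1" "w = f z" using f(4) by blast
    then show "k' w = k w" using k'(2)[OF z(1)] kf[of z] by simp
  qed
  moreover have "k ` interior P = ball 0 1"
    unfolding f(4)[symmetric] image_image using kf by force
  ultimately show ?thesis using that k by blast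
qed

text \<open>A Moebius map taking \<open>\<phi> 0\<close> to 0 reduces this to the Schwarz lemma for
  the map and its inverse, so the composition is a rotation. Its equation extends to the circle,
  where the fixed points determine the two parameters. Under \<open>cayley_inv\<close> the points
  \<open>1\<close>, \<open>-1\<close>, \<open>- \<i>\<close> correspond to the prevertices infinity,
  0 and 1.\<close>

lemma disc_automorphism_fixing_three_points:
  assumes cont: "continuous_on (cball 0 1) \<phi>"
    and hol: "\<phi> holomorphic_on ball 0 1" "\<psi> holomorphic_on ball 0 1"
    and im: "\<And>z. z \<in> ball 0 1 \<Longrightarrow> \<phi> z \<in> ball 0 1" "\<And>z. z \<in> ball 0 1 \<Longrightarrow> \<psi> z \<in> ball 0 1"
    and inv: "\<And>z. z \<in> ball 0 1 \<Longrightarrow> \<psi> (\<phi> z) = z" "\<And>z. z \<in> ball 0 1 \<Longrightarrow> \<phi> (\<psi> z) = z"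
    and fixed: "\<phi> 1 = 1" "\<phi> (-1) = -1" "\<phi> (-\<i>) = -\<i>"
    and z: "z \<in> cball 0 1"
  shows "\<phi> z = z"
proof -
  define a where "a = \<phi> 0"
  have a: "norm a < 1" using im(1)[of 0] by (simp add: a_def)
  define M where "M = Moebius_function 0 a"
  define M' where "M' = Moebius_function 0 (-a)"
  have M: "M w = (w - a) / (1 - cnj a * w)" for w by (simp add: M_def Moebius_function_simple)
  have Mh: "M holomorphic_on ball 0 1" "M' holomorphic_on ball 0 1"
    unfolding M_def M'_def using a by (intro Moebius_function_holomorphic; simp)+
  have Mb: "M w \<in> ball 0 1" "M' w \<in> ball 0 1" if "w \<in> ball 0 1" for w
    using that a Moebius_function_norm_lt_1[of a w 0] Moebius_function_norm_lt_1[of "-a" w 0]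
    by (simp_all add: M_def M'_def)
  have MM: "M' (M w) = w" "M (M' w) = w" if "w \<in> ball 0 1" for w
    using that a Moebius_function_compose[of a "-a" w] Moebius_function_compose[of "-a" a w]
    by (simp_all add: M_def M'_def)
  define F where "F = M \<circ> \<phi>"
  define G where "G = \<psi> \<circ> M'"
  have FG: "F holomorphic_on ball 0 1" "G holomorphic_on ball 0 1"
    unfolding F_def G_def using hol Mh im Mb
    by (intro holomorphic_on_compose_gen[of _ _ _ "ball 0 1"]; auto)+
  have F0: "F 0 = 0" by (simp add: F_def M a_def)
  have "M' 0 = a" by (simp add: M'_def Moebius_function_simple)
  then have G0: "G 0 = 0" using inv(1)[of 0] by (simp add: G_def a_def)
  have Fb: "norm (F w) < 1" "norm (G w) < 1" if "norm w < 1" for w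
    using that im(1)[of w] im(2)[of "M' w"] Mb(1)[of "\<phi> w"] Mb(2)[of w] by (auto simp: F_def G_def)
  have GF: "G (F w) = w" if "norm w < 1" for w
    using that im(1)[of w] MM(1)[of "\<phi> w"] inv(1)[of w] by (simp add: F_def G_def)
  \<comment> \<open>Any nonzero point of the disc would serve: equality in the Schwarz lemma at one
    of them makes \<open>F\<close> a rotation.\<close>
  have "norm (F (1/2)) = norm (1/2 :: complex)"
  proof (rule antisym)
    show "norm (F (1/2)) \<le> norm (1/2 :: complex)"
      by (rule Schwarz_Lemma(1)[OF FG(1) F0 Fb(1)]) auto
    have "norm (G (F (1/2))) \<le> norm (F (1/2))"
      by (rule Schwarz_Lemma(1)[OF FG(2) G0 Fb(2)]) (use Fb in auto)
    then show "norm (1/2 :: complex) \<le> norm (F (1/2))" using GF[of "1/2"] by simp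
  qed
  then have "(\<exists>z. norm z < 1 \<and> z \<noteq> 0 \<and> norm (F z) = norm z) \<or> norm (deriv F 0) = 1"
    by (intro disjI1 exI[of _ "1/2"]) auto
  then obtain \<alpha> where \<alpha>: "\<And>z. norm z < 1 \<Longrightarrow> F z = \<alpha> * z"
    using Schwarz_Lemma(3)[OF FG(1) F0 Fb(1), of 0] by auto
  \<comment> \<open>With the Moebius denominator cleared, the relation is between functions
    continuous on the closed disc and passes to the closure at once.\<close>
  have eq: "\<phi> w - a - \<alpha> * w * (1 - cnj a * \<phi> w) = 0" if "w \<in> closure (ball 0 1)" for w
  proof (rule continuous_constant_on_closure[of "ball 0 1" "\<lambda>w. \<phi> w - a - \<alpha> * w * (1 - cnj a * \<phi> w)"])
    show "continuous_on (closure (ball 0 1)) (\<lambda>w. \<phi> w - a - \<alpha> * w * (1 - cnj a * \<phi> w))"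
      using cont by (auto intro!: continuous_intros)
    fix w :: complex assume w: "w \<in> ball 0 1"
    have "norm (cnj a * \<phi> w) \<le> norm a * 1"
      unfolding norm_mult complex_mod_cnj using im(1)[OF w] by (intro mult_left_mono) auto
    then have "norm (cnj a * \<phi> w) < 1" using a by simp
    then have "1 - cnj a * \<phi> w \<noteq> 0" by auto
    moreover have "(\<phi> w - a) / (1 - cnj a * \<phi> w) = \<alpha> * w" using \<alpha>[of w] w by (simp add: F_def M)
    ultimately show "\<phi> w - a - \<alpha> * w * (1 - cnj a * \<phi> w) = 0" by (simp add: field_simps)
  qed (use that in auto)
  have e: "1 - a - \<alpha> * (1 - cnj a) = 0" "-1 - a + \<alpha> * (1 + cnj a) = 0" "- \<i> - a + \<alpha> * \<i> * (1 + \<i> * cnj a) = 0"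
    using eq[of 1] eq[of "-1"] eq[of "-\<i>"] fixed by (simp_all add: mult_ac)
  have "(1 - a - \<alpha> * (1 - cnj a)) + (-1 - a + \<alpha> * (1 + cnj a)) = 0" using e by simp
  then have "2 * (\<alpha> * cnj a - a) = 0" by (simp add: algebra_simps)
  then have ca: "\<alpha> * cnj a = a" by simp
  then have \<alpha>1: "\<alpha> = 1" using e(1) by (simp add: algebra_simps)
  have "a = 0" using e(3) ca \<alpha>1 by (simp add: algebra_simps)
  then show ?thesis using eq[of z] z \<alpha>1 by simp
qed

text \<open>The comparison is made in the disc: conjugating \<open>g1\<close> after the inverse of
  \<open>g2\<close> by the triangle map \<open>T\<close> gives a disc automorphism, continuous up to
  the circle, that fixes the preimages of the three corners of the triangle.\<close>

lemma is_carleson_map_unique: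
  assumes g1: "is_carleson_map r g1" and g2: "is_carleson_map r g2" and z: "z \<in> parallelogram r"
  shows "g1 z = g2 z"
proof -
  let ?P = "parallelogram r" and ?D = equilateral_triangle
  obtain T c where T0: "conformal_disc_map T equilateral_triangle" "c \<noteq> 0"
    "\<And>t. T ((of_real t - \<i>) / (of_real t + \<i>)) = 0 \<longleftrightarrow> t = 1"
    "T 1 = 1" "T (- 1) = cis (pi/3)"
    "((\<lambda>t. T ((of_real t - \<i>) / (of_real t + \<i>))) \<longlongrightarrow> 1) at_top"
    "((\<lambda>t. T ((of_real t - \<i>) / (of_real t + \<i>))) \<longlongrightarrow> 0) (at_right 1)"
    "\<And>t. t > 1 \<Longrightarrow> ((\<lambda>t. T ((of_real t - \<i>) / (of_real t + \<i>))) has_vector_derivative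
        c * of_real (t powr (-2/3) * (t - 1) powr (-2/3))) (at t)"
    by (rule triangle_map) blast
  have T: "conformal_disc_map T ?D" "T ((1 - \<i>) / (1 + \<i>)) = 0" "T 1 = 1" "T (- 1) = cis (pi/3)"
    using T0(1,4,5) T0(3)[of 1] by simp_all
  have i: "(1 - \<i>) / (1 + \<i>) = - \<i>"
  proof -
    have "1 + \<i> \<noteq> 0" by (simp add: complex_eq_iff)
    moreover have "1 - \<i> = - \<i> * (1 + \<i>)" by (simp add: algebra_simps)
    ultimately show ?thesis by (subst nonzero_divide_eq_eq) simp_all
  qed
  obtain Ti where Ti: "homeomorphism (cball 0 1) ?D T Ti" "Ti holomorphic_on interior ?D" "Ti ` interior ?D = ball 0 1"
    using conformal_disc_map_inverse[OF T(1)] by blast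
  have Tp: "T ` ball 0 1 = interior ?D" "T holomorphic_on ball 0 1" using T(1) by (auto simp: conformal_disc_map_def)
  obtain h1 where h1: "homeomorphism ?P ?D g1 h1" "g1 ` interior ?P = interior ?D"
    "g1 holomorphic_on interior ?P" "h1 holomorphic_on interior ?D"
    using g1 by (auto simp: is_carleson_map_def)
  obtain h2 where h2: "homeomorphism ?P ?D g2 h2" "g2 ` interior ?P = interior ?D"
    "g2 holomorphic_on interior ?P" "h2 holomorphic_on interior ?D"
    using g2 by (auto simp: is_carleson_map_def)
  note v1 = g1[unfolded is_carleson_map_def, THEN conjunct2]
  note v2 = g2[unfolded is_carleson_map_def, THEN conjunct2]
  have hi: "h ` interior ?D = interior ?P" if h: "homeomorphism ?P ?D g h" "g ` interior ?P = interior ?D" for g h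
  proof -
    have "h (g z) = z" if "z \<in> interior ?P" for z using h(1) that interior_subset[of ?P] by (auto simp: homeomorphism_def)
    then show ?thesis unfolding h(2)[symmetric] image_image by force
  qed
  note hi1 = hi[OF h1(1,2)] and hi2 = hi[OF h2(1,2)]
  have gh1: "h1 (g1 z) = z" if "z \<in> ?P" for z using h1(1) that by (auto simp: homeomorphism_def)
  have gh2: "h2 (g2 z) = z" if "z \<in> ?P" for z using h2(1) that by (auto simp: homeomorphism_def)
  have hg1: "g1 (h1 z) = z" if "z \<in> ?D" for z using h1(1) that by (auto simp: homeomorphism_def)
  have hg2: "g2 (h2 z) = z" if "z \<in> ?D" for z using h2(1) that by (auto simp: homeomorphism_def)
  have TT: "Ti (T z) = z" if "z \<in> cball 0 1" for z using Ti(1) that by (auto simp: homeomorphism_def)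
  have TT': "T (Ti z) = z" if "z \<in> ?D" for z using Ti(1) that by (auto simp: homeomorphism_def)
  define \<phi> where "\<phi> = (\<lambda>\<zeta>. Ti (g1 (h2 (T \<zeta>))))"
  define \<psi> where "\<psi> = (\<lambda>\<zeta>. Ti (g2 (h1 (T \<zeta>))))"
  have sub: "interior ?P \<subseteq> ?P" "interior ?D \<subseteq> ?D" "ball 0 1 \<subseteq> cball (0::complex) 1" by (auto simp: interior_subset)
  have vP: "0 \<in> ?P" "of_real r + cis (pi/3) \<in> ?P" "cis (pi/3) \<in> ?P" unfolding parallelogram_def by (auto intro!: hull_inc)
  have id: "\<phi> \<zeta> = \<zeta>" if \<zeta>: "\<zeta> \<in> cball 0 1" for \<zeta>
  proof (rule disc_automorphism_fixing_three_points[where \<psi> = \<psi>])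
    have "homeomorphism (cball 0 1) (cball 0 1) (Ti \<circ> (g1 \<circ> (h2 \<circ> T))) (Ti \<circ> (g2 \<circ> (h1 \<circ> T)))"
      using homeomorphism_compose[OF homeomorphism_compose[OF homeomorphism_compose[OF Ti(1) homeomorphism_symD[OF h2(1)]] h1(1)] homeomorphism_symD[OF Ti(1)]]
      by (simp add: o_assoc)
    then show "continuous_on (cball 0 1) \<phi>" by (simp add: homeomorphism_def \<phi>_def o_def)
    show "\<phi> holomorphic_on ball 0 1" unfolding \<phi>_def
      by (rule holomorphic_on_compose_gen[unfolded o_def, OF _ Ti(2)],
          rule holomorphic_on_compose_gen[unfolded o_def, OF _ h1(3)],
          rule holomorphic_on_compose_gen[unfolded o_def, OF Tp(2) h2(4)])
         (use Tp(1) hi2 h1(2) in blast)+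
    show "\<psi> holomorphic_on ball 0 1" unfolding \<psi>_def
      by (rule holomorphic_on_compose_gen[unfolded o_def, OF _ Ti(2)],
          rule holomorphic_on_compose_gen[unfolded o_def, OF _ h2(3)],
          rule holomorphic_on_compose_gen[unfolded o_def, OF Tp(2) h1(4)])
         (use Tp(1) hi1 h2(2) in blast)+
    show "\<phi> w \<in> ball 0 1" "\<psi> w \<in> ball 0 1" if "w \<in> ball 0 1" for w
      unfolding \<phi>_def \<psi>_def using that Tp(1) hi1 hi2 h1(2) h2(2) Ti(3) by blast+
    show "\<psi> (\<phi> w) = w" "\<phi> (\<psi> w) = w" if w: "w \<in> ball 0 1" for w
    proof -
      have a: "T w \<in> interior ?D" using w Tp(1) by blast
      have b: "h2 (T w) \<in> interior ?P" "h1 (T w) \<in> interior ?P" using a hi1 hi2 by blast+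
      have c: "g1 (h2 (T w)) \<in> interior ?D" "g2 (h1 (T w)) \<in> interior ?D" using b h1(2) h2(2) by blast+
      have d: "T w \<in> ?D" "h2 (T w) \<in> ?P" "h1 (T w) \<in> ?P" "g1 (h2 (T w)) \<in> ?D" "g2 (h1 (T w)) \<in> ?D" "w \<in> cball 0 1"
        using a b c w sub by blast+
      show "\<psi> (\<phi> w) = w" "\<phi> (\<psi> w) = w"
        unfolding \<phi>_def \<psi>_def using d by (simp_all add: TT TT' gh1 gh2 hg1 hg2)
    qed
    have "h2 1 = of_real r + cis (pi/3)" "h2 0 = 0" "h2 (cis (pi/3)) = cis (pi/3)"
      using gh2 vP v2 by metis+
    moreover have "Ti 1 = 1" "Ti (cis (pi/3)) = -1" "Ti 0 = -\<i>"
      using TT[of 1] TT[of "-1"] TT[of "-\<i>"] T i by simp_all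
    ultimately show "\<phi> 1 = 1" "\<phi> (-1) = -1" "\<phi> (-\<i>) = -\<i>"
      unfolding \<phi>_def using T i v1 by simp_all
  qed (rule \<zeta>)
  have g2z: "g2 z \<in> ?D" "g1 z \<in> ?D" using z h1(1) h2(1) by (auto simp: homeomorphism_def)
  have "Ti (g2 z) \<in> cball 0 1" using g2z Ti(1) unfolding homeomorphism_def by blast
  from id[OF this] have "Ti (g1 z) = Ti (g2 z)" unfolding \<phi>_def using g2z z by (simp add: TT' gh2)
  then show ?thesis using TT' g2z by metis
qed

text \<open>Triangle and parallelogram have the prevertices 0, 1 and infinity in common at the
  corners that normalise the Carleson map, which is therefore \<open>T \<circ> Qi\<close> on the
  parallelogram. The fourth corner has prevertex \<open>x\<close>, so \<open>carleson_map\<close> at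
  that corner is the boundary value \<open>u x\<close> of the triangle map.\<close>

lemma Pi_h_par_value:
  obtains u :: "real \<Rightarrow> complex" and c where
    "\<And>x. x > 1 \<Longrightarrow> Pi_h_par (cubic_period_real (1 / x) / cubic_period_real (1 - 1 / x)) = 1 - u x"
    "(u \<longlongrightarrow> 1) at_top" "(u \<longlongrightarrow> 0) (at_right 1)" "c \<noteq> 0"
    "\<And>t. t > 1 \<Longrightarrow> (u has_vector_derivative c * of_real (t powr (-2/3) * (t - 1) powr (-2/3))) (at t)"
proof -
  let ?D = equilateral_triangle
  obtain T c where T: "conformal_disc_map T equilateral_triangle" "c \<noteq> 0"
    "\<And>t. T ((of_real t - \<i>) / (of_real t + \<i>)) = 0 \<longleftrightarrow> t = 1"
    "T 1 = 1" "T (- 1) = cis (pi/3)"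
    "((\<lambda>t. T ((of_real t - \<i>) / (of_real t + \<i>))) \<longlongrightarrow> 1) at_top"
    "((\<lambda>t. T ((of_real t - \<i>) / (of_real t + \<i>))) \<longlongrightarrow> 0) (at_right 1)"
    "\<And>t. t > 1 \<Longrightarrow> ((\<lambda>t. T ((of_real t - \<i>) / (of_real t + \<i>))) has_vector_derivative
        c * of_real (t powr (-2/3) * (t - 1) powr (-2/3))) (at t)"
    by (rule triangle_map) blast
  obtain Ti where Ti: "homeomorphism (cball 0 1) ?D T Ti" "Ti holomorphic_on interior ?D" "Ti ` interior ?D = ball 0 1"
    using conformal_disc_map_inverse[OF T(1)] by blast
  have Tp: "T ` ball 0 1 = interior ?D" "T holomorphic_on ball 0 1" using T(1) by (auto simp: conformal_disc_map_def)
  show ?thesis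
  proof (rule that[OF _ T(6,7,2,8)])
    fix x :: real assume x: "x > 1"
    define r where "r = cubic_period_real (1 / x) / cubic_period_real (1 - 1 / x)"
    let ?P = "parallelogram r"
    obtain Q where Q: "conformal_disc_map Q ?P"
      "Q ((1 - \<i>) / (1 + \<i>)) = 0" "Q ((of_real x - \<i>) / (of_real x + \<i>)) = of_real r"
      "Q 1 = of_real r + cis (pi/3)" "Q (- 1) = cis (pi/3)"
      by (rule parallelogram_map[OF x, folded r_def]) blast
    obtain Qi where Qi: "homeomorphism (cball 0 1) ?P Q Qi" "Qi holomorphic_on interior ?P" "Qi ` interior ?P = ball 0 1"
      using conformal_disc_map_inverse[OF Q(1)] by blast
    have Qp: "Q ` ball 0 1 = interior ?P" "Q holomorphic_on ball 0 1" using Q(1) by (auto simp: conformal_disc_map_def)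
    have QQ: "Qi (Q z) = z" if "z \<in> cball 0 1" for z using Qi(1) that by (auto simp: homeomorphism_def)
    have Qin: "Q z \<in> ?P" if "z \<in> cball 0 1" for z using Qi(1) that unfolding homeomorphism_def by blast
    \<comment> \<open>The restriction puts the candidate into \<open>extensional\<close>, where
      agreement on the closed parallelogram becomes equality of functions.\<close>
    define g where "g = restrict (T \<circ> Qi) ?P"
    have gQ: "g (Q z) = T z" if "z \<in> cball 0 1" for z using QQ[OF that] Qin[OF that] by (simp add: g_def)
    have n: "norm ((of_real t - \<i>) / (of_real t + \<i>)) \<le> 1" for t
    proof -
      have "norm (complex_of_real t - \<i>) = norm (of_real t + \<i>)" by (simp add: cmod_def)
      then show ?thesis by (simp add: norm_divide)
    qed
    have subP: "interior ?P \<subseteq> ?P" by (rule interior_subset)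
    have "homeomorphism ?P ?D (T \<circ> Qi) (Q \<circ> Ti)"
      by (rule homeomorphism_compose[OF homeomorphism_symD[OF Qi(1)] Ti(1)])
    then have "homeomorphism ?P ?D g (Q \<circ> Ti)"
      by (rule homeomorphism_cong) (auto simp: g_def)
    moreover have "g ` interior ?P = interior ?D"
    proof -
      have "g ` interior ?P = (\<lambda>z. T (Qi z)) ` interior ?P" using subP by (auto simp: g_def intro!: image_cong)
      also have "\<dots> = T ` (Qi ` interior ?P)" by (simp add: image_image)
      finally show ?thesis using Qi(3) Tp(1) by simp
    qed
    moreover have "g holomorphic_on interior ?P"
    proof (rule holomorphic_transform)
      show "(\<lambda>z. T (Qi z)) holomorphic_on interior ?P"
        by (rule holomorphic_on_compose_gen[unfolded o_def, OF Qi(2) Tp(2)]) (use Qi(3) in auto)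
      show "T (Qi z) = g z" if "z \<in> interior ?P" for z using that subP by (auto simp: g_def)
    qed
    moreover have "(Q \<circ> Ti) holomorphic_on interior ?D"
      by (rule holomorphic_on_compose_gen[OF Ti(2) Qp(2)]) (use Ti(3) in auto)
    moreover have "g 0 = 0" using gQ[of "(1 - \<i>) / (1 + \<i>)"] n[of 1] Q(2) T(3)[of 1] by simp
    moreover have "g (of_real r + cis (pi/3)) = 1" using gQ[of 1] Q T by simp
    moreover have "g (cis (pi/3)) = cis (pi/3)" using gQ[of "-1"] Q T by simp
    ultimately have g: "is_carleson_map r g" unfolding is_carleson_map_def by blast
    have "carleson_map r = g" unfolding carleson_map_def
    proof (rule the_equality)
      show "g \<in> extensional ?P \<and> is_carleson_map r g" using g by (simp add: g_def)
      fix g' assume g': "g' \<in> extensional ?P \<and> is_carleson_map r g'"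
      show "g' = g"
      proof (rule extensionalityI[of _ ?P])
        show "g' z = g z" if "z \<in> ?P" for z
          by (rule is_carleson_map_unique[OF _ g that]) (use g' in auto)
      qed (use g' in \<open>auto simp: g_def\<close>)
    qed
    moreover have "g (of_real r) = T ((of_real x - \<i>) / (of_real x + \<i>))"
      using gQ[of "(of_real x - \<i>) / (of_real x + \<i>)"] n[of x] Q(3) by simp
    ultimately show "Pi_h_par (cubic_period_real (1 / x) / cubic_period_real (1 - 1 / x)) = 1 - T ((of_real x - \<i>) / (of_real x + \<i>))"
      unfolding Pi_h_par_def r_def by simp
  qed
qed

section \<open>Functions with a Fricke symmetry\<close>

locale fricke_function =
  fixes F :: "complex \<Rightarrow> complex" and a :: "nat \<Rightarrow> complex" and \<alpha> :: real
  assumes hol: "F holomorphic_on upper_half_plane"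
    and alpha_pos: "\<alpha> > 0"
    and q_expansion: "\<exists>Y>0. \<forall>\<tau>. Im \<tau> > Y \<longrightarrow>
          (\<lambda>n. a n * exp (2 * of_real pi * \<i> * (of_nat n + of_real \<alpha>) * \<tau>)) sums F \<tau>"
    and fricke: "\<And>\<tau>. \<tau> \<in> upper_half_plane \<Longrightarrow> F (- 1 / (3 * \<tau>)) = 1 - F \<tau>"
    and nonvanishing: "\<And>\<tau>. \<tau> \<in> upper_half_plane \<Longrightarrow> deriv F \<tau> \<noteq> 0"
begin

lemma open_uhp: "open upper_half_plane"
  unfolding upper_half_plane_def by (rule open_halfspace_Im_gt)

lemma connected_uhp: "connected upper_half_plane"
  unfolding upper_half_plane_def by (intro convex_connected convex_halfspace_Im_gt)

lemma F_deriv: "\<tau> \<in> upper_half_plane \<Longrightarrow> (F has_field_derivative deriv F \<tau>) (at \<tau>)"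
  by (rule holomorphic_derivI[OF hol open_uhp])

lemma deriv_F_holomorphic: "deriv F holomorphic_on upper_half_plane"
  by (rule holomorphic_deriv[OF hol open_uhp])

definition multiplier :: complex where "multiplier = cis (2 * pi * \<alpha>)"

text \<open>High in the half-plane the q-expansion gives this termwise, since a unit translation
  affects only the fractional part \<alpha> common to all exponents; analytic continuation carries
  it down.\<close>

lemma F_translate:
  assumes "\<tau> \<in> upper_half_plane"
  shows "F (\<tau> + 1) = multiplier * F \<tau>"
proof -
  obtain Y where Y: "Y > 0" "\<And>\<tau>. Im \<tau> > Y \<Longrightarrow>
          (\<lambda>n. a n * exp (2 * of_real pi * \<i> * (of_nat n + of_real \<alpha>) * \<tau>)) sums F \<tau>"
    using q_expansion by blast
  show ?thesis
  proof (rule analytic_continuation_open[of "{z. Im z > Y}" upper_half_plane "\<lambda>\<tau>. F (\<tau> + 1)" "\<lambda>\<tau>. multiplier * F \<tau>"])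
    show "open {z. Y < Im z}" by (rule open_halfspace_Im_gt)
    show "{z. Y < Im z} \<noteq> {}" by (auto intro!: exI[of _ "\<i> * of_real (Y + 1)"])
    show "{z. Y < Im z} \<subseteq> upper_half_plane" using Y by (auto simp: upper_half_plane_def)
    show "(\<lambda>\<tau>. F (\<tau> + 1)) holomorphic_on upper_half_plane"
      by (rule holomorphic_on_compose_gen[unfolded o_def, OF _ hol])
         (auto intro!: holomorphic_intros simp: upper_half_plane_def)
    show "(\<lambda>\<tau>. multiplier * F \<tau>) holomorphic_on upper_half_plane" by (intro holomorphic_intros hol)
    fix z assume "z \<in> {z. Y < Im z}"
    then have z: "Im z > Y" by simp
    have e: "exp (2 * of_real pi * \<i> * (of_nat n + of_real \<alpha>) * (z + 1)) =
      multiplier * exp (2 * of_real pi * \<i> * (of_nat n + of_real \<alpha>) * z)" for n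
    proof -
      have "2 * of_real pi * \<i> * (of_nat n + of_real \<alpha>) * (z + 1) = 2 * of_real pi * \<i> * (of_nat n + of_real \<alpha>) * z
        + (\<i> * of_real (2 * pi * \<alpha>) + 2 * of_nat n * of_real pi * \<i>)" by (simp add: algebra_simps)
      moreover have "exp (2 * of_nat n * complex_of_real pi * \<i>) = 1"
        using exp_integer_2pi[of "of_nat n"] by (simp add: mult_ac)
      ultimately show ?thesis unfolding multiplier_def cis_conv_exp by (simp add: exp_add mult_ac)
    qed
    have "(\<lambda>n. multiplier * (a n * exp (2 * of_real pi * \<i> * (of_nat n + of_real \<alpha>) * z))) sums (multiplier * F z)"
      by (intro sums_mult Y z)
    moreover have "(\<lambda>n. multiplier * (a n * exp (2 * of_real pi * \<i> * (of_nat n + of_real \<alpha>) * z))) sums F (z + 1)"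
      using Y(2)[of "z + 1"] z unfolding e by (simp add: mult_ac)
    ultimately show "F (z + 1) = multiplier * F z" by (rule sums_unique2[symmetric])
  qed (use open_uhp connected_uhp assms in auto)
qed

lemma deriv_F_translate:
  assumes t: "\<tau> \<in> upper_half_plane"
  shows "deriv F (\<tau> + 1) = multiplier * deriv F \<tau>"
proof -
  have t1: "\<tau> + 1 \<in> upper_half_plane" using t by (simp add: upper_half_plane_def)
  have d1: "((\<lambda>\<tau>. F (\<tau> + 1)) has_field_derivative deriv F (\<tau> + 1) * 1) (at \<tau>)"
  proof (rule DERIV_chain2[of F "deriv F (\<tau> + 1)" "\<lambda>\<tau>. \<tau> + 1"])
    show "((\<lambda>\<tau>. \<tau> + 1) has_field_derivative 1) (at \<tau>)" by (auto intro!: derivative_eq_intros)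
  qed (rule F_deriv[OF t1])
  have "((\<lambda>\<tau>. F (\<tau> + 1)) has_field_derivative multiplier * deriv F \<tau>) (at \<tau>)"
    by (rule has_field_derivative_transform_within_open[OF DERIV_cmult[OF F_deriv[OF t]] open_uhp t])
       (simp add: F_translate)
  from DERIV_unique[OF d1 this] show ?thesis by simp
qed

lemma fricke_in_uhp: "\<tau> \<in> upper_half_plane \<Longrightarrow> - 1 / (3 * \<tau>) \<in> upper_half_plane"
proof -
  assume t: "\<tau> \<in> upper_half_plane"
  then have "\<tau> \<noteq> 0" by (auto simp: upper_half_plane_def)
  have "complex_of_real (3 * (norm \<tau>)\<^sup>2) = 3 * (\<tau> * cnj \<tau>)" using complex_norm_square[of \<tau>] by simp
  then have "- 1 / (3 * \<tau>) = - cnj \<tau> / of_real (3 * (norm \<tau>)\<^sup>2)"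
    using \<open>\<tau> \<noteq> 0\<close> by simp
  then have "Im (- 1 / (3 * \<tau>)) = Im \<tau> / (3 * (norm \<tau>)\<^sup>2)" by (simp only: Im_divide_of_real) simp
  then show ?thesis using t \<open>\<tau> \<noteq> 0\<close> by (simp add: upper_half_plane_def)
qed

lemma deriv_F_fricke:
  assumes t: "\<tau> \<in> upper_half_plane"
  shows "deriv F (- 1 / (3 * \<tau>)) = - 3 * \<tau>\<^sup>2 * deriv F \<tau>"
proof -
  have t0: "\<tau> \<noteq> 0" using t by (auto simp: upper_half_plane_def)
  have d1: "((\<lambda>\<tau>. F (- 1 / (3 * \<tau>))) has_field_derivative deriv F (- 1 / (3 * \<tau>)) * (1 / (3 * \<tau>\<^sup>2))) (at \<tau>)"
  proof (rule DERIV_chain2[of F "deriv F (- 1 / (3 * \<tau>))" "\<lambda>\<tau>. - 1 / (3 * \<tau>)"])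
    show "((\<lambda>\<tau>. - 1 / (3 * \<tau>)) has_field_derivative 1 / (3 * \<tau>\<^sup>2)) (at \<tau>)"
      using t0 by (auto intro!: derivative_eq_intros simp: power2_eq_square field_simps)
  qed (rule F_deriv[OF fricke_in_uhp[OF t]])
  have "((\<lambda>\<tau>. 1 - F \<tau>) has_field_derivative - deriv F \<tau>) (at \<tau>)"
    using F_deriv[OF t] by (auto intro!: derivative_eq_intros)
  then have "((\<lambda>\<tau>. F (- 1 / (3 * \<tau>))) has_field_derivative - deriv F \<tau>) (at \<tau>)"
    by (rule has_field_derivative_transform_within_open[OF _ open_uhp t]) (rule fricke[symmetric])
  from DERIV_unique[OF d1 this] show ?thesis using t0 by (simp add: field_simps)
qed

text \<open>The composition of \<open>\<tau> \<mapsto> - 1 / (3 \<tau>)\<close> with the unit translation fixes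
  \<open>cis (pi / 6) / sqrt 3\<close>, where \<open>deriv F\<close> does not vanish.\<close>

lemma multiplier_eq: "multiplier = cis (2 * pi / 3)"
proof -
  define \<rho> where "\<rho> = Complex (1/2) (sqrt 3 / 6)"
  have r: "\<rho> \<in> upper_half_plane" by (simp add: \<rho>_def upper_half_plane_def)
  have "3 * \<rho> * \<rho> = 3 * \<rho> - 1" by (simp add: \<rho>_def complex_eq_iff)
  moreover have r0: "\<rho> \<noteq> 0" using r by (auto simp: upper_half_plane_def)
  ultimately have fixed: "- 1 / (3 * \<rho>) + 1 = \<rho>" by (simp add: field_simps)
  have "deriv F \<rho> = multiplier * (- 3 * \<rho>\<^sup>2 * deriv F \<rho>)"
    using deriv_F_translate[OF fricke_in_uhp[OF r]] unfolding fixed deriv_F_fricke[OF r] .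
  then have "(multiplier * (- 3 * \<rho>\<^sup>2)) * deriv F \<rho> = 1 * deriv F \<rho>" by (simp only: mult.assoc mult_1)
  then have "multiplier * (- 3 * \<rho>\<^sup>2) = 1" by (rule mult_right_cancel[OF nonvanishing[OF r], THEN iffD1])
  \<comment> \<open>\<open>3 * \<rho>\<^sup>2 = cis (pi / 3)\<close>, because
    \<open>\<rho> = cis (pi / 6) / sqrt 3\<close>.\<close>
  moreover have "- 3 * \<rho>\<^sup>2 = cis (- (2 * pi / 3))"
    by (simp add: \<rho>_def power2_eq_square complex_eq_iff cos_120 sin_120)
  ultimately have m: "multiplier * cis (- (2 * pi / 3)) = 1" by (simp only:)
  have "multiplier = multiplier * (cis (- (2 * pi / 3)) * cis (2 * pi / 3))" by (simp add: cis_mult)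
  then show ?thesis unfolding mult.assoc[symmetric] m by simp
qed

lemma alpha_cases: "\<alpha> = 1/3 \<or> \<alpha> \<ge> 4/3"
proof -
  have "cos (2 * pi * \<alpha> - 2 * pi / 3) = 1"
  proof -
    have "cis (2 * pi * \<alpha> - 2 * pi / 3) = multiplier / cis (2 * pi / 3)"
      unfolding multiplier_def cis_divide ..
    also have "\<dots> = 1" unfolding multiplier_eq by simp
    finally show ?thesis by (simp add: complex_eq_iff)
  qed
  then obtain n :: int where n: "2 * pi * \<alpha> - 2 * pi / 3 = of_int n * 2 * pi"
    using cos_one_2pi_int by auto
  then have "2 * pi * \<alpha> = 2 * pi * (1/3 + of_int n)" by (simp add: algebra_simps)
  then have al: "\<alpha> = 1/3 + of_int n" by simp
  then have "n \<ge> 0" using alpha_pos by linarith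
  then have "n = 0 \<or> n \<ge> 1" by linarith
  then show ?thesis using al by auto
qed

text \<open>Convergence at the single height \<open>y0\<close> bounds all terms there by
  \<open>M\<close>. Going up by \<open>d >= 1\<close> multiplies the term of index \<open>n\<close>
  by \<open>exp (- 2 * pi * (n + \<alpha>) * d)\<close>, which leaves the common factor
  \<open>exp (- 2 * pi * \<alpha> * d)\<close> and a geometric series of ratio
  \<open>exp (- 1)\<close> as majorant.\<close>

lemma F_decay:
  obtains Y C where "C \<ge> 0" "Y > 0" "\<And>\<tau>. Im \<tau> \<ge> Y \<Longrightarrow> norm (F \<tau>) \<le> C * exp (- 2 * pi * \<alpha> * Im \<tau>)"
proof -
  obtain Y where Y: "Y > 0" "\<And>\<tau>. Im \<tau> > Y \<Longrightarrow>
          (\<lambda>n. a n * exp (2 * of_real pi * \<i> * (of_nat n + of_real \<alpha>) * \<tau>)) sums F \<tau>"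
    using q_expansion by blast
  have nt: "norm (a n * exp (2 * of_real pi * \<i> * (of_nat n + of_real \<alpha>) * \<tau>)) = norm (a n) * exp (- 2 * pi * (real n + \<alpha>) * Im \<tau>)" for n \<tau>
    by (simp add: norm_mult)
  define y0 where "y0 = Y + 1"
  have "Bseq (\<lambda>n. a n * exp (2 * of_real pi * \<i> * (of_nat n + of_real \<alpha>) * (\<i> * of_real y0)))"
    using Y(2)[of "\<i> * of_real y0"] by (intro convergent_imp_Bseq summable_LIMSEQ_zero[THEN convergentI] sums_summable) (auto simp: y0_def)
  then obtain M where M: "M > 0" "\<And>n. norm (a n * exp (2 * of_real pi * \<i> * (of_nat n + of_real \<alpha>) * (\<i> * of_real y0))) \<le> M"
    by (auto simp: Bseq_def)
  have M': "norm (a n) * exp (- 2 * pi * (real n + \<alpha>) * y0) \<le> M" for n using M(2)[of n] unfolding nt by simp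
  define C where "C = M * exp (2 * pi * \<alpha> * y0) * (\<Sum>n. exp (- 1) ^ n)"
  have geo: "summable (\<lambda>n. exp (- 1 :: real) ^ n)" by (intro summable_geometric) auto
  show ?thesis
  proof (rule that[of C "Y + 2"])
    show "C \<ge> 0" unfolding C_def using M(1) by (intro mult_nonneg_nonneg suminf_nonneg geo) auto
    show "Y + 2 > 0" using Y by simp
    fix \<tau> assume t: "Im \<tau> \<ge> Y + 2"
    define d where "d = Im \<tau> - y0"
    have d: "d \<ge> 1" using t by (simp add: d_def y0_def)
    have bnd: "norm (a n * exp (2 * of_real pi * \<i> * (of_nat n + of_real \<alpha>) * \<tau>)) \<le> M * exp (- 2 * pi * \<alpha> * d) * exp (- 1) ^ n" for n
    proof -
      have "norm (a n * exp (2 * of_real pi * \<i> * (of_nat n + of_real \<alpha>) * \<tau>)) =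
        norm (a n) * exp (- 2 * pi * (real n + \<alpha>) * y0) * exp (- 2 * pi * (real n + \<alpha>) * d)"
      proof -
        have split: "A * Im \<tau> = A * y0 + A * d" for A :: real by (simp add: d_def right_diff_distrib)
        show ?thesis unfolding nt by (subst split) (simp only: exp_add mult.assoc)
      qed
      also have "\<dots> \<le> M * exp (- 2 * pi * (real n + \<alpha>) * d)" by (intro mult_right_mono M') auto
      also have "exp (- 2 * pi * (real n + \<alpha>) * d) = exp (- 2 * pi * \<alpha> * d) * exp (- (2 * pi * real n * d))"
        unfolding exp_add[symmetric] by (simp add: algebra_simps)
      also have "exp (- (2 * pi * real n * d)) \<le> exp (real n * (- 1))"
      proof -
        have "1 * 1 \<le> (2 * pi) * d" using d pi_gt3 by (intro mult_mono) auto
        then have "real n * 1 \<le> real n * ((2 * pi) * d)" by (intro mult_left_mono) auto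
        then show ?thesis by (simp add: mult_ac)
      qed
      also have "exp (real n * (- 1)) = exp (- 1 :: real) ^ n" by (rule exp_of_nat_mult)
      finally show ?thesis using M(1) by (simp add: mult_ac mult_left_mono)
    qed
    have "F \<tau> = (\<Sum>n. a n * exp (2 * of_real pi * \<i> * (of_nat n + of_real \<alpha>) * \<tau>))"
      using Y(2)[of \<tau>] t sums_unique by auto
    also have "norm \<dots> \<le> (\<Sum>n. M * exp (- 2 * pi * \<alpha> * d) * exp (- 1) ^ n)"
      by (rule norm_suminf_le[OF bnd]) (intro summable_mult geo)
    also have "\<dots> = M * exp (- 2 * pi * \<alpha> * d) * (\<Sum>n. exp (- 1) ^ n)" by (rule suminf_mult[OF geo])
    also have "exp (- 2 * pi * \<alpha> * d) = exp (2 * pi * \<alpha> * y0) * exp (- 2 * pi * \<alpha> * Im \<tau>)"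
      unfolding exp_add[symmetric] by (simp add: d_def algebra_simps)
    finally show "norm (F \<tau>) \<le> C * exp (- 2 * pi * \<alpha> * Im \<tau>)" by (simp add: C_def mult_ac)
  qed
qed

text \<open>Cauchy's estimate on the unit disc around \<tau> costs one unit of height, hence the
  factor \<open>exp (2 * pi * \<alpha>)\<close>.\<close>

lemma deriv_F_decay:
  obtains Y C where "C \<ge> 0" "Y > 0" "\<And>\<tau>. Im \<tau> \<ge> Y \<Longrightarrow> norm (deriv F \<tau>) \<le> C * exp (- 2 * pi * \<alpha> * Im \<tau>)"
proof -
  obtain Y C where Y: "C \<ge> 0" "Y > 0" "\<And>\<tau>. Im \<tau> \<ge> Y \<Longrightarrow> norm (F \<tau>) \<le> C * exp (- 2 * pi * \<alpha> * Im \<tau>)"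
    by (rule F_decay, rule that)
  show ?thesis
  proof (rule that[of "C * exp (2 * pi * \<alpha>)" "Y + 1"])
    fix \<tau> assume t: "Im \<tau> \<ge> Y + 1"
    have im: "Im z \<ge> Im \<tau> - 1" if "z \<in> cball \<tau> 1" for z
      using that abs_Im_le_cmod[of "\<tau> - z"] by (simp add: dist_norm)
    have sub: "cball \<tau> 1 \<subseteq> upper_half_plane"
    proof
      fix z assume "z \<in> cball \<tau> 1"
      from im[OF this] t Y(2) show "z \<in> upper_half_plane" by (simp add: upper_half_plane_def)
    qed
    have "norm ((deriv ^^ 1) F \<tau>) \<le> fact 1 * (C * exp (- 2 * pi * \<alpha> * (Im \<tau> - 1))) / 1 ^ 1"
    proof (rule Cauchy_inequality)
      show "F holomorphic_on ball \<tau> 1" by (rule holomorphic_on_subset[OF hol]) (use sub in auto)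
      show "continuous_on (cball \<tau> 1) F" by (rule continuous_on_subset[OF holomorphic_on_imp_continuous_on[OF hol] sub])
      fix z assume "norm (\<tau> - z) = 1"
      then have z: "Im z \<ge> Im \<tau> - 1" using im[of z] by (simp add: dist_norm)
      have "norm (F z) \<le> C * exp (- 2 * pi * \<alpha> * Im z)" using z t by (intro Y) auto
      also have "\<dots> \<le> C * exp (- 2 * pi * \<alpha> * (Im \<tau> - 1))"
        using z alpha_pos Y(1) by (intro mult_left_mono) (auto intro: mult_left_mono)
      finally show "norm (F z) \<le> C * exp (- 2 * pi * \<alpha> * (Im \<tau> - 1))" .
    qed auto
    moreover have "exp (- 2 * pi * \<alpha> * (Im \<tau> - 1)) = exp (2 * pi * \<alpha>) * exp (- 2 * pi * \<alpha> * Im \<tau>)"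
      unfolding exp_add[symmetric] by (simp add: algebra_simps)
    ultimately show "norm (deriv F \<tau>) \<le> C * exp (2 * pi * \<alpha>) * exp (- 2 * pi * \<alpha> * Im \<tau>)" by (simp add: mult_ac)
  qed (use Y in auto)
qed

lemma norm_deriv_F_translate_int:
  assumes "\<tau> \<in> upper_half_plane"
  shows "norm (deriv F (\<tau> + of_int n)) = norm (deriv F \<tau>)"
proof (induction n rule: int_induct[where k = 0])
  case (step1 i)
  have "\<tau> + of_int i \<in> upper_half_plane" using assms by (simp add: upper_half_plane_def)
  from deriv_F_translate[OF this] step1 show ?case by (simp add: norm_mult multiplier_def add.assoc)
next
  case (step2 i)
  have "\<tau> + of_int (i - 1) \<in> upper_half_plane" using assms by (simp add: upper_half_plane_def)
  from deriv_F_translate[OF this] step2 show ?case by (simp add: norm_mult multiplier_def)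
qed auto

text \<open>The norm has period 1 because \<open>multiplier\<close> is unimodular, so below the
  height \<open>Y\<close> a compact rectangle of width 1 suffices; above \<open>Y\<close> the decay
  takes over.\<close>

lemma deriv_F_bounded:
  assumes c: "c > 0"
  obtains B where "B > 0" "\<And>\<tau>. Im \<tau> \<ge> c \<Longrightarrow> norm (deriv F \<tau>) \<le> B"
proof -
  obtain Y C where Y: "C \<ge> 0" "Y > 0" "\<And>\<tau>. Im \<tau> \<ge> Y \<Longrightarrow> norm (deriv F \<tau>) \<le> C * exp (- 2 * pi * \<alpha> * Im \<tau>)"
    by (rule deriv_F_decay, rule that)
  define R where "R = cbox (Complex 0 c) (Complex 1 Y)"
  have Rsub: "R \<subseteq> upper_half_plane" using c by (auto simp: R_def in_cbox_complex_iff upper_half_plane_def)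
  have "compact (deriv F ` R)" unfolding R_def
    by (intro compact_continuous_image compact_cbox continuous_on_subset[OF holomorphic_on_imp_continuous_on[OF deriv_F_holomorphic]])
       (use Rsub in \<open>simp add: R_def\<close>)
  then have "bounded (deriv F ` R)" by (rule compact_imp_bounded)
  then obtain B1 where "\<forall>x\<in>deriv F ` R. norm x \<le> B1" unfolding bounded_iff by (rule exE)
  then have B1: "norm (deriv F z) \<le> B1" if "z \<in> R" for z using that by simp
  show ?thesis
  proof (rule that[of "max 1 (max B1 C)"])
    fix \<tau> assume t: "Im \<tau> \<ge> c"
    show "norm (deriv F \<tau>) \<le> max 1 (max B1 C)"
    proof (cases "Im \<tau> \<ge> Y")
      case True
      have "norm (deriv F \<tau>) \<le> C * exp (- 2 * pi * \<alpha> * Im \<tau>)" by (rule Y(3)[OF True])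
      also have "\<dots> \<le> C * 1" using Y(1,2) True alpha_pos by (intro mult_left_mono) auto
      finally show ?thesis by simp
    next
      case False
      have uh: "\<tau> \<in> upper_half_plane" using t c by (simp add: upper_half_plane_def)
      have "\<tau> + of_int (- \<lfloor>Re \<tau>\<rfloor>) \<in> R" unfolding R_def in_cbox_complex_iff
        using t False by (auto simp: algebra_simps) linarith+
      from B1[OF this] norm_deriv_F_translate_int[OF uh, of "- \<lfloor>Re \<tau>\<rfloor>"] show ?thesis by simp
    qed
  qed auto
qed

end

section \<open>The pullback to the period coordinate\<close>

abbreviation "tau z \<equiv> \<i> / of_real (sqrt 3) * (cubic_period (1 - z) / cubic_period z)"

lemma cubic_period_nonzero:
  assumes "Re z > 0" "Im z \<le> 0" "z \<noteq> 1"
  shows "cubic_period z \<noteq> 0" "cubic_period (1 - z) \<noteq> 0"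
proof -
  have nn: "z \<notin> \<real>\<^sub>\<le>\<^sub>0" using assms by (auto simp: complex_nonpos_Reals_iff)
  have pos: "0 < 3 powr (-4/3) / 2 * (1 + norm w) powr (-1/3)" for w :: complex
  proof -
    have "(1 + norm w) powr (-1/3) > 0" using norm_ge_zero[of w] by (subst powr_gt_zero) linarith
    then show ?thesis by (intro mult_pos_pos) auto
  qed
  show "cubic_period z \<noteq> 0" "cubic_period (1 - z) \<noteq> 0"
    using cubic_period_lower_bounds[OF assms(2) nn assms(3)] pos[of z] pos[of "1 - z"] by auto
qed

lemma one_minus_not_nonpos: "Im z \<noteq> 0 \<Longrightarrow> 1 - z \<notin> \<real>\<^sub>\<le>\<^sub>0"
  by (auto simp: complex_nonpos_Reals_iff)

lemma cubic_period_cnj_upper: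
  assumes "Re z > 0" "Im z > 0"
  shows "cubic_period z = cnj (cubic_period (cnj z))" "cubic_period (1 - z) = cnj (cubic_period (1 - cnj z))"
  using cubic_period_cnj[of "cnj z"] cubic_period_cnj[of "1 - cnj z"] assms
  by (auto simp: complex_nonpos_Reals_iff)

lemma cubic_period_nonzero':
  assumes "Re z > 0" "z \<noteq> 1"
  shows "cubic_period z \<noteq> 0" "cubic_period (1 - z) \<noteq> 0"
proof -
  have "cubic_period z \<noteq> 0 \<and> cubic_period (1 - z) \<noteq> 0"
  proof (cases "Im z \<le> 0")
    case False
    then have "cubic_period (cnj z) \<noteq> 0" "cubic_period (1 - cnj z) \<noteq> 0"
      using cubic_period_nonzero[of "cnj z"] assms by (auto simp: complex_eq_iff)
    then show ?thesis using cubic_period_cnj_upper[of z] assms False by auto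
  qed (use cubic_period_nonzero assms in auto)
  then show "cubic_period z \<noteq> 0" "cubic_period (1 - z) \<noteq> 0" by auto
qed

lemma Re_cubic_ratio_pos:
  assumes "Re z > 0" "z \<noteq> 1"
  shows "Re (cubic_period (1 - z) / cubic_period z) > 0"
proof -
  have low: "Re (cubic_period (1 - z) / cubic_period z) > 0" if z: "Re z > 0" "Im z \<le> 0" "z \<noteq> 1" for z
  proof -
    have nn: "z \<notin> \<real>\<^sub>\<le>\<^sub>0" using z by (auto simp: complex_nonpos_Reals_iff)
    note nz = cubic_period_nonzero[OF z]
    have "0 < 1/2 * (norm (cubic_period (1 - z)) * norm (cubic_period z))" using nz by simp
    also have "\<dots> \<le> Re (cubic_period (1 - z) * cnj (cubic_period z))"
      by (rule cubic_period_ratio_cone(1)[OF z(2) nn z(3)])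
    finally have "0 < Re (cubic_period (1 - z) * cnj (cubic_period z)) / (norm (cubic_period z))\<^sup>2" using nz by simp
    also have "\<dots> = Re (cubic_period (1 - z) * cnj (cubic_period z) / of_real ((norm (cubic_period z))\<^sup>2))"
      by (simp only: Re_divide_of_real)
    also have "cubic_period (1 - z) * cnj (cubic_period z) / of_real ((norm (cubic_period z))\<^sup>2) = cubic_period (1 - z) / cubic_period z"
      by (metis complex_div_cnj of_real_power)
    finally show ?thesis .
  qed
  show ?thesis
  proof (cases "Im z \<le> 0")
    case False
    have "Re (cubic_period (1 - cnj z) / cubic_period (cnj z)) > 0"
      using low[of "cnj z"] assms False by (auto simp: complex_eq_iff)
    also have "Re (cubic_period (1 - cnj z) / cubic_period (cnj z)) = Re (cnj (cubic_period (1 - cnj z) / cubic_period (cnj z)))"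
      by (rule cnj.simps(1)[symmetric])
    also have "cnj (cubic_period (1 - cnj z) / cubic_period (cnj z)) = cubic_period (1 - z) / cubic_period z"
      unfolding complex_cnj_divide using cubic_period_cnj_upper[of z] assms False by simp
    finally show ?thesis .
  qed (use low assms in auto)
qed

lemma Re_cubic_ratio_ge:
  obtains c where "c > 0"
    "\<And>z. Re z \<ge> 1/2 \<Longrightarrow> z \<noteq> 1 \<Longrightarrow> Re (cubic_period (1 - z) / cubic_period z) \<ge> c"
proof -
  obtain c where c: "c > 0" "\<And>z. Re z \<ge> 1/2 \<Longrightarrow> Im z \<le> 0 \<Longrightarrow> z \<noteq> 1 \<Longrightarrow> Re (cubic_period (1 - z) / cubic_period z) \<ge> c"
    by (rule cubic_ratio_Re_lower_bound, rule that)
  show ?thesis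
  proof (rule that[OF c(1)])
    fix z assume z: "Re z \<ge> 1/2" "z \<noteq> 1"
    show "Re (cubic_period (1 - z) / cubic_period z) \<ge> c"
    proof (cases "Im z \<le> 0")
      case False
      have "c \<le> Re (cubic_period (1 - cnj z) / cubic_period (cnj z))"
        using c(2)[of "cnj z"] z False by (auto simp: complex_eq_iff)
      also have "Re (cubic_period (1 - cnj z) / cubic_period (cnj z)) = Re (cnj (cubic_period (1 - cnj z) / cubic_period (cnj z)))"
      by (rule cnj.simps(1)[symmetric])
      also have "cnj (cubic_period (1 - cnj z) / cubic_period (cnj z)) = cubic_period (1 - z) / cubic_period z"
        unfolding complex_cnj_divide using cubic_period_cnj_upper[of z] z False by simp
      finally show ?thesis .
    qed (use c z in auto)
  qed
qed

lemma Im_tau: "Im (\<i> / of_real (sqrt 3) * w) = Re w / sqrt 3"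
proof -
  have "\<i> / of_real (sqrt 3) * w = \<i> * w / of_real (sqrt 3)" by simp
  then show ?thesis by (simp only: Im_divide_of_real) simp
qed

lemma tau_in_uhp: "Re z > 0 \<Longrightarrow> z \<noteq> 1 \<Longrightarrow> tau z \<in> upper_half_plane"
  unfolding upper_half_plane_def mem_Collect_eq Im_tau using Re_cubic_ratio_pos[of z] by simp

text \<open>This is the jump of the period across its cut. Divided by
  \<open>cubic_period (of_real x)\<close> and multiplied by the prefactor
  \<open>\<i> / sqrt 3\<close> of \<open>tau\<close>, the extra term becomes
  \<open>\<i> * \<i> = -1\<close>, so the two boundary values of \<open>tau\<close> differ by
  exactly one translation.\<close>

lemma cubic_period_of_real_gt_1:
  assumes x: "x > 1"
  shows "cnj (cubic_period (of_real (1 - x))) = cubic_period (of_real (1 - x)) + \<i> * of_real (sqrt 3) * cubic_period (of_real x)"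
proof -
  have "cubic_period (of_real x) = of_real (cubic_period_real x)" using x by (intro cubic_period_of_real) auto
  then show ?thesis using Im_cubic_period_cut[OF x] by (simp add: complex_eq_iff)
qed

context fricke_function
begin

definition pullback :: "complex \<Rightarrow> complex" where
  "pullback z = deriv F (tau z) * (z powr of_real (-1/3) * (1 - z) powr of_real (-1/3)) / (cubic_period z)\<^sup>2"

lemma continuous_on_cubic_period_right: "continuous_on {z. Re z > 0} cubic_period"
  by (rule continuous_on_subset[OF holomorphic_on_imp_continuous_on[OF cubic_period_holomorphic]])
     (auto simp: complex_nonpos_Reals_iff)

lemma continuous_on_deriv_F: "continuous_on upper_half_plane (deriv F)"
  by (rule holomorphic_on_imp_continuous_on[OF deriv_F_holomorphic])

text \<open>For \<open>Im z <= 0\<close> the point \<open>1 - z\<close> lies in the closed upper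
  half-plane, where \<open>cubic_period\<close> and \<open>powr\<close> are continuous up to the
  cut.\<close>

lemma pullback_continuous_lower: "continuous_on ({z. Re z > 0} \<inter> {z. Im z \<le> 0} - {1}) pullback"
proof -
  let ?S = "{z. Re z > 0} \<inter> {z. Im z \<le> 0} - {1::complex}"
  have c1: "continuous_on ?S cubic_period" by (rule continuous_on_subset[OF continuous_on_cubic_period_right]) auto
  have c2: "continuous_on ?S (\<lambda>z. cubic_period (1 - z))"
    by (rule continuous_on_compose2[OF continuous_on_cubic_period_upper]) (auto intro!: continuous_intros)
  have c3: "continuous_on ?S (\<lambda>z. (1 - z) powr of_real (-1/3))"
    by (rule continuous_on_compose2[OF continuous_on_powr_upper_half]) (auto intro!: continuous_intros)
  have c4: "continuous_on ?S (\<lambda>z. z powr of_real (-1/3))"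
    by (intro continuous_intros) (auto simp: complex_nonpos_Reals_iff)
  have c5: "continuous_on ?S (\<lambda>z. deriv F (tau z))"
  proof (rule continuous_on_compose2[OF continuous_on_deriv_F])
    show "continuous_on ?S (\<lambda>z. tau z)"
      by (intro continuous_on_mult continuous_on_const continuous_on_divide[OF c2 c1] ballI cubic_period_nonzero'(1)) auto
    show "(\<lambda>z. tau z) ` ?S \<subseteq> upper_half_plane"
      by (intro image_subsetI tau_in_uhp) auto
  qed
  have nz2: "\<forall>z\<in>?S. (cubic_period z)\<^sup>2 \<noteq> 0"
    by (intro ballI power_not_zero cubic_period_nonzero'(1)) auto
  show ?thesis unfolding pullback_def
    by (rule continuous_on_divide[OF continuous_on_mult[OF c5 continuous_on_mult[OF c4 c3]] continuous_on_power[OF c1] nz2])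
qed

text \<open>On the cut \<open>(1, \<infinity>)\<close> the values of \<open>pullback\<close> are its limits from below, while \<open>pullback_upper\<close>
  gives the limits from above. The two values of \<open>tau\<close> differ by \<open>1\<close>, and the multiplier of
  \<open>deriv F\<close> cancels the phase of \<open>(1 - z) powr (-1/3)\<close>.\<close>

definition pullback_upper :: "complex \<Rightarrow> complex" where
  "pullback_upper z = deriv F (\<i> / of_real (sqrt 3) * (cnj (cubic_period (1 - cnj z)) / cubic_period z)) *
     (z powr of_real (-1/3) * cnj ((1 - cnj z) powr of_real (-1/3))) / (cubic_period z)\<^sup>2"

lemma pullback_upper_eq:
  assumes z: "Re z > 0" "Im z \<ge> 0" "z \<noteq> 1"
  shows "pullback_upper z = pullback z"
proof (cases "z \<in> \<real> \<and> Re z > 1")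
  case False
  have nn: "1 - z \<notin> \<real>\<^sub>\<le>\<^sub>0"
  proof
    assume "1 - z \<in> \<real>\<^sub>\<le>\<^sub>0"
    then have "Im z = 0" "Re z \<ge> 1" by (auto simp: complex_nonpos_Reals_iff)
    then show False using False z(3) by (auto simp: complex_is_Real_iff complex_eq_iff)
  qed
  then have nn': "1 - cnj z \<notin> \<real>\<^sub>\<le>\<^sub>0" by (auto simp: complex_nonpos_Reals_iff)
  have "cnj ((1 - cnj z) powr of_real (-1/3)) = (1 - z) powr of_real (-1/3)"
    using cnj_powr[of "1 - cnj z" "of_real (-1/3)"] nn' by (auto simp: complex_nonpos_Reals_iff)
  moreover have "cnj (cubic_period (1 - cnj z)) = cubic_period (1 - z)"
    using cubic_period_cnj[OF nn'] by simp
  ultimately show ?thesis by (simp add: pullback_def pullback_upper_def)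
next
  case True
  define x where "x = Re z"
  have x: "x > 1" "z = of_real x" using True by (auto simp: x_def complex_eq_iff complex_is_Real_iff)
  define w where "w = \<i> / of_real (sqrt 3) * (cnj (cubic_period (1 - cnj z)) / cubic_period z)"
  have nz: "cubic_period z \<noteq> 0" using cubic_period_nonzero' z by auto
  have s3: "complex_of_real (sqrt 3) * of_real (sqrt 3) = 3" by (simp flip: of_real_mult)
  have "cnj (cubic_period (1 - cnj z)) = cubic_period (1 - z) + \<i> * of_real (sqrt 3) * cubic_period z"
    using cubic_period_of_real_gt_1[OF x(1)] x(2) by simp
  then have "cnj (cubic_period (1 - cnj z)) / cubic_period z = cubic_period (1 - z) / cubic_period z + \<i> * of_real (sqrt 3)"
    using nz by (simp add: field_simps)
  then have w: "w + 1 = tau z" unfolding w_def by (simp add: field_simps)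
  have "w + 1 \<in> upper_half_plane" unfolding w using tau_in_uhp[of z] z by simp
  then have wu: "w \<in> upper_half_plane" by (simp add: upper_half_plane_def)
  have A: "deriv F (tau z) = cis (2 * pi / 3) * deriv F w"
    using deriv_F_translate[OF wu] unfolding w multiplier_eq .
  have p: "(1 - z) powr of_real (-1/3) = of_real ((x - 1) powr (-1/3)) * cis (- (pi/3))"
  proof -
    have "(1 - z) powr of_real (-1/3) = of_real (1 - x) powr of_real (-1/3)" by (simp add: x(2))
    also have "\<dots> = of_real ((x - 1) powr (-1/3)) * exp (\<i> * pi * of_real (-1/3))"
      using x(1) by (subst powr_of_real_if) simp
    also have "exp (\<i> * pi * of_real (-1/3)) = cis (- (pi/3))" by (simp add: cis_conv_exp)
    finally show ?thesis .
  qed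
  have q: "cnj ((1 - cnj z) powr of_real (-1/3)) = of_real ((x - 1) powr (-1/3)) * cis (pi/3)"
  proof -
    have cz: "cnj z = z" by (simp add: x(2))
    show ?thesis unfolding cz p by (simp add: cis_cnj)
  qed
  have e: "cis (2 * pi / 3) * cis (- (pi/3)) = cis (pi/3)" by (simp add: cis_mult)
  show ?thesis unfolding pullback_def pullback_upper_def w_def[symmetric] A p q e[symmetric]
    by (simp only: mult_ac)
qed

text \<open>\<open>pullback_upper\<close> evaluates the period and the power at
  \<open>1 - cnj z\<close>, which for \<open>Im z >= 0\<close> is again in the closed upper
  half-plane, so its continuity is clear up to the axis.\<close>

lemma pullback_continuous_upper: "continuous_on ({z. Re z > 0} \<inter> {z. Im z \<ge> 0} - {1}) pullback"
proof -
  let ?S = "{z. Re z > 0} \<inter> {z. Im z \<ge> 0} - {1::complex}"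
  have c1: "continuous_on ?S cubic_period" by (rule continuous_on_subset[OF continuous_on_cubic_period_right]) auto
  have c2: "continuous_on ?S (\<lambda>z. cnj (cubic_period (1 - cnj z)))"
    by (intro continuous_on_cnj, rule continuous_on_compose2[OF continuous_on_cubic_period_upper])
       (auto intro!: continuous_intros simp: complex_eq_iff)
  have c3: "continuous_on ?S (\<lambda>z. cnj ((1 - cnj z) powr of_real (-1/3)))"
    by (intro continuous_on_cnj, rule continuous_on_compose2[OF continuous_on_powr_upper_half])
       (auto intro!: continuous_intros simp: complex_eq_iff)
  have c4: "continuous_on ?S (\<lambda>z. z powr of_real (-1/3))"
    by (intro continuous_intros) (auto simp: complex_nonpos_Reals_iff)
  have im: "\<i> / of_real (sqrt 3) * (cnj (cubic_period (1 - cnj z)) / cubic_period z) \<in> upper_half_plane" if z: "z \<in> ?S" for z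
  proof -
    have "cubic_period z = cnj (cubic_period (cnj z))"
      using cubic_period_cnj[of "cnj z"] z by (auto simp: complex_nonpos_Reals_iff)
    then have "cnj (cubic_period (1 - cnj z)) / cubic_period z = cnj (cubic_period (1 - cnj z) / cubic_period (cnj z))" by simp
    moreover have "Re (cubic_period (1 - cnj z) / cubic_period (cnj z)) > 0"
      using Re_cubic_ratio_pos[of "cnj z"] z by (auto simp: complex_eq_iff)
    ultimately have "Re (cnj (cubic_period (1 - cnj z)) / cubic_period z) > 0" by (simp only: cnj.simps)
    then show ?thesis unfolding upper_half_plane_def mem_Collect_eq Im_tau by simp
  qed
  have nz: "cubic_period z \<noteq> 0" if "z \<in> ?S" for z
    by (rule cubic_period_nonzero'(1)) (use that in auto)
  have c5: "continuous_on ?S (\<lambda>z. deriv F (\<i> / of_real (sqrt 3) * (cnj (cubic_period (1 - cnj z)) / cubic_period z)))"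
  proof (rule continuous_on_compose2[OF continuous_on_deriv_F])
    show "continuous_on ?S (\<lambda>z. \<i> / of_real (sqrt 3) * (cnj (cubic_period (1 - cnj z)) / cubic_period z))"
      by (intro continuous_on_mult continuous_on_const continuous_on_divide[OF c2 c1] ballI nz)
  qed (rule image_subsetI, rule im)
  have nz2: "\<forall>z\<in>?S. (cubic_period z)\<^sup>2 \<noteq> 0" by (intro ballI power_not_zero nz)
  have "continuous_on ?S pullback_upper" unfolding pullback_upper_def
    by (rule continuous_on_divide[OF continuous_on_mult[OF c5 continuous_on_mult[OF c4 c3]] continuous_on_power[OF c1] nz2])
  then show ?thesis by (rule continuous_on_eq) (use pullback_upper_eq in auto)
qed

lemma pullback_holomorphic_off: "pullback holomorphic_on {z. Re z > 0} - \<real>"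
proof -
  let ?S = "{z. Re z > 0} - \<real>"
  have im: "Im z \<noteq> 0" "Re z > 0" if "z \<in> ?S" for z using that by (auto simp: complex_is_Real_iff)
  have h1: "cubic_period holomorphic_on ?S"
    by (rule holomorphic_on_subset[OF cubic_period_holomorphic]) (auto simp: complex_nonpos_Reals_iff)
  have h2: "(\<lambda>z. cubic_period (1 - z)) holomorphic_on ?S"
  proof (rule holomorphic_on_compose_gen[unfolded o_def, OF _ cubic_period_holomorphic])
    show "(\<lambda>z. 1 - z) ` ?S \<subseteq> - \<real>\<^sub>\<le>\<^sub>0"
      by (intro image_subsetI ComplI) (use one_minus_not_nonpos im in blast)
  qed (intro holomorphic_intros)
  have nz: "cubic_period z \<noteq> 0" if "z \<in> ?S" for z
    by (rule cubic_period_nonzero'(1)) (use that in auto)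
  have h5: "(\<lambda>z. deriv F (tau z)) holomorphic_on ?S"
  proof (rule holomorphic_on_compose_gen[unfolded o_def, OF _ deriv_F_holomorphic])
    show "(\<lambda>z. tau z) holomorphic_on ?S"
      by (intro holomorphic_on_mult holomorphic_on_const holomorphic_on_divide[OF h2 h1] nz)
    show "(\<lambda>z. tau z) ` ?S \<subseteq> upper_half_plane"
      by (intro image_subsetI tau_in_uhp) auto
  qed
  have h3: "(\<lambda>z. (1 - z) powr of_real (-1/3)) holomorphic_on ?S"
    by (intro holomorphic_on_powr holomorphic_intros one_minus_not_nonpos im)
  have h4: "(\<lambda>z. z powr of_real (-1/3)) holomorphic_on ?S"
    by (intro holomorphic_intros) (auto simp: complex_nonpos_Reals_iff)
  show ?thesis unfolding pullback_def
    by (intro holomorphic_on_divide[OF holomorphic_on_mult[OF h5 holomorphic_on_mult[OF h4 h3]] holomorphic_on_power[OF h1]] power_not_zero nz)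
qed

text \<open>Off the real axis every factor is holomorphic; continuity across the axis, assembled
  from the two closed quadrants, is enough to paste.\<close>

lemma pullback_holomorphic: "pullback holomorphic_on {z. Re z > 0} - {1}"
proof (rule holomorphic_on_paste_across_line[where d = \<i> and k = 0])
  let ?D = "{z. Re z > 0} - {1::complex}"
  show "open ?D" by (intro open_Diff open_halfspace_Re_gt) auto
  show "pullback holomorphic_on ?D \<inter> {z. \<i> \<bullet> z < 0}" "pullback holomorphic_on ?D \<inter> {z. 0 < \<i> \<bullet> z}"
    by (rule holomorphic_on_subset[OF pullback_holomorphic_off]; auto simp: inner_complex_def complex_is_Real_iff)+
  have e: "?D = ({z. Re z > 0} \<inter> {z. Im z \<le> 0} - {1}) \<union> ({z. Re z > 0} \<inter> {z. Im z \<ge> 0} - {1})" by auto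
  have "continuous_on (({z. Re z > 0} \<inter> {z. Im z \<le> 0} - {1}) \<union> ({z. Re z > 0} \<inter> {z. Im z \<ge> 0} - {1})) pullback"
  proof (rule continuous_on_Un_local[OF _ _ pullback_continuous_lower pullback_continuous_upper])
    have "{z. Re z > 0} \<inter> {z. Im z \<le> 0} - {1} = ?D \<inter> {z. Im z \<le> 0}" by auto
    then show "closedin (top_of_set ({z. Re z > 0} \<inter> {z. Im z \<le> 0} - {1} \<union> ({z. Re z > 0} \<inter> {z. Im z \<ge> 0} - {1}))) ({z. Re z > 0} \<inter> {z. Im z \<le> 0} - {1})"
      unfolding e[symmetric] by (metis closedin_closed_Int closed_halfspace_Im_le)
    have "{z. Re z > 0} \<inter> {z. Im z \<ge> 0} - {1} = ?D \<inter> {z. Im z \<ge> 0}" by auto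
    then show "closedin (top_of_set ({z. Re z > 0} \<inter> {z. Im z \<le> 0} - {1} \<union> ({z. Re z > 0} \<inter> {z. Im z \<ge> 0} - {1}))) ({z. Re z > 0} \<inter> {z. Im z \<ge> 0} - {1})"
      unfolding e[symmetric] by (metis closedin_closed_Int closed_halfspace_Im_ge)
  qed
  then show "continuous_on ?D pullback" unfolding e[symmetric] .
qed auto

lemma tau_one_minus:
  assumes "0 < Re z" "Re z < 1"
  shows "tau (1 - z) = - 1 / (3 * tau z)"
proof -
  have nz: "cubic_period z \<noteq> 0" "cubic_period (1 - z) \<noteq> 0" 
    by (rule cubic_period_nonzero'; use assms in force)+
  have s3: "complex_of_real (sqrt 3) * of_real (sqrt 3) = 3" by (simp flip: of_real_mult)
  define s where "s = complex_of_real (sqrt 3)"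
  have s0: "s \<noteq> 0" "3 = s * s" using s3 by (simp add: s_def, simp only: s_def)
  show ?thesis unfolding s_def[symmetric] s0(2) using nz s0(1) by (simp add: field_simps)
qed

text \<open>The Fricke factor \<open>- 3 * (tau z)\<^sup>2\<close> equals
  \<open>(cubic_period (1 - z) / cubic_period z)\<^sup>2\<close>, exactly what exchanges the two
  denominators; this is the reason for dividing by the square of the period.\<close>

lemma pullback_one_minus:
  assumes z: "0 < Re z" "Re z < 1"
  shows "pullback (1 - z) = pullback z"
proof -
  have nz: "cubic_period z \<noteq> 0" "cubic_period (1 - z) \<noteq> 0" 
    by (rule cubic_period_nonzero'; use z in force)+
  have u: "tau z \<in> upper_half_plane" by (rule tau_in_uhp) (use z in force)+
  have s3: "(complex_of_real (sqrt 3))\<^sup>2 = 3" by (simp flip: of_real_power)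
  have "deriv F (tau (1 - z)) = - 3 * (tau z)\<^sup>2 * deriv F (tau z)"
    unfolding tau_one_minus[OF z] by (rule deriv_F_fricke[OF u])
  also have "- 3 * (tau z)\<^sup>2 = (cubic_period (1 - z))\<^sup>2 / (cubic_period z)\<^sup>2"
    unfolding power_mult_distrib power_divide s3 by simp
  finally show ?thesis unfolding pullback_def using nz by (simp add: field_simps)
qed

end

section \<open>Constancy of the pullback\<close>

lemma cubic_period_lower_bound:
  assumes "Re z > 0" "z \<noteq> 1"
  shows "norm (cubic_period z) \<ge> 3 powr (-4/3) / 2 * (1 + norm z) powr (-1/3)"
proof (cases "Im z \<le> 0")
  case True
  then show ?thesis using cubic_period_lower_bounds(2)[of z] assms by (auto simp: complex_nonpos_Reals_iff)
next
  case False
  have "cnj z \<noteq> 1" using assms(2) by (metis complex_cnj_cnj complex_cnj_one)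
  then have "norm (cubic_period (cnj z)) \<ge> 3 powr (-4/3) / 2 * (1 + norm (cnj z)) powr (-1/3)"
    using cubic_period_lower_bounds(2)[of "cnj z"] assms False by (auto simp: complex_nonpos_Reals_iff)
  moreover have "norm (cubic_period z) = norm (cubic_period (cnj z))"
    using cubic_period_cnj_upper(1)[of z] assms False by (metis complex_mod_cnj not_le)
  ultimately show ?thesis by simp
qed

context fricke_function
begin

text \<open>\<open>deriv F\<close> is bounded because \<open>tau z\<close> stays above the height
  \<open>c / sqrt 3\<close>, and the lower bound on the period accounts for
  \<open>(1 + norm z) powr (2/3)\<close>. The singularity at 1 has order at most \<open>1/3\<close>,
  and at infinity the exponents add up to 0.\<close>

lemma pullback_bound:
  obtains C where "C > 0" "\<And>z. Re z \<ge> 1/2 \<Longrightarrow> z \<noteq> 1 \<Longrightarrow>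
    norm (pullback z) \<le> C * (norm z powr (-1/3) * norm (1 - z) powr (-1/3) * (1 + norm z) powr (2/3))"
proof -
  obtain c where c: "c > 0" "\<And>z. Re z \<ge> 1/2 \<Longrightarrow> z \<noteq> 1 \<Longrightarrow> Re (cubic_period (1 - z) / cubic_period z) \<ge> c"
    by (rule Re_cubic_ratio_ge, rule that)
  obtain B where B: "B > 0" "\<And>\<tau>. Im \<tau> \<ge> c / sqrt 3 \<Longrightarrow> norm (deriv F \<tau>) \<le> B"
    by (rule deriv_F_bounded[of "c / sqrt 3"], use c(1) in simp, rule that)
  define k where "k = (3::real) powr (-4/3) / 2"
  have k: "k > 0" by (simp add: k_def)
  show ?thesis
  proof (rule that[of "B / k\<^sup>2"])
    show "B / k\<^sup>2 > 0" using B k by simp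
    fix z assume z: "Re z \<ge> 1/2" "z \<noteq> 1"
    have f: "norm (deriv F (tau z)) \<le> B"
      by (rule B(2)) (unfold Im_tau, intro divide_right_mono c(2) z, simp)
    define N where "N = norm (cubic_period z)"
    have N: "k * (1 + norm z) powr (-1/3) \<le> N" using cubic_period_lower_bound[of z] z by (simp add: N_def k_def)
    have p: "(1 + norm z) powr (-1/3) > 0" using norm_ge_zero[of z] by (subst powr_gt_zero) linarith
    then have kp: "k * (1 + norm z) powr (-1/3) > 0" using k by simp
    have "(k * (1 + norm z) powr (-1/3))\<^sup>2 \<le> N\<^sup>2" using N kp by (intro power_mono) auto
    moreover have "(k * (1 + norm z) powr (-1/3))\<^sup>2 = k\<^sup>2 * (1 + norm z) powr (-2/3)"
      unfolding power_mult_distrib by (simp add: power2_eq_square flip: powr_add)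
    ultimately have N2: "k\<^sup>2 * (1 + norm z) powr (-2/3) \<le> N\<^sup>2" by simp
    have p2: "(1 + norm z) powr (-2/3) > 0" using norm_ge_zero[of z] by (subst powr_gt_zero) linarith
    have n1: "norm (z powr of_real (-1/3)) = norm z powr (-1/3)" "norm ((1 - z) powr of_real (-1/3)) = norm (1 - z) powr (-1/3)"
      by (subst norm_powr_real_powr'; simp)+
    have "norm (pullback z) = norm (deriv F (tau z)) * (norm z powr (-1/3) * norm (1 - z) powr (-1/3)) / N\<^sup>2"
      unfolding pullback_def norm_divide norm_mult norm_power n1 N_def ..
    also have "\<dots> \<le> B * (norm z powr (-1/3) * norm (1 - z) powr (-1/3)) / (k\<^sup>2 * (1 + norm z) powr (-2/3))"
    proof (rule frac_le)
      show "0 \<le> B * (norm z powr (-1/3) * norm (1 - z) powr (-1/3))" using B(1) by (simp add: mult_nonneg_nonneg)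
      show "norm (deriv F (tau z)) * (norm z powr (-1/3) * norm (1 - z) powr (-1/3))
        \<le> B * (norm z powr (-1/3) * norm (1 - z) powr (-1/3))"
        by (rule mult_right_mono[OF f]) (simp add: mult_nonneg_nonneg)
      show "0 < k\<^sup>2 * (1 + norm z) powr (-2/3)" using k p2 by simp
    qed (rule N2)
    also have "\<dots> = B / k\<^sup>2 * (norm z powr (-1/3) * norm (1 - z) powr (-1/3) * (1 + norm z) powr (2/3))"
      by (simp add: powr_minus field_simps)
    finally show "norm (pullback z) \<le> B / k\<^sup>2 * (norm z powr (-1/3) * norm (1 - z) powr (-1/3) * (1 + norm z) powr (2/3))" .
  qed
qed

text \<open>\<open>H\<close> glues \<open>pullback\<close> to its mirror image under
  \<open>z -> 1 - z\<close>. Both agree on the strip \<open>0 < Re z < 1\<close>, so 0 and 1 are the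
  only singularities left, and the symmetry transfers everything proved at 1 to 0.\<close>

lemma pullback_constant:
  obtains h0 where "\<And>z. Re z > 0 \<Longrightarrow> z \<noteq> 1 \<Longrightarrow> pullback z = h0"
proof -
  obtain C where C: "C > 0" "\<And>z. Re z \<ge> 1/2 \<Longrightarrow> z \<noteq> 1 \<Longrightarrow>
    norm (pullback z) \<le> C * (norm z powr (-1/3) * norm (1 - z) powr (-1/3) * (1 + norm z) powr (2/3))"
    by (rule pullback_bound, rule that)
  define H where "H = (\<lambda>z. if Re z > 0 then pullback z else pullback (1 - z))"
  have Hsym: "H (1 - z) = H z" for z
  proof -
    consider "0 < Re z" "Re z < 1" | "Re z \<ge> 1" | "Re z \<le> 0" by linarith
    then show ?thesis by cases (simp_all add: H_def pullback_one_minus)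
  qed
  have H1: "H z = pullback z" if "Re z > 0" for z using that by (simp add: H_def)
  have H2: "H z = pullback (1 - z)" if "Re z < 1" for z using Hsym[of z] H1[of "1 - z"] that by simp
  have holH: "H holomorphic_on ({z. Re z > 0} - {1}) \<union> ({z. Re z < 1} - {0})"
  proof (rule holomorphic_on_Un)
    show "H holomorphic_on {z. Re z > 0} - {1}"
      by (rule holomorphic_transform[OF pullback_holomorphic]) (simp add: H1)
    have "(\<lambda>z. pullback (1 - z)) holomorphic_on {z. Re z < 1} - {0}"
      by (rule holomorphic_on_compose_gen[unfolded o_def, OF _ pullback_holomorphic])
         (auto intro!: holomorphic_intros)
    then show "H holomorphic_on {z. Re z < 1} - {0}"
      by (rule holomorphic_transform) (simp add: H2)
  qed (auto intro!: open_Diff open_halfspace_Re_gt open_halfspace_Re_lt)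
  have sets: "- {0} - {1} = ({z. Re z > 0} - {1}) \<union> ({z. Re z < 1} - {0::complex})" by auto
  \<comment> \<open>Within distance \<open>1/2\<close> of 1 the real part is at least
    \<open>1/2\<close>, so \<open>pullback_bound\<close> applies; the exponent
    \<open>1 - 1/3\<close> is positive, which is the criterion for a removable singularity.\<close>
  have lim1: "((\<lambda>z. (z - 1) * H z) \<longlongrightarrow> 0) (at 1)"
  proof (rule Lim_null_comparison)
    define K where "K = C * ((1/2) powr (-1/3) * (5/2) powr (2/3))"
    show "eventually (\<lambda>z. norm ((z - 1) * H z) \<le> K * norm (z - 1) powr (2/3)) (at (1::complex))"
      unfolding eventually_at
    proof (intro exI conjI ballI impI)
      show "(1/2::real) > 0" by simp
      fix z :: complex assume zz: "z \<noteq> 1 \<and> dist z 1 < 1/2"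
      then have z: "z \<noteq> 1" "norm (z - 1) < 1/2" by (auto simp: dist_norm)
      have re: "Re z \<ge> 1/2" using abs_Re_le_cmod[of "z - 1"] z by simp
      have n: "norm z \<ge> 1/2" "norm z \<le> 3/2"
        using re complex_Re_le_cmod[of z] norm_triangle_ineq2[of z 1] z by auto
      have "norm (H z) \<le> C * (norm z powr (-1/3) * norm (1 - z) powr (-1/3) * (1 + norm z) powr (2/3))"
        using C(2)[OF re z(1)] H1[of z] re by simp
      also have "\<dots> \<le> C * ((1/2) powr (-1/3) * norm (1 - z) powr (-1/3) * (5/2) powr (2/3))"
      proof -
        have a: "norm z powr (-1/3) \<le> (1/2) powr (-1/3)" by (rule powr_mono2') (use n in auto)
        have b: "(1 + norm z) powr (2/3) \<le> (5/2) powr (2/3)" by (rule powr_mono2) (use n in auto)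
        have "norm z powr (-1/3) * norm (1 - z) powr (-1/3) * (1 + norm z) powr (2/3)
          \<le> (1/2) powr (-1/3) * norm (1 - z) powr (-1/3) * (5/2) powr (2/3)"
          by (rule mult_mono[OF mult_right_mono[OF a] b]) (auto intro: mult_nonneg_nonneg)
        then show ?thesis using C(1) by (simp only: mult_le_cancel_left_pos)
      qed
      also have "\<dots> = K * norm (z - 1) powr (-1/3)" by (simp add: K_def norm_minus_commute)
      finally have "norm (z - 1) * norm (H z) \<le> norm (z - 1) * (K * norm (z - 1) powr (-1/3))"
        by (intro mult_left_mono) auto
      also have "\<dots> = K * (norm (z - 1) powr 1 * norm (z - 1) powr (-1/3))" by simp
      also have "norm (z - 1) powr 1 * norm (z - 1) powr (-1/3) = norm (z - 1) powr (2/3)"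
        unfolding powr_add[symmetric] by simp
      finally show "norm ((z - 1) * H z) \<le> K * norm (z - 1) powr (2/3)" by (simp add: norm_mult)
    qed
    have "((\<lambda>z::complex. norm (z - 1)) \<longlongrightarrow> norm (1 - 1 :: complex)) (at 1)" by (intro tendsto_intros)
    then have "((\<lambda>z::complex. norm (z - 1)) \<longlongrightarrow> 0) (at 1)" by simp
    then have "((\<lambda>z::complex. norm (z - 1) powr (2/3)) \<longlongrightarrow> 0) (at 1)"
      by (intro tendsto_zero_powrI[where b = "2/3"]) auto
    then show "((\<lambda>z::complex. K * norm (z - 1) powr (2/3)) \<longlongrightarrow> 0) (at 1)" by (rule tendsto_mult_right_zero)
  qed
  have lim0: "((\<lambda>z. (z - 0) * H z) \<longlongrightarrow> 0) (at 0)"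
  proof -
    have "filterlim (\<lambda>z::complex. 1 - z) (at 1) (at 0)"
      unfolding filterlim_at by (auto intro!: tendsto_eq_intros simp: eventually_at exI[of _ 1])
    from filterlim_compose[OF lim1 this] have "((\<lambda>z. (1 - z - 1) * H (1 - z)) \<longlongrightarrow> 0) (at 0)" .
    then have "((\<lambda>z. - ((1 - z - 1) * H (1 - z))) \<longlongrightarrow> - 0) (at 0)" by (rule tendsto_minus)
    then show ?thesis by (simp add: Hsym)
  qed
  have "\<exists>g. g holomorphic_on - {0} \<and> (\<forall>z\<in>- {0} - {1}. g z = H z)"
  proof (subst holomorphic_on_extend_lim)
    show "H holomorphic_on - {0} - {1}" unfolding sets by (rule holH)
    show "1 \<in> interior (- {0 :: complex})" by (simp add: interior_open open_Compl)
  qed (rule lim1)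
  then obtain g1 where g1: "g1 holomorphic_on - {0}" "\<And>z. z \<noteq> 0 \<Longrightarrow> z \<noteq> 1 \<Longrightarrow> g1 z = H z" by auto
  have "\<exists>g. g holomorphic_on UNIV \<and> (\<forall>z\<in>UNIV - {0}. g z = g1 z)"
  proof (subst holomorphic_on_extend_lim)
    show "g1 holomorphic_on UNIV - {0}" using g1(1) by (simp add: Compl_eq_Diff_UNIV)
    have "eventually (\<lambda>z. (z - 0) * H z = (z - 0) * g1 z) (at (0::complex))"
      unfolding eventually_at
    proof (intro exI[of _ 1] conjI ballI impI)
      fix z :: complex assume z: "z \<noteq> 0 \<and> dist z 0 < 1"
      then have "z \<noteq> 1" by auto
      then show "(z - 0) * H z = (z - 0) * g1 z" using g1(2)[of z] z by simp
    qed simp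
    from tendsto_cong[OF this] lim0 show "((\<lambda>z. (z - 0) * g1 z) \<longlongrightarrow> 0) (at 0)" by (rule iffD1)
  qed auto
  then obtain g where g: "g holomorphic_on UNIV" "\<And>z. z \<noteq> 0 \<Longrightarrow> g z = g1 z" by auto
  have gH: "g z = H z" if "z \<noteq> 0" "z \<noteq> 1" for z using g(2) g1(2) that by simp
  \<comment> \<open>For \<open>norm z >= 2\<close> all bases are comparable to
    \<open>norm z\<close>; its powers cancel, and the remaining
    \<open>2 powr (1/3) * 2 powr (2/3)\<close> is the factor 2.\<close>
  have far: "norm (H z) \<le> C * 2" if z: "Re z \<ge> 1/2" "norm z \<ge> 2" for z
  proof -
    have z1: "z \<noteq> 1" using z by auto
    have n: "norm (1 - z) \<ge> norm z / 2" using norm_triangle_ineq2[of z 1] z by (simp add: norm_minus_commute)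
    define m where "m = norm z"
    have m: "m \<ge> 2" using z by (simp add: m_def)
    have "norm (H z) \<le> C * (m powr (-1/3) * norm (1 - z) powr (-1/3) * (1 + m) powr (2/3))"
      using C(2)[OF z(1) z1] H1[of z] z(1) by (simp add: m_def)
    also have "\<dots> \<le> C * (m powr (-1/3) * (m/2) powr (-1/3) * (2 * m) powr (2/3))"
    proof -
      have a: "norm (1 - z) powr (-1/3) \<le> (m/2) powr (-1/3)" by (rule powr_mono2') (use n m in \<open>auto simp: m_def\<close>)
      have b: "(1 + m) powr (2/3) \<le> (2 * m) powr (2/3)" by (rule powr_mono2) (use m in auto)
      have "m powr (-1/3) * norm (1 - z) powr (-1/3) * (1 + m) powr (2/3)
        \<le> m powr (-1/3) * (m/2) powr (-1/3) * (2 * m) powr (2/3)"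
        by (rule mult_mono[OF mult_left_mono[OF a] b]) (use m in \<open>auto intro: mult_nonneg_nonneg\<close>)
      then show ?thesis using C(1) by (simp only: mult_le_cancel_left_pos)
    qed
    also have "m powr (-1/3) * (m/2) powr (-1/3) * (2 * m) powr (2/3) = 2"
    proof -
      have a: "m powr (-1/3) * m powr (-1/3) * m powr (2/3) = 1" using m unfolding powr_add[symmetric] by simp
      have b: "(1/2::real) powr (-1/3) = 2 powr (1/3)" by (simp add: powr_divide powr_minus)
      have c: "(2::real) powr (1/3) * 2 powr (2/3) = 2" unfolding powr_add[symmetric] by simp
      have "(m/2) powr (-1/3) = m powr (-1/3) * (1/2) powr (-1/3)" unfolding powr_mult[symmetric] by simp
      then have "m powr (-1/3) * (m/2) powr (-1/3) * (2 * m) powr (2/3) =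
        (m powr (-1/3) * m powr (-1/3) * m powr (2/3)) * (2 powr (1/3) * 2 powr (2/3))"
        unfolding b by (simp add: powr_mult mult_ac)
      then show ?thesis unfolding a c by simp
    qed
    finally show ?thesis .
  qed
  have "compact (g ` cball 0 3)"
    by (intro compact_continuous_image continuous_on_subset[OF holomorphic_on_imp_continuous_on[OF g(1)]]) auto
  then have "bounded (g ` cball 0 3)" by (rule compact_imp_bounded)
  then obtain B where B: "\<forall>x\<in>g ` cball 0 3. norm x \<le> B" unfolding bounded_iff by (rule exE)
  have "bounded (range g)"
    unfolding bounded_iff
  proof (intro exI ballI)
    fix y assume "y \<in> range g"
    then obtain z where y: "y = g z" by auto
    show "norm y \<le> max B (C * 2)"
    \<comment> \<open>One of \<open>z\<close> and \<open>1 - z\<close> has real part at least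
      \<open>1/2\<close>; the radius 3 guarantees \<open>norm (1 - z) >= 2\<close> when the
      reflected point is the one to use.\<close>
    proof (cases "norm z \<le> 3")
      case True
      then show ?thesis using B y by (simp add: le_max_iff_disj)
    next
      case False
      then have gz: "g z = H z" by (intro gH) auto
      have "norm (H z) \<le> C * 2"
      proof (cases "Re z \<ge> 1/2")
        case True
        then show ?thesis using far False by simp
      next
        case 2: False
        have "norm (1 - z) \<ge> 2" using norm_triangle_ineq2[of z 1] False by (simp add: norm_minus_commute)
        then have "norm (H (1 - z)) \<le> C * 2" using 2 by (intro far) auto
        then show ?thesis by (simp add: Hsym)
      qed
      then show ?thesis using y gz by (simp add: le_max_iff_disj)
    qed
  qed
  then obtain h0 where h0: "\<And>z. g z = h0" using Liouville_theorem[OF g(1)] by (auto simp: constant_on_def)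
  show ?thesis
  proof (rule that[of h0])
    fix z assume z: "Re z > 0" "z \<noteq> 1"
    then have "z \<noteq> 0" by auto
    then show "pullback z = h0" using h0[of z] gH[of z] H1[of z] z by simp
  qed
qed

section \<open>The approach to the cusp and the exponent\<close>

lemma tau_of_real:
  assumes "0 < x" "x < 1"
  shows "tau (of_real x) = \<i> * of_real (cubic_period_real (1 - x) / (sqrt 3 * cubic_period_real x))"
proof -
  have "cubic_period (1 - of_real x) = of_real (cubic_period_real (1 - x))"
    using cubic_period_of_real[of "1 - x"] assms by simp
  then show ?thesis using cubic_period_of_real[of x] assms by simp
qed

text \<open>\<open>75/1000\<close> is \<open>13/100\<close> divided by the upper bound
  \<open>1.733\<close> for \<open>sqrt 3\<close>, rounded down.\<close>

lemma Im_tau_of_real_ge: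
  assumes "0 < \<epsilon>" "\<epsilon> \<le> 1/2"
  shows "Im (tau (of_real (1 - \<epsilon>))) \<ge> 75/1000 * ln (1 / \<epsilon>)"
proof -
  have l: "ln (1 / \<epsilon>) \<ge> 0" using assms by simp
  have "sqrt 3 \<le> 1.733" by (rule real_le_lsqrt) (auto simp: power2_eq_square)
  then have "75/1000 * sqrt 3 \<le> 13/100" by simp
  then have "75/1000 * sqrt 3 * ln (1 / \<epsilon>) \<le> 13/100 * ln (1 / \<epsilon>)" using l by (rule mult_right_mono)
  also have "\<dots> \<le> cubic_period_real \<epsilon> / cubic_period_real (1 - \<epsilon>)"
    by (rule cubic_ratio_log_lower_bound[OF assms])
  finally have "75/1000 * ln (1 / \<epsilon>) \<le> (cubic_period_real \<epsilon> / cubic_period_real (1 - \<epsilon>)) / sqrt 3"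
    by (subst pos_le_divide_eq) (simp, simp only: mult_ac)
  also have "\<dots> = Im (tau (of_real (1 - \<epsilon>)))"
    using tau_of_real[of "1 - \<epsilon>"] assms by (simp add: mult.commute)
  finally show ?thesis .
qed

lemma Im_tau_at_right_0: "filterlim (\<lambda>\<epsilon>. Im (tau (of_real (1 - \<epsilon>)))) at_top (at_right 0)"
proof (rule filterlim_at_top_mono)
  show "filterlim (\<lambda>\<epsilon>::real. 75/1000 * ln (1 / \<epsilon>)) at_top (at_right 0)" by real_asymp
  show "eventually (\<lambda>\<epsilon>. 75/1000 * ln (1 / \<epsilon>) \<le> Im (tau (of_real (1 - \<epsilon>)))) (at_right 0)"
    using Im_tau_of_real_ge by (intro eventually_at_rightI[of 0 "1/2"]) auto
qed

text \<open>If \<alpha> >= 4/3, the decay of \<open>deriv F\<close> in the height of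
  \<open>tau (1 - \<epsilon>)\<close> is a power of \<epsilon> that beats the singular factor
  \<open>\<epsilon> powr (-1/3)\<close>. The constant value of \<open>pullback\<close> is then 0,
  and \<open>deriv F\<close> would vanish at \<open>tau (1/2)\<close>.\<close>

lemma alpha_eq: "\<alpha> = 1/3"
proof (rule ccontr)
  assume "\<alpha> \<noteq> 1/3"
  then have al: "\<alpha> \<ge> 4/3" using alpha_cases by simp
  obtain h0 where h0: "\<And>z. Re z > 0 \<Longrightarrow> z \<noteq> 1 \<Longrightarrow> pullback z = h0"
    by (rule pullback_constant, rule that)
  obtain Y C where Y: "C \<ge> 0" "Y > 0" "\<And>\<tau>. Im \<tau> \<ge> Y \<Longrightarrow> norm (deriv F \<tau>) \<le> C * exp (- 2 * pi * \<alpha> * Im \<tau>)"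
    by (rule deriv_F_decay, rule that)
  define k where "k = (3::real) powr (-4/3) / 2 * 2 powr (-1/3)"
  have k: "k > 0" by (simp add: k_def)
  define K where "K = C * 2 powr (1/3) / k\<^sup>2"
  have "eventually (\<lambda>\<epsilon>. norm h0 \<le> K * \<epsilon> powr (1/4)) (at_right 0)"
  proof -
    have "eventually (\<lambda>\<epsilon>. Im (tau (of_real (1 - \<epsilon>))) \<ge> Y) (at_right 0)"
      using Im_tau_at_right_0 by (simp add: filterlim_at_top)
    moreover have "eventually (\<lambda>\<epsilon>::real. 0 < \<epsilon> \<and> \<epsilon> \<le> 1/2) (at_right 0)"
      by (intro eventually_at_rightI[of 0 "1/2"]) auto
    ultimately show ?thesis
    proof eventually_elim
      case (elim \<epsilon>)
      then have e: "0 < \<epsilon>" "\<epsilon> \<le> 1/2" by auto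
      define z where "z = complex_of_real (1 - \<epsilon>)"
      have z: "Re z > 0" "z \<noteq> 1" "norm z = 1 - \<epsilon>"
        using e by (auto simp: z_def complex_eq_iff simp del: of_real_diff)
      have "1 - z = of_real \<epsilon>" by (simp add: z_def)
      then have z4: "norm (1 - z) = \<epsilon>" using e by simp
      have "- 2 * pi * \<alpha> * Im (tau z) \<le> - (7/12) * ln (1 / \<epsilon>)"
      proof -
        \<comment> \<open>From \<open>pi * \<alpha> >= 4\<close> the right side is at least
          \<open>6/10\<close>. The value \<open>7/12\<close> lies just below and is convenient
          because \<open>7/12 - 1/3 = 1/4\<close>.\<close>
        have "7/12 \<le> 2 * pi * \<alpha> * (75/1000)"
        proof -
          have "3 * (4/3) \<le> pi * \<alpha>" using al pi_gt3 by (intro mult_mono) auto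
          then show ?thesis by simp
        qed
        then have "7/12 * ln (1 / \<epsilon>) \<le> 2 * pi * \<alpha> * (75/1000) * ln (1 / \<epsilon>)"
          using e by (intro mult_right_mono) auto
        also have "\<dots> \<le> 2 * pi * \<alpha> * Im (tau z)"
          unfolding mult.assoc[of _ "75/1000"] z_def using Im_tau_of_real_ge[OF e] al by (intro mult_left_mono) auto
        finally show ?thesis by simp
      qed
      then have "exp (- 2 * pi * \<alpha> * Im (tau z)) \<le> exp (- (7/12) * ln (1 / \<epsilon>))" by simp
      also have "\<dots> = \<epsilon> powr (7/12)" using e by (simp add: powr_def ln_div)
      finally have "C * exp (- 2 * pi * \<alpha> * Im (tau z)) \<le> C * \<epsilon> powr (7/12)" using Y(1) by (rule mult_left_mono)
      then have f: "norm (deriv F (tau z)) \<le> C * \<epsilon> powr (7/12)" using Y(3)[of "tau z"] elim unfolding z_def by linarith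
      have "2 powr (-1/3) \<le> (1 + norm z) powr (-1/3)" using z(3) e by (intro powr_mono2') auto
      then have "k \<le> 3 powr (-4/3) / 2 * (1 + norm z) powr (-1/3)" unfolding k_def by (intro mult_left_mono) auto
      also have "\<dots> \<le> norm (cubic_period z)" by (rule cubic_period_lower_bound[OF z(1,2)])
      finally have N: "k\<^sup>2 \<le> (norm (cubic_period z))\<^sup>2" using k by (intro power_mono) auto
      have n1: "norm (z powr of_real (-1/3)) = norm z powr (-1/3)" "norm ((1 - z) powr of_real (-1/3)) = norm (1 - z) powr (-1/3)"
        by (subst norm_powr_real_powr'; simp)+
      have "(1 - \<epsilon>) powr (-1/3) \<le> (1/2) powr (-1/3)" using e by (intro powr_mono2') auto
      also have "(1/2::real) powr (-1/3) = 2 powr (1/3)" by (simp add: powr_divide powr_minus)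
      finally have p: "(1 - \<epsilon>) powr (-1/3) \<le> 2 powr (1/3)" .
      have "norm h0 = norm (pullback z)" using h0[OF z(1,2)] by simp
      also have "\<dots> = norm (deriv F (tau z)) * ((1 - \<epsilon>) powr (-1/3) * \<epsilon> powr (-1/3)) / (norm (cubic_period z))\<^sup>2"
        unfolding pullback_def norm_divide norm_mult norm_power n1 z(3) z4 ..
      also have "\<dots> \<le> (C * \<epsilon> powr (7/12)) * (2 powr (1/3) * \<epsilon> powr (-1/3)) / k\<^sup>2"
      proof (rule frac_le)
        show "norm (deriv F (tau z)) * ((1 - \<epsilon>) powr (-1/3) * \<epsilon> powr (-1/3))
          \<le> C * \<epsilon> powr (7/12) * (2 powr (1/3) * \<epsilon> powr (-1/3))"
          by (rule mult_mono[OF f mult_right_mono[OF p]]) (use Y(1) in \<open>auto intro: mult_nonneg_nonneg\<close>)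
      qed (use N k Y(1) in \<open>auto intro: mult_nonneg_nonneg\<close>)
      also have "\<dots> = K * (\<epsilon> powr (7/12) * \<epsilon> powr (-1/3))" by (simp add: K_def)
      also have "\<epsilon> powr (7/12) * \<epsilon> powr (-1/3) = \<epsilon> powr (1/4)" unfolding powr_add[symmetric] by simp
      finally show ?case .
    qed
  qed
  moreover have "((\<lambda>\<epsilon>. K * \<epsilon> powr (1/4)) \<longlongrightarrow> 0) (at_right 0)" by real_asymp
  ultimately have "norm h0 \<le> 0" by (intro tendsto_lowerbound) auto
  then have "pullback (1/2) = 0" using h0[of "1/2"] by simp
  moreover have "cubic_period (1/2) \<noteq> 0" using cubic_period_nonzero'(1)[of "1/2"] by simp
  ultimately have "deriv F (tau (1/2)) = 0" by (simp add: pullback_def)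
  moreover have "tau (1/2) \<in> upper_half_plane" by (rule tau_in_uhp) auto
  ultimately show False using nonvanishing by blast
qed

text \<open>Constancy of \<open>pullback\<close> makes \<open>deriv F (tau z)\<close> proportional
  to \<open>(cubic_period z)\<^sup>2\<close>, and the Wronskian puts the same square into the
  denominator of the derivative of \<open>tau\<close>. It cancels, and the exponents
  \<open>1/3\<close> and \<open>-1\<close> of \<open>z * (1 - z)\<close> combine to
  \<open>-2/3\<close>.\<close>

lemma F_tau_deriv:
  obtains c where "\<And>x. 0 < x \<Longrightarrow> x < 1 \<Longrightarrow>
    ((\<lambda>x. F (tau (of_real x))) has_vector_derivative c * of_real (x powr (-2/3) * (1 - x) powr (-2/3))) (at x)"
proof -
  obtain h0 where h0: "\<And>z. Re z > 0 \<Longrightarrow> z \<noteq> 1 \<Longrightarrow> pullback z = h0"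
    by (rule pullback_constant, rule that)
  obtain c where c: "\<And>z. 0 < Re z \<Longrightarrow> Re z < 1 \<Longrightarrow> cubic_period z \<noteq> 0 \<Longrightarrow>
    ((\<lambda>z. cubic_period (1 - z) / cubic_period z) has_field_derivative c / (z * (1 - z) * (cubic_period z)\<^sup>2)) (at z)"
    by (rule cubic_ratio_deriv, rule that)
  show ?thesis
  proof (rule that[of "\<i> / of_real (sqrt 3) * c * h0"])
    fix x :: real assume x: "0 < x" "x < 1"
    define z where "z = complex_of_real x"
    have z: "0 < Re z" "Re z < 1" "z \<noteq> 1" "z \<noteq> 0" "1 - z \<noteq> 0" using x by (auto simp: z_def complex_eq_iff)
    have nz: "cubic_period z \<noteq> 0" using cubic_period_nonzero'(1) z by blast
    have u: "tau z \<in> upper_half_plane" using tau_in_uhp z by blast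
    have d1: "((\<lambda>z. tau z) has_field_derivative \<i> / of_real (sqrt 3) * (c / (z * (1 - z) * (cubic_period z)\<^sup>2))) (at z)"
      by (rule DERIV_cmult[OF c[OF z(1,2) nz]])
    have "((\<lambda>z. F (tau z)) has_field_derivative deriv F (tau z) * (\<i> / of_real (sqrt 3) * (c / (z * (1 - z) * (cubic_period z)\<^sup>2)))) (at z)"
      by (rule DERIV_chain2[of F "deriv F (tau z)" "\<lambda>z. tau z", OF F_deriv[OF u] d1])
    then have v: "((\<lambda>x. F (tau (of_real x))) has_vector_derivative deriv F (tau z) * (\<i> / of_real (sqrt 3) * (c / (z * (1 - z) * (cubic_period z)\<^sup>2)))) (at x)"
      unfolding z_def by (rule has_vector_derivative_real_field)
    define p where "p = z powr of_real (-1/3) * (1 - z) powr of_real (-1/3)"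
    have p: "p = of_real (x powr (-1/3) * (1 - x) powr (-1/3))"
      using powr_of_real[of x "-1/3"] powr_of_real[of "1 - x" "-1/3"] x by (simp add: p_def z_def)
    have p0: "p \<noteq> 0" unfolding p using x by simp
    have "deriv F (tau z) * p / (cubic_period z)\<^sup>2 = h0" using h0[OF z(1,3)] by (simp only: pullback_def p_def)
    then have "deriv F (tau z) / (cubic_period z)\<^sup>2 = h0 / p" using p0 nz by (simp add: field_simps)
    moreover have "deriv F (tau z) * (\<i> / of_real (sqrt 3) * (c / (z * (1 - z) * (cubic_period z)\<^sup>2)))
      = \<i> / of_real (sqrt 3) * c * (deriv F (tau z) / (cubic_period z)\<^sup>2) * (1 / (z * (1 - z)))"
      by (simp only: times_divide_eq_left times_divide_eq_right divide_divide_eq_left mult_ac mult_1_left mult_1_right)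
    ultimately have "deriv F (tau z) * (\<i> / of_real (sqrt 3) * (c / (z * (1 - z) * (cubic_period z)\<^sup>2)))
      = \<i> / of_real (sqrt 3) * c * h0 * (1 / (p * (z * (1 - z))))"
      by (simp only: times_divide_eq_left times_divide_eq_right divide_divide_eq_left mult_ac mult_1_left mult_1_right)
    also have "1 / (p * (z * (1 - z))) = of_real (x powr (-2/3) * (1 - x) powr (-2/3))"
    proof -
      have "p * (z * (1 - z)) = of_real ((x powr (-1/3) * x powr 1) * ((1 - x) powr (-1/3) * (1 - x) powr 1))"
        unfolding p z_def using x by simp
      also have "(x powr (-1/3) * x powr 1) * ((1 - x) powr (-1/3) * (1 - x) powr 1) = x powr (2/3) * (1 - x) powr (2/3)"
        unfolding powr_add[symmetric] by simp
      finally have "1 / (p * (z * (1 - z))) = of_real (1 / (x powr (2/3) * (1 - x) powr (2/3)))" by simp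
      then show ?thesis by (simp add: powr_minus_divide)
    qed
    finally show "((\<lambda>x. F (tau (of_real x))) has_vector_derivative
        \<i> / of_real (sqrt 3) * c * h0 * of_real (x powr (-2/3) * (1 - x) powr (-2/3))) (at x)" using v by simp
  qed
qed

text \<open>Towards the end 1 the point \<open>tau x\<close> climbs the imaginary axis into the
  cusp, where \<open>F\<close> decays; the Fricke relation carries this limit to the end 0.\<close>

lemma F_tau_limits:
  "((\<lambda>x. F (tau (of_real (1 - x)))) \<longlongrightarrow> 0) (at_right 0)"
  "((\<lambda>x. F (tau (of_real x))) \<longlongrightarrow> 1) (at_right 0)"
proof -
  obtain Y C where Y: "C \<ge> 0" "Y > 0" "\<And>\<tau>. Im \<tau> \<ge> Y \<Longrightarrow> norm (F \<tau>) \<le> C * exp (- 2 * pi * \<alpha> * Im \<tau>)"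
    by (rule F_decay, rule that)
  show lim: "((\<lambda>x. F (tau (of_real (1 - x)))) \<longlongrightarrow> 0) (at_right 0)"
  proof (rule Lim_null_comparison)
    have "eventually (\<lambda>\<epsilon>. Im (tau (of_real (1 - \<epsilon>))) \<ge> Y) (at_right 0)"
      using Im_tau_at_right_0 by (simp add: filterlim_at_top)
    then show "eventually (\<lambda>\<epsilon>. norm (F (tau (of_real (1 - \<epsilon>)))) \<le> C * exp (- 2 * pi * \<alpha> * Im (tau (of_real (1 - \<epsilon>))))) (at_right 0)"
      by (rule eventually_mono) (rule Y(3))
    have "((\<lambda>t. C * exp (- 2 * pi * \<alpha> * t)) \<longlongrightarrow> 0) at_top" unfolding alpha_eq by real_asymp
    from filterlim_compose[OF this Im_tau_at_right_0]
    show "((\<lambda>\<epsilon>. C * exp (- 2 * pi * \<alpha> * Im (tau (of_real (1 - \<epsilon>))))) \<longlongrightarrow> 0) (at_right 0)" .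
  qed
  have "((\<lambda>x. 1 - F (tau (of_real (1 - x)))) \<longlongrightarrow> 1 - 0) (at_right 0)" by (intro tendsto_intros lim)
  moreover have "eventually (\<lambda>x. 1 - F (tau (of_real (1 - x))) = F (tau (of_real x))) (at_right 0)"
  proof (rule eventually_at_rightI[of 0 1])
    fix x :: real assume x: "x \<in> {0<..<1}"
    have "tau (1 - of_real (1 - x)) = - 1 / (3 * tau (of_real (1 - x)))"
      by (rule tau_one_minus) (use x in auto)
    moreover have "tau (of_real (1 - x)) \<in> upper_half_plane" by (rule tau_in_uhp) (use x in \<open>auto simp: complex_eq_iff\<close>)
    moreover have "1 - of_real (1 - x) = complex_of_real x" by simp
    ultimately show "1 - F (tau (of_real (1 - x))) = F (tau (of_real x))"
      using fricke[of "tau (of_real (1 - x))"] by (simp only:)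
  qed simp
  ultimately have "((\<lambda>x. F (tau (of_real x))) \<longlongrightarrow> 1 - 0) (at_right 0)" by (rule Lim_transform_eventually)
  then show "((\<lambda>x. F (tau (of_real x))) \<longlongrightarrow> 1) (at_right 0)" by (simp only: diff_zero)
qed

end

section \<open>Identification on the imaginary axis\<close>

lemma cubic_period_real_continuous: "continuous_on {0<..} cubic_period_real"
proof -
  have "continuous_on {0<..} (\<lambda>x. cubic_period (complex_of_real x))"
    by (rule continuous_on_compose2[OF holomorphic_on_imp_continuous_on[OF cubic_period_holomorphic]])
       (auto intro!: continuous_intros simp: complex_nonpos_Reals_iff)
  then have "continuous_on {0<..} (\<lambda>x. Re (cubic_period (complex_of_real x)))" by (rule continuous_on_Re)
  then show ?thesis by (rule continuous_on_eq) (simp add: cubic_period_of_real)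
qed

text \<open>The ratio is unbounded towards 1 by the logarithmic estimate and takes reciprocal values
  at \<open>x\<close> and \<open>1 - x\<close>, so it also becomes arbitrarily small; the
  intermediate value theorem yields the rest.\<close>

lemma cubic_ratio_surj:
  assumes "s > 0"
  obtains x where "0 < x" "x < 1" "cubic_period_real (1 - x) / cubic_period_real x = s"
proof -
  define R where "R = (\<lambda>x. cubic_period_real (1 - x) / cubic_period_real x)"
  have pos: "cubic_period_real x > 0" if "x > 0" for x using cubic_period_real_pos that by blast
  have large: "\<exists>\<epsilon>. 0 < \<epsilon> \<and> \<epsilon> < 1/2 \<and> R (1 - \<epsilon>) \<ge> M" for M
  proof -
    have "filterlim (\<lambda>\<epsilon>::real. 13/100 * ln (1 / \<epsilon>)) at_top (at_right 0)" by real_asymp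
    then have "eventually (\<lambda>\<epsilon>. 13/100 * ln (1 / \<epsilon>) \<ge> M) (at_right 0)" by (simp add: filterlim_at_top)
    moreover have "eventually (\<lambda>\<epsilon>::real. 0 < \<epsilon> \<and> \<epsilon> < 1/2) (at_right 0)"
      by (intro eventually_at_rightI[of 0 "1/2"]) auto
    ultimately have "eventually (\<lambda>\<epsilon>. 0 < \<epsilon> \<and> \<epsilon> < 1/2 \<and> R (1 - \<epsilon>) \<ge> M) (at_right 0)"
    proof eventually_elim
      case (elim \<epsilon>)
      then have "13/100 * ln (1 / \<epsilon>) \<le> R (1 - \<epsilon>)"
        using cubic_ratio_log_lower_bound[of \<epsilon>] by (simp add: R_def)
      then show ?case using elim by simp
    qed
    then show ?thesis using eventually_happens trivial_limit_at_right_real by blast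
  qed
  obtain b where b: "0 < b" "b < 1/2" "R (1 - b) \<ge> s" using large by blast
  obtain d where d: "0 < d" "d < 1/2" "R (1 - d) \<ge> 1 / s" using large by blast
  have "0 < 1 / s" using assms by simp
  then have "R (1 - d) > 0" using d(3) by linarith
  then have "1 / R (1 - d) \<le> s" using d(3) assms by (simp add: field_simps)
  moreover have "R d = 1 / R (1 - d)" by (simp add: R_def)
  ultimately have Rd: "R d \<le> s" by simp
  have "\<exists>x. d \<le> x \<and> x \<le> 1 - b \<and> R x = s"
  proof (rule IVT')
    have "continuous_on {d..1 - b} (\<lambda>x. cubic_period_real (1 - x))"
      by (rule continuous_on_compose2[OF cubic_period_real_continuous]) (use b in \<open>auto intro!: continuous_intros\<close>)
    moreover have "continuous_on {d..1 - b} cubic_period_real"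
      by (rule continuous_on_subset[OF cubic_period_real_continuous]) (use d in auto)
    moreover have "\<forall>x\<in>{d..1 - b}. cubic_period_real x \<noteq> 0"
      using pos d by (metis atLeastAtMost_iff less_irrefl order_less_le_trans)
    ultimately show "continuous_on {d..1 - b} R" unfolding R_def by (rule continuous_on_divide)
  qed (use Rd b d in auto)
  then obtain x where "d \<le> x" "x \<le> 1 - b" "R x = s" by blast
  then show ?thesis using that[of x] b d by (simp add: R_def)
qed

context fricke_function
begin

text \<open>With \<open>t = 1 / (1 - x)\<close> as the fourth prevertex the parallelogram has
  exactly the side ratio in question, and \<open>u t\<close>, like \<open>F (tau x)\<close>, has a
  derivative in \<open>x\<close> proportional to \<open>(x * (1 - x)) powr (-2/3)\<close>. The
  combination \<open>D\<close> is therefore constant, and the limits at the two ends determine both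
  this constant and \<open>c2 / c\<close>.\<close>

lemma F_tau_eq_Pi_h_par:
  assumes "0 < x" "x < 1"
  shows "F (tau (of_real x)) = Pi_h_par (cubic_period_real (1 - x) / cubic_period_real x)"
proof -
  obtain u c where u: "\<And>x. x > 1 \<Longrightarrow> Pi_h_par (cubic_period_real (1 / x) / cubic_period_real (1 - 1 / x)) = 1 - u x"
    "(u \<longlongrightarrow> 1) at_top" "(u \<longlongrightarrow> 0) (at_right 1)" "c \<noteq> 0"
    "\<And>t. t > 1 \<Longrightarrow> (u has_vector_derivative c * of_real (t powr (-2/3) * (t - 1) powr (-2/3))) (at t)"
    by (rule Pi_h_par_value, rule that)
  obtain c2 where c2: "\<And>x. 0 < x \<Longrightarrow> x < 1 \<Longrightarrow>
    ((\<lambda>x. F (tau (of_real x))) has_vector_derivative c2 * of_real (x powr (-2/3) * (1 - x) powr (-2/3))) (at x)"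
    by (rule F_tau_deriv, rule that)
  define G where "G = (\<lambda>x. F (tau (of_real x)))"
  define D where "D = (\<lambda>x. G x - c2 / c * u (1 / (1 - x)))"
  have dD: "(D has_vector_derivative 0) (at x)" if x: "0 < x" "x < 1" for x
  proof -
    define t where "t = 1 / (1 - x)"
    have t: "t > 1" "t - 1 = x * t" using x by (auto simp: t_def field_simps)
    have "((\<lambda>x. 1 / (1 - x)) has_real_derivative t * t) (at x)"
      using x by (auto intro!: derivative_eq_intros simp: t_def)
    then have dt: "((\<lambda>x. 1 / (1 - x)) has_vector_derivative t * t) (at x)"
      by (simp add: has_real_derivative_iff_has_vector_derivative)
    have "(u has_vector_derivative c * of_real (t powr (-2/3) * (t - 1) powr (-2/3))) (at (1 / (1 - x)))"
      using u(5)[OF t(1)] unfolding t_def .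
    from vector_diff_chain_at[OF dt this]
    have "((\<lambda>x. u (1 / (1 - x))) has_vector_derivative (t * t) *\<^sub>R (c * of_real (t powr (-2/3) * (t - 1) powr (-2/3)))) (at x)"
      unfolding o_def .
    \<comment> \<open>By \<open>t - 1 = x * t\<close> the exponents of \<open>t\<close> add up to
      \<open>2 - 2/3 - 2/3 = 2/3\<close>, and \<open>t powr (2/3)\<close> is
      \<open>(1 - x) powr (-2/3)\<close>.\<close>
    moreover have "(t * t) * (t powr (-2/3) * (t - 1) powr (-2/3)) = x powr (-2/3) * (1 - x) powr (-2/3)"
    proof -
      have "(t * t) * (t powr (-2/3) * (t - 1) powr (-2/3)) = x powr (-2/3) * (t powr 2 * t powr (-2/3) * t powr (-2/3))"
        unfolding t(2) using t(1) x by (simp add: powr_mult power2_eq_square)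
      also have "t powr 2 * t powr (-2/3) * t powr (-2/3) = t powr (2/3)" unfolding powr_add[symmetric] by simp
      also have "t powr (2/3) = (1 - x) powr (-2/3)" using x by (simp add: t_def powr_divide powr_minus_divide)
      finally show ?thesis .
    qed
    then have "(t * t) *\<^sub>R (c * of_real (t powr (-2/3) * (t - 1) powr (-2/3))) = c * of_real (x powr (-2/3) * (1 - x) powr (-2/3))"
      by (simp add: scaleR_conv_of_real mult_ac flip: of_real_mult)
    ultimately have "((\<lambda>x. u (1 / (1 - x))) has_vector_derivative c * of_real (x powr (-2/3) * (1 - x) powr (-2/3))) (at x)"
      by simp
    then have "((\<lambda>x. c2 / c * u (1 / (1 - x))) has_vector_derivative c2 / c * (c * of_real (x powr (-2/3) * (1 - x) powr (-2/3)))) (at x)"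
      by (rule has_vector_derivative_mult_right)
    from has_vector_derivative_diff[OF c2[OF x] this] show ?thesis using u(4) by (simp add: D_def G_def)
  qed
  have dD': "(D has_vector_derivative 0) (at x within {0<..<1})" if "x \<in> {0<..<1}" for x
    by (rule has_vector_derivative_at_within) (use dD that in auto)
  obtain k where "\<And>x. x \<in> {0<..<1} \<Longrightarrow> D x = k"
    by (rule has_vector_derivative_zero_constant[OF convex_real_interval(8) dD'], assumption, rule that)
  then have k: "D x = k" if "0 < x" "x < 1" for x using that by simp
  have ev: "eventually (\<lambda>x::real. 0 < x \<and> x < 1) (at_right 0)"
    by (intro eventually_at_rightI[of 0 1]) auto
  have k1: "k = 1"
  proof -
    have "filterlim (\<lambda>x::real. 1 / (1 - x)) (at_right 1) (at_right 0)" by real_asymp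
    from filterlim_compose[OF u(3) this] have "((\<lambda>x. u (1 / (1 - x))) \<longlongrightarrow> 0) (at_right 0)" .
    with F_tau_limits(2) have "((\<lambda>x. G x - c2 / c * u (1 / (1 - x))) \<longlongrightarrow> 1 - c2 / c * 0) (at_right 0)"
      unfolding G_def by (intro tendsto_intros)
    moreover have "eventually (\<lambda>x. G x - c2 / c * u (1 / (1 - x)) = k) (at_right 0)"
      using ev by eventually_elim (use k in \<open>auto simp: D_def\<close>)
    ultimately have "((\<lambda>x::real. k) \<longlongrightarrow> 1 - c2 / c * 0) (at_right 0)" by (rule Lim_transform_eventually)
    then show ?thesis by (simp add: tendsto_const_iff)
  qed
  have k2: "k = - (c2 / c)"
  proof -
    have "filterlim (\<lambda>x::real. 1 / (1 - (1 - x))) at_top (at_right 0)" by real_asymp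
    from filterlim_compose[OF u(2) this] have "((\<lambda>x. u (1 / (1 - (1 - x)))) \<longlongrightarrow> 1) (at_right 0)" .
    with F_tau_limits(1) have "((\<lambda>x. G (1 - x) - c2 / c * u (1 / (1 - (1 - x)))) \<longlongrightarrow> 0 - c2 / c * 1) (at_right 0)"
      unfolding G_def by (intro tendsto_intros)
    moreover have "eventually (\<lambda>x. G (1 - x) - c2 / c * u (1 / (1 - (1 - x))) = k) (at_right 0)"
      using ev
    proof eventually_elim
      case (elim x)
      then show ?case using k[of "1 - x"] unfolding D_def by simp
    qed
    ultimately have "((\<lambda>x::real. k) \<longlongrightarrow> 0 - c2 / c * 1) (at_right 0)" by (rule Lim_transform_eventually)
    then show ?thesis by (simp add: tendsto_const_iff)
  qed
  have "c2 / c = -1" using k1 k2 by (metis minus_equation_iff)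
  then have "G x = 1 - u (1 / (1 - x))" using k[OF assms] k1 by (simp add: D_def eq_diff_eq)
  also have "\<dots> = Pi_h_par (cubic_period_real (1 - x) / cubic_period_real x)"
    using u(1)[of "1 / (1 - x)"] assms by simp
  finally show ?thesis by (simp only: G_def)
qed

text \<open>Every positive side ratio occurs, and the factor \<open>1 / sqrt 3\<close> in
  \<open>tau\<close> turns the ratio \<open>sqrt 3 * t\<close> into the height
  \<open>t\<close>.\<close>

lemma F_imaginary_axis:
  assumes "t > 0"
  shows "F (\<i> * of_real t) = Pi_h_par (sqrt 3 * t)"
proof -
  have "sqrt 3 * t > 0" using assms by simp
  then obtain x where x: "0 < x" "x < 1" and r: "cubic_period_real (1 - x) / cubic_period_real x = sqrt 3 * t"
    by (rule cubic_ratio_surj)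
  have "tau (of_real x) = \<i> * of_real (cubic_period_real (1 - x) / cubic_period_real x / sqrt 3)"
    using tau_of_real[OF x] by (simp add: mult.commute)
  also have "cubic_period_real (1 - x) / cubic_period_real x / sqrt 3 = t" unfolding r by simp
  finally show ?thesis using F_tau_eq_Pi_h_par[OF x] unfolding r by simp
qed

text \<open>\<open>F\<close> itself meets the conditions that define the extension, which settles
  existence. Uniqueness is the identity theorem, since \<open>\<i>\<close> is a limit point of the
  positive imaginary axis.\<close>

lemma Pi_h_par_ext_eq: "Pi_h_par_ext = restrict F upper_half_plane"
  unfolding Pi_h_par_ext_def
proof (rule the_equality)
  have "(\<i> * of_real t) \<in> upper_half_plane" if "t > 0" for t using that by (simp add: upper_half_plane_def)
  then show "restrict F upper_half_plane \<in> extensional upper_half_plane \<and>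
      restrict F upper_half_plane holomorphic_on upper_half_plane \<and>
      (\<forall>t>0. restrict F upper_half_plane (\<i> * complex_of_real t) = Pi_h_par (sqrt 3 * t))"
    using hol F_imaginary_axis by (auto intro: holomorphic_transform)
next
  fix G assume G: "G \<in> extensional upper_half_plane \<and> G holomorphic_on upper_half_plane \<and>
      (\<forall>t>0. G (\<i> * complex_of_real t) = Pi_h_par (sqrt 3 * t))"
  define U where "U = (\<lambda>t. \<i> * complex_of_real t) ` {0<..}"
  have lim: "\<i> islimpt U"
    unfolding islimpt_approachable
  proof (intro allI impI)
    fix e :: real assume e: "e > 0"
    define z where "z = \<i> * complex_of_real (1 + e / 2)"
    have "z \<in> U" unfolding U_def z_def using e by (intro imageI) simp
    moreover have "dist z \<i> = e / 2" using e by (simp add: z_def dist_norm norm_mult algebra_simps)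
    ultimately show "\<exists>x'\<in>U. x' \<noteq> \<i> \<and> dist x' \<i> < e" using e by (intro bexI[of _ z]) auto
  qed
  have "G z - F z = 0" if "z \<in> upper_half_plane" for z
  proof (rule analytic_continuation[OF _ open_uhp connected_uhp _ _ lim _ that])
    show "(\<lambda>z. G z - F z) holomorphic_on upper_half_plane" using G hol by (intro holomorphic_intros) auto
    show "U \<subseteq> upper_half_plane" "\<i> \<in> upper_half_plane" by (auto simp: U_def upper_half_plane_def)
    show "G z - F z = 0" if "z \<in> U" for z using that G F_imaginary_axis by (auto simp: U_def)
  qed
  then show "G = restrict F upper_half_plane"
    by (intro extensionalityI[of _ upper_half_plane]) (use G in auto)
qed

end

theorem theorem1p4:
  fixes F :: "complex \<Rightarrow> complex" and a :: "nat \<Rightarrow> complex" and \<alpha> :: real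
  assumes hol: "F holomorphic_on upper_half_plane"
    and alpha_pos: "\<alpha> > 0"
    and a0: "a 0 \<noteq> 0"
    and q_expansion: "\<exists>Y>0. \<forall>\<tau>. Im \<tau> > Y \<longrightarrow>
          (\<lambda>n. a n * exp (2 * of_real pi * \<i> * (of_nat n + of_real \<alpha>) * \<tau>)) sums F \<tau>"
    and fricke: "\<And>\<tau>. \<tau> \<in> upper_half_plane \<Longrightarrow> F (- 1 / (3 * \<tau>)) = 1 - F \<tau>"
    and nonvanishing: "\<And>\<tau>. \<tau> \<in> upper_half_plane \<Longrightarrow> deriv F \<tau> \<noteq> 0"
  shows "\<alpha> = 1 / 3 \<and> (\<forall>\<tau>\<in>upper_half_plane. F \<tau> = Pi_h_par_ext \<tau>)"
proof -
  interpret fricke_function F a \<alpha>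
    by unfold_locales (fact hol alpha_pos q_expansion fricke nonvanishing)+
  show ?thesis
  proof (intro conjI ballI)
    show "\<alpha> = 1 / 3" by (rule alpha_eq)
    show "F \<tau> = Pi_h_par_ext \<tau>" if "\<tau> \<in> upper_half_plane" for \<tau>
      unfolding Pi_h_par_ext_eq using that by simp
  qed
qed

end
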